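(* The following stochastic comparisons hold. (1) Fix $-1\le\mu<1/4$. If $\lambda,\lambda'\in\Lambda_\mu$ satisfy $\lambda\le\lambda'$, then $\tau_{\mu,\lambda}\le_{\mathrm{st}}\tau_{\mu,\lambda'}$. (2) If $-1/2<\alpha\le\alpha'<1$, then $\tau_{\alpha,\alpha}^{\mathrm{sym}}\le_{\mathrm{st}}\tau_{\alpha',\alpha'}^{\mathrm{sym}}$. In particular, the same orders hold for expectations and all positive moments: $\mathbb{E}[\tau_{\mu,\lambda}^q]\le\mathbb{E}[\tau_{\mu,\lambda'}^q]$ in (1) and $\mathbb{E}[(\tau^{\mathrm{sym}}_{\alpha,\alpha})^q]\le\mathbb{E}[(\tau^{\mathrm{sym}}_{\alpha',\alpha'})^q]$ in (2), for every $q>0$.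
   Context: For nonnegative random variables $X,Y$, $X\le_{\mathrm{st}}Y$ means $\mathbb{P}(X>T)\le\mathbb{P}(Y>T)$ for every $T\ge0$. For $\mu<1/4$ and $x\ge0$ let $c_\mu(x)=\cosh(\sqrt\mu\,x)$, $1$, $\cos(\sqrt{-\mu}\,x)$ and $s_\mu(x)=\sinh(\sqrt\mu\,x)/\sqrt\mu$, $x$, $\sin(\sqrt{-\mu}\,x)/\sqrt{-\mu}$, according to whether $\mu>0$, $\mu=0$, $\mu<0$. Let $$\Lambda_\mu:=\left\{\frac{\nu(1-\nu)}{1-4\mu}:\ \alpha_1,\alpha_2\in[-1,1],\ \alpha_1\alpha_2=\mu,\ \nu=\alpha_1+\alpha_2\right\}.$$ For $\lambda\in\Lambda_\mu$, $\{V^{(\mu,\lambda)}_t\}_{t\ge0}$ is a centered continuous Gaussian process with $V^{(\mu,\lambda)}_0=0$ and, for $s,t>0$ with $r=\min\{s,t\}$, $q=\max\{s,t\}$, $$\mathbb{E}[V^{(\mu,\lambda)}_sV^{(\mu,\lambda)}_t]=2r\,c_\mu\!\left(\log\tfrac qr\right)-\lambda\,C_\mu(s,t),\qquad C_\mu(s,t)=r\left(2c_\mu\!\left(\log\tfrac qr\right)+s_\mu\!\left(\log\tfrac qr\right)\right).$$ (This is the covariance of the process $\int_0^t(1,-1)(t/s)^A\,dB_s$, where $A=\begin{pmatrix}0&\alpha_1\\ \alpha_2&0\end{pmatrix}$, $x^A=e^{(\log x)A}$, $B$ is a two-dimensional standard Brownian motion, $\alpha_1\alpha_2=\mu$ and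 $\lambda=\nu(1-\nu)/(1-4\mu)$, $\nu=\alpha_1+\alpha_2$.) Put $\tau_{\mu,\lambda}:=\inf\{t>0:|V^{(\mu,\lambda)}_t|\ge2\}$. For $\alpha\in(-1/2,1)$, let $V^{(\alpha)}=\{V_t^{(\alpha)}\}_{t\ge0}$ be the limiting difference process for equal parameters $\alpha_1=\alpha_2=\alpha$, that is: for $\alpha\in(-1/2,1/2)$, $V^{(\alpha)}_t=\int_0^t(1,-1)(t/s)^{A}\,dB_s$ with $A=\begin{pmatrix}0&\alpha\\ \alpha&0\end{pmatrix}$ and $B$ a two-dimensional standard Brownian motion; for $\alpha\in[1/2,1)$, $V_t^{(\alpha)}=\sqrt2\int_0^t(t/s)^{-\alpha}\,dW_s$ with $W$ a standard Brownian motion; $V_0^{(\alpha)}=0$, and continuous modifications are taken. Put $\tau^{\mathrm{sym}}_{\alpha,\alpha}:=\inf\{t>0:|V_t^{(\alpha)}|\ge2\}$. *)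

theory Defs
  imports "HOL-Probability.Probability"
begin

text \<open>Hitting times may be infinite, so nonnegative random variables take values in
  \<^typ>\<open>ennreal\<close>. The two variables may live on different probability spaces, since the order
  depends on the laws only. Measurability is part of the definition because \<^const>\<open>measure\<close> is
  \<open>0\<close> on non-measurable sets.\<close>

definition st_le :: "'a measure \<Rightarrow> ('a \<Rightarrow> ennreal) \<Rightarrow> 'b measure \<Rightarrow> ('b \<Rightarrow> ennreal) \<Rightarrow> bool" where
  "st_le M X N Y \<longleftrightarrow>
     X \<in> borel_measurable M \<and> Y \<in> borel_measurable N \<and>
     (\<forall>T::real. T \<ge> 0 \<longrightarrow>
        measure M {\<omega> \<in> space M. X \<omega> > ennreal T} \<le> measure N {\<omega> \<in> space N. Y \<omega> > ennreal T})"

text \<open>Real power on \<open>[0, \<infinity>]\<close>, used for exponents \<open>q > 0\<close> only, whence \<open>\<infinity>\<^sup>q = \<infinity>\<close>.\<close>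

definition ennreal_rpow :: "ennreal \<Rightarrow> real \<Rightarrow> ennreal" where
  "ennreal_rpow x q = (if x = \<infinity> then \<infinity> else ennreal (enn2real x powr q))"

definition moment :: "'a measure \<Rightarrow> ('a \<Rightarrow> ennreal) \<Rightarrow> real \<Rightarrow> ennreal" where
  "moment M X q = (\<integral>\<^sup>+\<omega>. ennreal_rpow (X \<omega>) q \<partial>M)"

text \<open>The infimum of the empty set is \<open>\<infinity>\<close>.\<close>

definition hit_time :: "(real \<Rightarrow> 'a \<Rightarrow> real) \<Rightarrow> 'a \<Rightarrow> ennreal" where
  "hit_time V \<omega> = Inf (ennreal ` {t. t > 0 \<and> \<bar>V t \<omega>\<bar> \<ge> 2})"

text \<open>Processes are indexed by \<open>[0, \<infinity>)\<close>; values at negative times are irrelevant.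
  Both processes of interest start at \<open>0\<close> and have continuous paths for every outcome.\<close>

definition continuous_process_from_0 :: "'a measure \<Rightarrow> (real \<Rightarrow> 'a \<Rightarrow> real) \<Rightarrow> bool" where
  "continuous_process_from_0 M V \<longleftrightarrow>
     (\<forall>t\<ge>0. V t \<in> borel_measurable M) \<and>
     (\<forall>\<omega>\<in>space M. V 0 \<omega> = 0 \<and> continuous_on {0..} (\<lambda>t. V t \<omega>))"

text \<open>A Gaussian variable is allowed to be degenerate, i.e. almost surely constant.\<close>

definition gaussian_rv :: "'a measure \<Rightarrow> ('a \<Rightarrow> real) \<Rightarrow> bool" where
  "gaussian_rv M X \<longleftrightarrow> X \<in> borel_measurable M \<and>
     ((\<exists>m. AE \<omega> in M. X \<omega> = m) \<or>
      (\<exists>m \<sigma>. \<sigma> > 0 \<and> distributed M lborel X (\<lambda>x. ennreal (normal_density m \<sigma> x))))"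

definition centered_gaussian_process :: "'a measure \<Rightarrow> (real \<Rightarrow> 'a \<Rightarrow> real) \<Rightarrow> bool" where
  "centered_gaussian_process M V \<longleftrightarrow>
     (\<forall>t\<ge>0. (\<integral>\<omega>. V t \<omega> \<partial>M) = 0) \<and>
     (\<forall>I a. finite I \<and> I \<subseteq> {0..} \<longrightarrow> gaussian_rv M (\<lambda>\<omega>. \<Sum>t\<in>I. a t * V t \<omega>))"

definition c_fun :: "real \<Rightarrow> real \<Rightarrow> real" where
  "c_fun \<mu> x = (if \<mu> > 0 then cosh (sqrt \<mu> * x) else if \<mu> = 0 then 1 else cos (sqrt (- \<mu>) * x))"

definition s_fun :: "real \<Rightarrow> real \<Rightarrow> real" where
  "s_fun \<mu> x = (if \<mu> > 0 then sinh (sqrt \<mu> * x) / sqrt \<mu> else if \<mu> = 0 then x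
                else sin (sqrt (- \<mu>) * x) / sqrt (- \<mu>))"

definition Lambda_set :: "real \<Rightarrow> real set" where
  "Lambda_set \<mu> = {\<nu> * (1 - \<nu>) / (1 - 4 * \<mu>) | \<nu> \<alpha>1 \<alpha>2.
     \<alpha>1 \<in> {-1..1} \<and> \<alpha>2 \<in> {-1..1} \<and> \<alpha>1 * \<alpha>2 = \<mu> \<and> \<nu> = \<alpha>1 + \<alpha>2}"

definition C_cov :: "real \<Rightarrow> real \<Rightarrow> real \<Rightarrow> real" where
  "C_cov \<mu> s t = (let r = min s t; q = max s t in
     r * (2 * c_fun \<mu> (ln (q / r)) + s_fun \<mu> (ln (q / r))))"

definition V_cov :: "real \<Rightarrow> real \<Rightarrow> real \<Rightarrow> real \<Rightarrow> real" where
  "V_cov \<mu> lam s t = (let r = min s t; q = max s t in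
     2 * r * c_fun \<mu> (ln (q / r)) - lam * C_cov \<mu> s t)"

definition V_process :: "'a measure \<Rightarrow> real \<Rightarrow> real \<Rightarrow> (real \<Rightarrow> 'a \<Rightarrow> real) \<Rightarrow> bool" where
  "V_process M \<mu> lam V \<longleftrightarrow>
     prob_space M \<and> continuous_process_from_0 M V \<and> centered_gaussian_process M V \<and>
     (\<forall>s>0. \<forall>t>0. (\<integral>\<omega>. V s \<omega> * V t \<omega> \<partial>M) = V_cov \<mu> lam s t)"

text \<open>Standard Brownian motion in a Euclidean space: all coordinates of all increments over
  disjoint intervals are jointly independent and \<open>N(0, t - s)\<close>-distributed. For \<^typ>\<open>real\<close>,
  whose only basis vector is \<open>1\<close>, this is one-dimensional Brownian motion.\<close>

definition brownian_motion :: "'a measure \<Rightarrow> (real \<Rightarrow> 'a \<Rightarrow> 'e::euclidean_space) \<Rightarrow> bool" where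
  "brownian_motion M B \<longleftrightarrow>
     prob_space M \<and>
     (\<forall>t\<ge>0. B t \<in> borel_measurable M) \<and>
     (AE \<omega> in M. B 0 \<omega> = 0 \<and> continuous_on {0..} (\<lambda>t. B t \<omega>)) \<and>
     (\<forall>n (p::nat \<Rightarrow> real). p 0 \<ge> 0 \<and> strict_mono_on {..n} p \<longrightarrow>
        prob_space.indep_vars M (\<lambda>_. borel)
          (\<lambda>(k, b) \<omega>. (B (p (Suc k)) \<omega> - B (p k) \<omega>) \<bullet> b) ({..<n} \<times> Basis)) \<and>
     (\<forall>s t. 0 \<le> s \<and> s < t \<longrightarrow> (\<forall>b\<in>Basis.
        distributed M lborel (\<lambda>\<omega>. (B t \<omega> - B s \<omega>) \<bullet> b)
          (\<lambda>x. ennreal (normal_density 0 (sqrt (t - s)) x))))"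

text \<open>A list of triples \<open>(a, b, c)\<close> encodes the step function \<open>\<Sum> c 1\<^bsub>(a, b]\<^esub>\<close>.\<close>

definition step_list_on :: "real \<Rightarrow> (real \<times> real \<times> 'e) list \<Rightarrow> bool" where
  "step_list_on t xs \<longleftrightarrow> (\<forall>(a, b, c)\<in>set xs. 0 \<le> a \<and> a \<le> b \<and> b \<le> t)"

definition step_fun :: "(real \<times> real \<times> 'e::euclidean_space) list \<Rightarrow> real \<Rightarrow> 'e" where
  "step_fun xs u = (\<Sum>(a, b, c)\<leftarrow>xs. indicator {a<..b} u *\<^sub>R c)"

definition step_integral ::
    "(real \<Rightarrow> 'a \<Rightarrow> 'e::euclidean_space) \<Rightarrow> (real \<times> real \<times> 'e) list \<Rightarrow> 'a \<Rightarrow> real" where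
  "step_integral B xs \<omega> = (\<Sum>(a, b, c)\<leftarrow>xs. c \<bullet> (B b \<omega> - B a \<omega>))"

text \<open>\<open>X\<close> is (a version of) \<open>\<integral>\<^sub>0\<^sup>t f(s) dB\<^sub>s\<close>, with \<open>f\<close> deterministic and vector valued
  (paired with \<open>dB\<close> by the inner product): the \<open>L\<^sup>2\<close> limit of the integrals of step functions
  converging to \<open>f\<close> in \<open>L\<^sup>2\<close> on \<open>[0, t]\<close>.\<close>

definition has_wiener_integral ::
    "'a measure \<Rightarrow> (real \<Rightarrow> 'a \<Rightarrow> 'e::euclidean_space) \<Rightarrow> (real \<Rightarrow> 'e) \<Rightarrow> real \<Rightarrow> ('a \<Rightarrow> real) \<Rightarrow> bool" where
  "has_wiener_integral M B f t X \<longleftrightarrow>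
     set_borel_measurable lborel {0..t} f \<and> X \<in> borel_measurable M \<and>
     (\<exists>S. (\<forall>n::nat. step_list_on t (S n)) \<and>
        (\<lambda>n. \<integral>\<^sup>+u\<in>{0..t}. ennreal ((norm (f u - step_fun (S n) u))\<^sup>2) \<partial>lborel) \<longlonglongrightarrow> 0 \<and>
        (\<lambda>n. \<integral>\<^sup>+\<omega>. ennreal ((X \<omega> - step_integral B (S n) \<omega>)\<^sup>2) \<partial>M) \<longlonglongrightarrow> 0)"

definition matrix_exp :: "real^'n^'n \<Rightarrow> real^'n^'n" where
  "matrix_exp A = (\<Sum>k. (1 / fact k) *\<^sub>R ((\<lambda>P. A ** P) ^^ k) (mat 1))"

definition matrix_rpow :: "real \<Rightarrow> real^'n^'n \<Rightarrow> real^'n^'n" where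
  "matrix_rpow x A = matrix_exp (ln x *\<^sub>R A)"

definition A_mat :: "real \<Rightarrow> real \<Rightarrow> real^2^2" where
  "A_mat \<alpha>1 \<alpha>2 = vector [vector [0, \<alpha>1], vector [\<alpha>2, 0]]"

text \<open>Here \<open>-1/2 < \<alpha> < 1\<close>. Wiener integrals are determined only almost surely for each \<open>t\<close>;
  \<open>V\<close> is a continuous modification.\<close>

definition sym_V_process :: "'a measure \<Rightarrow> real \<Rightarrow> (real \<Rightarrow> 'a \<Rightarrow> real) \<Rightarrow> bool" where
  "sym_V_process M \<alpha> V \<longleftrightarrow>
     prob_space M \<and> continuous_process_from_0 M V \<and>
     (if \<alpha> < 1/2
      then \<exists>B :: real \<Rightarrow> 'a \<Rightarrow> real^2. brownian_motion M B \<and>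
             (\<forall>t>0. has_wiener_integral M B
                (\<lambda>s. vector [1, -1] v* matrix_rpow (t / s) (A_mat \<alpha> \<alpha>)) t (V t))
      else \<exists>W :: real \<Rightarrow> 'a \<Rightarrow> real. brownian_motion M W \<and>
             (\<forall>t>0. \<exists>X. has_wiener_integral M W (\<lambda>s. (t / s) powr (- \<alpha>)) t X \<and>
                (AE \<omega> in M. V t \<omega> = sqrt 2 * X \<omega>)))"

end

theory Submission
  imports Defs
begin

text \<open>Both comparisons are instances of Anderson's inequality: if the covariance of a centered Gaussian
vector is increased by a positive semidefinite matrix, the probability that it lies in a symmetric
box cannot increase. By continuity of paths, the event that a process has not hit \<open>\<plusminus>2\<close> up to time \<open>T\<close> is a
monotone limit of events \<open>\<bar>V t\<bar> \<le> b\<close> for \<open>t\<close> in a finite set and \<open>b < 2\<close>. Hence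
hitting times are ordered as soon as the difference of the covariance kernels is positive
semidefinite on finite sets of positive times; moments follow by the layer cake formula.

In the first family the difference of two covariances is \<open>(\<lambda>' - \<lambda>) C_cov \<mu>\<close>, and \<open>C_cov \<mu> s t\<close> is
\<open>(1 - 4\<mu>)\<close> times the integral over \<open>0 < u < min s t\<close> of
\<open>s_fun \<mu> (ln (s/u)) * s_fun \<mu> (ln (t/u))\<close>, a Gram kernel. In the symmetric family the covariance is
\<open>2 \<integral> (s/u)\<^sup>-\<^sup>\<alpha> (t/u)\<^sup>-\<^sup>\<alpha> du\<close> (after a logarithmic change of time, a stationary
Ornstein-Uhlenbeck process with spectral density \<open>2 / ((\<alpha> + 1/2)\<^sup>2 + \<xi>\<^sup>2)\<close>, which decreases in
\<open>\<alpha>\<close>); the difference for \<open>\<alpha> < \<alpha>'\<close> is a positive multiple of the Gram kernel of the functions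
\<open>(t/u)\<^sup>-\<^sup>\<alpha> - (t/u)\<^sup>-\<^sup>\<alpha>'\<close>.

Anderson's inequality is proved one Gaussian coordinate at a time. A centered Gaussian vector with
covariance \<open>\<Sum> a\<^sub>k a\<^sub>k\<^sup>T\<close> is \<open>\<Sum> \<xi>\<^sub>k a\<^sub>k\<close> with independent standard normal \<open>\<xi>\<^sub>k\<close>, so that its box
probability arises from the indicator of the box by the successive smoothings
\<open>F \<mapsto> (z \<mapsto> E F (z + \<xi> a\<^sub>k))\<close>. By the one-dimensional Prekopa-Leindler inequality each smoothing
preserves even log-concave functions. Such functions are maximal at \<open>0\<close>, so no further smoothing
raises the value at \<open>0\<close>; and the additional covariance amounts precisely to further smoothings.

Laws enter only through characteristic functions of linear combinations. These determine the
probabilities of rectangles, which is all that is compared, and they pass to \<open>L\<^sup>2\<close> limits, which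
gives the law of Wiener integrals as limits of step integrals.\<close>

section \<open>Moments from the stochastic order\<close>

lemma emeasure_lborel_atLeast: "emeasure lborel {a::real..} = \<infinity>"
proof (rule ccontr)
  assume "emeasure lborel {a..} \<noteq> \<infinity>"
  then obtain n where n: "emeasure lborel {a..} < of_nat n"
    using ennreal_Ex_less_of_nat by (auto simp: less_top)
  have "ennreal (real n) = emeasure lborel {a..a + real n}" by simp
  also have "\<dots> \<le> emeasure lborel {a..}" by (rule emeasure_mono) auto
  finally show False using n by (simp add: ennreal_of_nat_eq_real_of_nat)
qed

text \<open>Write \<open>f x\<close> as the length of \<open>{s. 0 \<le> s < f x}\<close> and exchange the integrals. The formula serves twice:
for moments, and to integrate a one-dimensional inequality between superlevel sets.\<close>

lemma nn_integral_layer_cake: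
  fixes f :: "'a \<Rightarrow> ennreal"
  assumes M: "sigma_finite_measure M" and f[measurable]: "f \<in> borel_measurable M"
  shows "(\<integral>\<^sup>+x. f x \<partial>M)
           = (\<integral>\<^sup>+s. indicator {0..} s * emeasure M {x \<in> space M. ennreal s < f x} \<partial>lborel)"
proof -
  interpret sigma_finite_measure M by fact
  interpret pair_sigma_finite lborel M ..
  have pt: "y = (\<integral>\<^sup>+s. indicator {s. 0 \<le> s \<and> ennreal s < y} s \<partial>lborel)" for y :: ennreal
  proof (cases y)
    case (real r)
    have "{s. 0 \<le> s \<and> ennreal s < y} = {0..<r}"
      using real by (auto simp: ennreal_less_iff)
    then show ?thesis using real by simp
  next
    case top
    have "{s. 0 \<le> s \<and> ennreal s < y} = {0..}"
      using top by auto
    then show ?thesis using top emeasure_lborel_atLeast[of 0] by simp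
  qed
  have "(\<integral>\<^sup>+x. f x \<partial>M) = (\<integral>\<^sup>+x. \<integral>\<^sup>+s. indicator {s. 0 \<le> s \<and> ennreal s < f x} s \<partial>lborel \<partial>M)"
    using pt by simp
  also have "\<dots> = (\<integral>\<^sup>+s. \<integral>\<^sup>+x. indicator {s. 0 \<le> s \<and> ennreal s < f x} s \<partial>M \<partial>lborel)"
    by (rule Fubini') measurable
  also have "\<dots> = (\<integral>\<^sup>+s. indicator {0..} s * emeasure M {x \<in> space M. ennreal s < f x} \<partial>lborel)"
  proof (rule nn_integral_cong)
    fix s :: real
    have "(\<integral>\<^sup>+x. indicator {s. 0 \<le> s \<and> ennreal s < f x} s \<partial>M)
        = (\<integral>\<^sup>+x. indicator {0..} s * indicator {x \<in> space M. ennreal s < f x} x \<partial>M)"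
      by (rule nn_integral_cong) (auto simp: indicator_def)
    also have "\<dots> = indicator {0..} s * emeasure M {x \<in> space M. ennreal s < f x}"
      by (subst nn_integral_cmult) (auto)
    finally show "(\<integral>\<^sup>+x. indicator {s. 0 \<le> s \<and> ennreal s < f x} s \<partial>M) =
      indicator {0..} s * emeasure M {x \<in> space M. ennreal s < f x}" .
  qed
  finally show ?thesis .
qed

lemma ennreal_rpow_measurable [measurable]: "(\<lambda>x. ennreal_rpow x q) \<in> borel_measurable borel"
  unfolding ennreal_rpow_def by measurable

text \<open>The superlevel sets of a power of \<open>X\<close> are superlevel sets of \<open>X\<close>, so the stochastic order is
inherited by powers.\<close>

lemma less_ennreal_rpow_iff:
  assumes "q > 0" "s \<ge> 0"
  shows "ennreal s < ennreal_rpow x q \<longleftrightarrow> ennreal (s powr (1 / q)) < x"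
proof (cases x)
  case (real r)
  have "s < r powr q \<longleftrightarrow> s powr (1 / q) < r"
  proof -
    have "s < r powr q \<longleftrightarrow> s powr (1/q) < (r powr q) powr (1/q)"
      using assms real by (metis powr_less_mono2 powr_mono2 not_less powr_ge_zero divide_pos_pos zero_less_one less_imp_le)
    also have "(r powr q) powr (1/q) = r" using assms real by (simp add: powr_powr)
    finally show ?thesis .
  qed
  then show ?thesis using real assms by (simp add: ennreal_rpow_def ennreal_less_iff)
next
  case top
  then show ?thesis by (simp add: ennreal_rpow_def)
qed

lemma st_le_imp_moment_le:
  assumes M: "prob_space M" and N: "prob_space N" and st: "st_le M X N Y" and q: "q > 0"
  shows "moment M X q \<le> moment N Y q"
proof -
  interpret M: prob_space M by fact
  interpret N: prob_space N by fact
  have [measurable]: "X \<in> borel_measurable M" "Y \<in> borel_measurable N"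
    using st by (auto simp: st_le_def)
  have "emeasure M {x \<in> space M. ennreal s < ennreal_rpow (X x) q}
      \<le> emeasure N {x \<in> space N. ennreal s < ennreal_rpow (Y x) q}" if "s \<ge> 0" for s
    using st that q
    by (simp add: less_ennreal_rpow_iff M.emeasure_eq_measure N.emeasure_eq_measure st_le_def)
  then show ?thesis
    unfolding moment_def
    by (subst (1 2) nn_integral_layer_cake)
       (auto simp: M.sigma_finite_measure_axioms N.sigma_finite_measure_axioms
             intro!: nn_integral_mono split: split_indicator)
qed

section \<open>Hitting times and finitely many time points\<close>

text \<open>Continuity is used to the right of \<open>T\<close>: a path inside the open strip on \<open>[0, T]\<close> stays inside for a
short time longer, which makes the hitting time strictly larger than \<open>T\<close>.\<close>

lemma hit_time_gt_iff:
  assumes V: "continuous_process_from_0 M V" and w: "\<omega> \<in> space M" and T: "T \<ge> 0"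
  shows "hit_time V \<omega> > ennreal T \<longleftrightarrow> (\<forall>t\<in>{0..T}. \<bar>V t \<omega>\<bar> < 2)"
proof
  have V0: "V 0 \<omega> = 0" and cont: "continuous_on {0..} (\<lambda>t. V t \<omega>)"
    using V w by (auto simp: continuous_process_from_0_def)
  {
    assume "hit_time V \<omega> > ennreal T"
    show "\<forall>t\<in>{0..T}. \<bar>V t \<omega>\<bar> < 2"
    proof (rule ccontr, clarsimp simp: not_less)
      fix t assume t: "0 \<le> t" "t \<le> T" "2 \<le> \<bar>V t \<omega>\<bar>"
      with V0 have "t > 0" by (cases "t = 0") auto
      then have "hit_time V \<omega> \<le> ennreal t"
        unfolding hit_time_def using t by (intro Inf_lower) auto
      also have "\<dots> \<le> ennreal T" using t by (simp add: ennreal_leI)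
      finally show False using \<open>hit_time V \<omega> > ennreal T\<close> by simp
    qed
  }
  {
    assume *: "\<forall>t\<in>{0..T}. \<bar>V t \<omega>\<bar> < 2"
    have "((\<lambda>t. \<bar>V t \<omega>\<bar>) \<longlongrightarrow> \<bar>V T \<omega>\<bar>) (at T within {0..})"
      using cont T by (intro tendsto_rabs) (auto simp: continuous_on_def)
    then have "eventually (\<lambda>t. \<bar>V t \<omega>\<bar> < 2) (at T within {0..})"
      using * T by (intro order_tendstoD) auto
    then obtain d where d: "d > 0" "\<And>t. t \<ge> 0 \<Longrightarrow> t \<noteq> T \<Longrightarrow> dist t T < d \<Longrightarrow> \<bar>V t \<omega>\<bar> < 2"
      unfolding eventually_at by auto
    have "ennreal (T + d) \<le> hit_time V \<omega>"
      unfolding hit_time_def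
    proof (rule Inf_greatest)
      fix y assume "y \<in> ennreal ` {t. 0 < t \<and> 2 \<le> \<bar>V t \<omega>\<bar>}"
      then obtain t where t: "0 < t" "2 \<le> \<bar>V t \<omega>\<bar>" "y = ennreal t" by auto
      show "ennreal (T + d) \<le> y" unfolding t(3)
      proof (rule ennreal_leI, rule ccontr)
        assume "\<not> T + d \<le> t"
        moreover have "\<not> t \<le> T" using t *[rule_format, of t] by auto
        ultimately show False using t d(2)[of t] by (auto simp: dist_real_def)
      qed
    qed
    moreover have "ennreal T < ennreal (T + d)" using d T by (simp add: ennreal_less_iff)
    ultimately show "hit_time V \<omega> > ennreal T" by simp
  }
qed

text \<open>An increasing sequence of finite sets that exhausts the rationals in \<open>(0, T)\<close>. Time \<open>0\<close> is left
out because covariances are prescribed at positive times only.\<close>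

definition rat_grid :: "real \<Rightarrow> nat \<Rightarrow> real set" where
  "rat_grid T m = from_nat_into \<rat> ` {..m} \<inter> {0<..<T}"

lemma finite_rat_grid: "finite (rat_grid T m)"
  by (auto simp: rat_grid_def)

lemma rat_grid_mono: "m \<le> m' \<Longrightarrow> rat_grid T m \<subseteq> rat_grid T m'"
  by (auto simp: rat_grid_def)

lemma rat_grid_pos: "rat_grid T m \<subseteq> {0<..}"
  by (auto simp: rat_grid_def)

lemma Union_rat_grid: "(\<Union>m. rat_grid T m) = \<rat> \<inter> {0<..<T}"
proof -
  have "(\<Union>m. from_nat_into (\<rat>::real set) ` {..m}) = range (from_nat_into \<rat>)"
    by auto
  also have "\<dots> = (\<rat>::real set)"
    by (intro range_from_nat_into countable_rat) (auto intro: Rats_0)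
  finally show ?thesis by (auto simp: rat_grid_def)
qed

text \<open>The supremum of \<open>\<bar>V\<bar>\<close> over the compact \<open>[0, T]\<close> is attained, hence it is less than \<open>2\<close> exactly if it is
at most some \<open>2 - 1/(n+1)\<close>, and a non-strict bound may be tested on a dense set of times. The
closed levels are essential: with strict inequalities on a dense set the limit could touch \<open>2\<close>.\<close>

lemma hit_time_gt_eq_Union_Inter:
  assumes V: "continuous_process_from_0 M V" and T: "T \<ge> 0"
  shows "{\<omega> \<in> space M. hit_time V \<omega> > ennreal T}
       = (\<Union>n. \<Inter>m. {\<omega> \<in> space M. \<forall>t\<in>rat_grid T m. \<bar>V t \<omega>\<bar> \<le> 2 - 1 / real (Suc n)})"
    (is "?L = ?R")
proof (intro set_eqI iffI)
  fix \<omega> assume w: "\<omega> \<in> ?L"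
  then have ws: "\<omega> \<in> space M" by auto
  have cont: "continuous_on {0..T} (\<lambda>t. \<bar>V t \<omega>\<bar>)"
    using V ws by (auto simp: continuous_process_from_0_def intro!: continuous_on_rabs
        elim!: continuous_on_subset)
  have lt: "\<forall>t\<in>{0..T}. \<bar>V t \<omega>\<bar> < 2" using w hit_time_gt_iff[OF V ws T] by auto
  obtain x where x: "x \<in> {0..T}" "\<And>y. y \<in> {0..T} \<Longrightarrow> \<bar>V y \<omega>\<bar> \<le> \<bar>V x \<omega>\<bar>"
    using continuous_attains_sup[OF _ _ cont] T by auto
  from lt x have "2 - \<bar>V x \<omega>\<bar> > 0" by auto
  then obtain n where n: "inverse (real (Suc n)) < 2 - \<bar>V x \<omega>\<bar>" using reals_Archimedean by blast
  have "\<bar>V t \<omega>\<bar> \<le> 2 - 1 / real (Suc n)" if "t \<in> rat_grid T m" for t m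
    using x(2)[of t] that n by (auto simp: rat_grid_def divide_inverse)
  with ws show "\<omega> \<in> ?R" by auto
next
  fix \<omega> assume "\<omega> \<in> ?R"
  then obtain n where ws: "\<omega> \<in> space M"
    and le: "\<And>m t. t \<in> rat_grid T m \<Longrightarrow> \<bar>V t \<omega>\<bar> \<le> 2 - 1 / real (Suc n)" by auto
  have V0: "V 0 \<omega> = 0" and cont: "continuous_on {0..} (\<lambda>t. V t \<omega>)"
    using V ws by (auto simp: continuous_process_from_0_def)
  have "\<bar>V t \<omega>\<bar> < 2" if t: "t \<in> {0..T}" for t
  proof (cases "T = 0")
    case True
    then show ?thesis using t V0 by auto
  next
    case False
    with T have T: "T > 0" by auto
    have cl: "closure (\<rat> \<inter> {0<..<T}) = {0..T}"
    proof -
      have "closure ({0<..<T} \<inter> \<rat>) = closure {0<..<T}"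
        by (rule closure_open_Int_superset) (auto simp: Rats_closure_real)
      then show ?thesis using T by (simp add: Int_commute)
    qed
    have "\<bar>V t \<omega>\<bar> \<le> 2 - 1 / real (Suc n)"
    proof (rule continuous_le_on_closure[where S = "\<rat> \<inter> {0<..<T}" and f = "\<lambda>t. \<bar>V t \<omega>\<bar>"])
      show "continuous_on (closure (\<rat> \<inter> {0<..<T})) (\<lambda>t. \<bar>V t \<omega>\<bar>)"
        using cont unfolding cl by (intro continuous_intros) (auto elim: continuous_on_subset)
      show "t \<in> closure (\<rat> \<inter> {0<..<T})" using t cl by simp
      show "\<bar>V u \<omega>\<bar> \<le> 2 - 1 / real (Suc n)" if "u \<in> \<rat> \<inter> {0<..<T}" for u
        using that le unfolding Union_rat_grid[symmetric] by auto
    qed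
    also have "\<dots> < 2" by simp
    finally show ?thesis .
  qed
  then show "\<omega> \<in> ?L" using hit_time_gt_iff[OF V ws T] ws by auto
qed

text \<open>Continuity of the measure, from above in the set of times and from below in the level.\<close>

lemma prob_hit_time_gt_limit:
  assumes M: "prob_space M" and V: "continuous_process_from_0 M V" and T: "T \<ge> 0"
  defines "A n m \<equiv> {\<omega> \<in> space M. \<forall>t\<in>rat_grid T m. \<bar>V t \<omega>\<bar> \<le> 2 - 1 / real (Suc n)}"
  shows "{\<omega> \<in> space M. hit_time V \<omega> > ennreal T} \<in> sets M"
    and "(\<lambda>m. measure M (A n m)) \<longlonglongrightarrow> measure M (\<Inter>m. A n m)"
    and "(\<lambda>n. measure M (\<Inter>m. A n m)) \<longlonglongrightarrow> measure M {\<omega> \<in> space M. hit_time V \<omega> > ennreal T}"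
proof -
  interpret prob_space M by fact
  have [measurable]: "A n m \<in> sets M" for n m
  proof -
    have "V t \<in> borel_measurable M" if "t \<in> rat_grid T m" for t
      using V rat_grid_pos that by (force simp: continuous_process_from_0_def)
    then show ?thesis unfolding A_def
      by (intro sets.sets_Collect_finite_All finite_rat_grid) measurable
  qed
  have eq: "{\<omega> \<in> space M. hit_time V \<omega> > ennreal T} = (\<Union>n. \<Inter>m. A n m)"
    unfolding A_def by (rule hit_time_gt_eq_Union_Inter[OF V T])
  show "{\<omega> \<in> space M. hit_time V \<omega> > ennreal T} \<in> sets M"
    unfolding eq by measurable
  show "(\<lambda>m. measure M (A n m)) \<longlonglongrightarrow> measure M (\<Inter>m. A n m)"
  proof (intro finite_Lim_measure_decseq)
    show "decseq (A n)"
      unfolding decseq_def A_def using rat_grid_mono by blast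
  qed auto
  have "incseq (\<lambda>n. \<Inter>m. A n m)"
  proof (rule incseq_SucI)
    fix n
    have "2 - 1 / real (Suc n) \<le> 2 - 1 / real (Suc (Suc n))"
      by (simp add: field_simps)
    then show "(\<Inter>m. A n m) \<subseteq> (\<Inter>m. A (Suc n) m)"
      unfolding A_def by (force simp del: of_nat_Suc)
  qed
  then show "(\<lambda>n. measure M (\<Inter>m. A n m)) \<longlonglongrightarrow> measure M {\<omega> \<in> space M. hit_time V \<omega> > ennreal T}"
    unfolding eq by (intro finite_Lim_measure_incseq) auto
qed

lemma hit_time_measurable:
  assumes M: "prob_space M" and V: "continuous_process_from_0 M V"
  shows "hit_time V \<in> borel_measurable M"
proof (rule borel_measurableI_greater)
  fix y :: ennreal
  show "{x \<in> space M. y < hit_time V x} \<in> sets M"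
    by (cases y) (auto intro: prob_hit_time_gt_limit(1)[OF M V])
qed

text \<open>The tails of the hitting times are iterated limits of box probabilities, and limits preserve
inequalities.\<close>

lemma st_le_hit_timeI:
  assumes M: "prob_space M" and N: "prob_space N"
    and V: "continuous_process_from_0 M V" and V': "continuous_process_from_0 N V'"
    and le: "\<And>I b. finite I \<Longrightarrow> I \<subseteq> {0<..} \<Longrightarrow>
      measure M {\<omega> \<in> space M. \<forall>t\<in>I. \<bar>V t \<omega>\<bar> \<le> b} \<le> measure N {\<omega> \<in> space N. \<forall>t\<in>I. \<bar>V' t \<omega>\<bar> \<le> b}"
  shows "st_le M (hit_time V) N (hit_time V')"
  unfolding st_le_def
proof (intro conjI allI impI hit_time_measurable M N V V')
  fix T :: real assume T: "T \<ge> 0"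
  note lim = prob_hit_time_gt_limit[OF M V T] and lim' = prob_hit_time_gt_limit[OF N V' T]
  show "measure M {\<omega> \<in> space M. ennreal T < hit_time V \<omega>}
      \<le> measure N {\<omega> \<in> space N. ennreal T < hit_time V' \<omega>}"
    by (intro LIMSEQ_le[OF lim(3) lim'(3)] LIMSEQ_le[OF lim(2) lim'(2)] exI allI impI le
        finite_rat_grid rat_grid_pos)
qed

section \<open>The Prekopa-Leindler inequality on the line\<close>

text \<open>A set of diameter \<open>c\<close> lies in an interval of length \<open>c\<close>. In this form the measure of a set is
controlled by pairs of points, without knowing its end points.\<close>

lemma emeasure_le_if_differences_le:
  fixes A :: "real set"
  assumes ne: "A \<noteq> {}" and le: "\<And>a b. a \<in> A \<Longrightarrow> b \<in> A \<Longrightarrow> b - a \<le> c"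
  shows "emeasure lborel A \<le> ennreal c"
proof -
  from ne obtain a0 where a0: "a0 \<in> A" by auto
  have bdd: "bdd_above A" "bdd_below A"
    using le[OF a0] le[OF _ a0] by (auto intro!: bdd_aboveI[of _ "a0 + c"] bdd_belowI[of _ "a0 - c"] simp: algebra_simps)
  have "x - c \<le> Inf A" if "x \<in> A" for x
    using ne le[OF _ that] by (intro cInf_greatest) (auto simp: algebra_simps)
  then have "Sup A \<le> Inf A + c"
    using ne by (intro cSup_least) (auto simp: algebra_simps)
  moreover have "Inf A \<le> Sup A"
    using a0 bdd by (meson cInf_lower cSup_upper order_trans)
  moreover have "emeasure lborel A \<le> emeasure lborel {Inf A..Sup A}"
    using bdd by (intro emeasure_mono) (auto intro: cInf_lower cSup_upper)
  ultimately show ?thesis by (auto intro: order_trans ennreal_leI)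
qed

text \<open>Brunn-Minkowski on the line, with an interval in place of the Minkowski combination. Two points of
\<open>A\<close> and two points of \<open>B\<close> produce two points of \<open>H\<close>, and \<open>H\<close> contains everything between them; this bounds
weighted sums of differences by the length of \<open>H\<close>. The bounds for \<open>A\<close> and \<open>B\<close> follow one after the
other, by the preceding lemma.\<close>

lemma brunn_minkowski_interval:
  fixes A B H :: "real set"
  assumes H: "is_interval H" and A: "A \<noteq> {}" and B: "B \<noteq> {}" and t: "0 < t" "t < 1"
    and sub: "\<And>a b. a \<in> A \<Longrightarrow> b \<in> B \<Longrightarrow> (1 - t) * a + t * b \<in> H"
  shows "ennreal (1 - t) * emeasure lborel A + ennreal t * emeasure lborel B \<le> emeasure lborel H"
proof (cases "emeasure lborel H")
  case (real r)
  have [measurable]: "H \<in> sets borel"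
    using H by (rule real_interval_borel_measurable)
  have le: "(1 - t) * (a' - a) + t * (b' - b) \<le> r"
    if "a \<in> A" "a' \<in> A" "b \<in> B" "b' \<in> B" for a a' b b'
  proof -
    define p where "p = (1 - t) * a + t * b"
    define q where "q = (1 - t) * a' + t * b'"
    have "q - p \<le> r"
    proof (cases "p \<le> q")
      case True
      have "p \<in> H" "q \<in> H" using sub that by (auto simp: p_def q_def)
      then have "{p..q} \<subseteq> H"
        by (meson H atLeastAtMost_iff mem_is_interval_1_I subsetI)
      then have "emeasure lborel {p..q} \<le> emeasure lborel H" by (intro emeasure_mono) auto
      then show ?thesis using True real by simp
    qed (use real in auto)
    then show ?thesis by (simp add: p_def q_def algebra_simps)
  qed
  have A_le: "emeasure lborel A \<le> ennreal ((r - t * (b' - b)) / (1 - t))" if "b \<in> B" "b' \<in> B" for b b'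
    using le that t by (intro emeasure_le_if_differences_le A) (auto simp: field_simps)
  obtain b0 where b0: "b0 \<in> B" using B by auto
  obtain i where i: "i \<ge> 0" "emeasure lborel A = ennreal i"
    using A_le[OF b0 b0] by (cases "emeasure lborel A") (auto simp: top_unique)
  have "emeasure lborel B \<le> ennreal ((r - (1 - t) * i) / t)"
  proof (rule emeasure_le_if_differences_le[OF B])
    fix b b' assume bb: "b \<in> B" "b' \<in> B"
    obtain a0 where a0: "a0 \<in> A" using A by auto
    have "0 \<le> (r - t * (b' - b)) / (1 - t)" using le[OF a0 a0 bb] t by simp
    then have "i \<le> (r - t * (b' - b)) / (1 - t)"
      using A_le[OF bb] i by simp
    then show "b' - b \<le> (r - (1 - t) * i) / t" using t by (simp add: field_simps)
  qed
  moreover have "0 \<le> (r - (1 - t) * i) / t"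
  proof -
    have "i \<le> (r - t * (b0 - b0)) / (1 - t)"
      using A_le[OF b0 b0] i real t by simp
    then show ?thesis using t by (simp add: field_simps)
  qed
  ultimately obtain j where j: "j \<ge> 0" "emeasure lborel B = ennreal j" "j \<le> (r - (1 - t) * i) / t"
    by (cases "emeasure lborel B") (auto simp: top_unique)
  have "(1 - t) * i + t * j \<le> r" using j t by (simp add: field_simps)
  then show ?thesis using real i j t
    by (simp add: ennreal_mult[symmetric] ennreal_plus[symmetric] del: ennreal_plus)
qed simp

text \<open>If both functions have supremum \<open>1\<close>, their superlevel sets at a level below \<open>1\<close> are nonempty, so the
inequality for sets can be integrated over all levels. The normalization is what makes the sum of
the two integrals appear.\<close>

lemma prekopa_leindler_normalized:
  fixes f g h :: "real \<Rightarrow> real"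
  assumes t: "0 < t" "t < 1"
    and [measurable]: "f \<in> borel_measurable borel" "g \<in> borel_measurable borel" "h \<in> borel_measurable borel"
    and h: "\<And>s. 0 \<le> s \<Longrightarrow> is_interval {x. s < h x}"
    and f1: "\<And>x. f x \<le> 1" and g1: "\<And>x. g x \<le> 1"
    and fs: "\<And>s. s < 1 \<Longrightarrow> \<exists>x. s < f x" and gs: "\<And>s. s < 1 \<Longrightarrow> \<exists>x. s < g x"
    and fgh: "\<And>s x y. 0 \<le> s \<Longrightarrow> s < f x \<Longrightarrow> s < g y \<Longrightarrow> s < h ((1 - t) * x + t * y)"
  shows "ennreal (1 - t) * (\<integral>\<^sup>+x. f x \<partial>lborel) + ennreal t * (\<integral>\<^sup>+x. g x \<partial>lborel) \<le> (\<integral>\<^sup>+x. h x \<partial>lborel)"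
proof -
  have *: "ennreal (1 - t) * emeasure lborel {x. ennreal s < ennreal (f x)}
      + ennreal t * emeasure lborel {x. ennreal s < ennreal (g x)}
      \<le> emeasure lborel {x. ennreal s < ennreal (h x)}" if s: "s \<ge> 0" for s
  proof (cases "s < 1")
    case True
    show ?thesis
      using fs[OF True] gs[OF True] h[OF s] fgh[OF s] t s
      by (intro brunn_minkowski_interval) (auto simp: ennreal_less_iff)
  next
    case False
    then have "f x \<le> s" "g x \<le> s" for x using f1[of x] g1[of x] by auto
    then have "{x. ennreal s < ennreal (f x)} = {}" "{x. ennreal s < ennreal (g x)} = {}"
      using s by (simp_all add: ennreal_less_iff not_less)
    then show ?thesis by simp
  qed
  have sf: "sigma_finite_measure (lborel :: real measure)" ..
  show ?thesis
    apply (subst (1 2 3) nn_integral_layer_cake[OF sf])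
    apply measurable
    apply (subst (1 2) nn_integral_cmult[symmetric])
    apply measurable
    apply (subst nn_integral_add[symmetric])
    apply measurable
    using * by (auto intro!: nn_integral_mono split: split_indicator)
qed

lemma weighted_am_gm:
  fixes a b :: real
  assumes "0 \<le> a" "0 \<le> b" "0 < t" "t < 1"
  shows "a powr (1 - t) * b powr t \<le> (1 - t) * a + t * b"
proof (cases "a = 0 \<or> b = 0")
  case False
  then show ?thesis using assms by (intro Youngs_inequality_0) auto
qed (use assms in auto)

text \<open>Divide by the suprema to reach the normalized case, and pass from the arithmetic to the geometric
mean of the two integrals.\<close>

lemma prekopa_leindler:
  fixes f g h :: "real \<Rightarrow> real"
  assumes t: "0 < t" "t < 1"
    and int: "integrable lborel f" "integrable lborel g" "integrable lborel h"
    and h: "\<And>s. 0 \<le> s \<Longrightarrow> is_interval {x. s < h x}"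
    and f0: "\<And>x. 0 \<le> f x" and g0: "\<And>x. 0 \<le> g x" and h0: "\<And>x. 0 \<le> h x"
    and fB: "\<And>x. f x \<le> C" and gB: "\<And>x. g x \<le> C"
    and fgh: "\<And>x y. f x powr (1 - t) * g y powr t \<le> h ((1 - t) * x + t * y)"
  shows "(\<integral>x. f x \<partial>lborel) powr (1 - t) * (\<integral>x. g x \<partial>lborel) powr t \<le> (\<integral>x. h x \<partial>lborel)"
proof (cases "(\<forall>x. f x = 0) \<or> (\<forall>x. g x = 0)")
  case True
  then show ?thesis using h0 t by (auto intro!: Bochner_Integration.integral_nonneg)
next
  case False
  have [measurable]: "f \<in> borel_measurable borel" "g \<in> borel_measurable borel" "h \<in> borel_measurable borel"
    using int by auto
  define F G where "F = (SUP x. f x)" and "G = (SUP x. g x)"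
  have bdd: "bdd_above (range f)" "bdd_above (range g)" using fB gB by (auto intro!: bdd_aboveI)
  have F_le: "f x \<le> F" and G_le: "g x \<le> G" for x
    unfolding F_def G_def using bdd by (auto intro: cSUP_upper)
  have pos: "F > 0" "G > 0"
    using False f0 g0 F_le G_le by (metis less_le order_trans order_antisym)+
  have ex: "\<exists>x. s < f x / F" "\<exists>x. s < g x / G" if "s < 1" for s
  proof -
    have "s * F < (SUP x. f x)" "s * G < (SUP x. g x)"
      using that pos by (auto simp: F_def[symmetric] G_def[symmetric])
    then show "\<exists>x. s < f x / F" "\<exists>x. s < g x / G"
      using pos bdd by (auto simp: less_cSUP_iff field_simps)
  qed
  define H where "H = F powr (1 - t) * G powr t"
  have H: "H > 0" using pos by (simp add: H_def)
  have "ennreal (1 - t) * (\<integral>\<^sup>+x. f x / F \<partial>lborel) + ennreal t * (\<integral>\<^sup>+x. g x / G \<partial>lborel)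
      \<le> (\<integral>\<^sup>+x. h x / H \<partial>lborel)"
  proof (rule prekopa_leindler_normalized[OF t])
    fix s :: real assume s: "0 \<le> s"
    have "{x. s < h x / H} = {x. s * H < h x}" using H by (auto simp: field_simps)
    then show "is_interval {x. s < h x / H}" using h[of "s * H"] s H by simp
    fix x y assume *: "s < f x / F" "s < g y / G"
    have "s = s powr (1 - t) * s powr t" using s by (simp add: powr_add[symmetric])
    also have "\<dots> \<le> s powr (1 - t) * (g y / G) powr t"
      using * s t pos by (intro mult_left_mono powr_mono2) auto
    also have "\<dots> < (f x / F) powr (1 - t) * (g y / G) powr t"
      using * s t pos by (intro mult_strict_right_mono powr_less_mono2) auto
    also have "\<dots> = (f x powr (1 - t) * g y powr t) / H"
      using pos f0[of x] g0[of y] by (simp add: powr_divide H_def)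
    also have "\<dots> \<le> h ((1 - t) * x + t * y) / H"
      using fgh[of x y] H by (intro divide_right_mono) auto
    finally show "s < h ((1 - t) * x + t * y) / H" .
  qed (use F_le G_le pos ex in auto)
  also have "(\<integral>\<^sup>+x. f x / F \<partial>lborel) = ennreal ((\<integral>x. f x \<partial>lborel) / F)"
    using int f0 pos by (subst nn_integral_eq_integral) auto
  also have "(\<integral>\<^sup>+x. g x / G \<partial>lborel) = ennreal ((\<integral>x. g x \<partial>lborel) / G)"
    using int g0 pos by (subst nn_integral_eq_integral) auto
  also have "(\<integral>\<^sup>+x. h x / H \<partial>lborel) = ennreal ((\<integral>x. h x \<partial>lborel) / H)"
    using int h0 H by (subst nn_integral_eq_integral) auto
  finally have le: "(1 - t) * ((\<integral>x. f x \<partial>lborel) / F) + t * ((\<integral>x. g x \<partial>lborel) / G) \<le> (\<integral>x. h x \<partial>lborel) / H"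
    using t pos H f0 g0 h0
    by (simp add: ennreal_mult[symmetric] ennreal_plus[symmetric] Bochner_Integration.integral_nonneg del: ennreal_plus)
  have "((\<integral>x. f x \<partial>lborel) / F) powr (1 - t) * ((\<integral>x. g x \<partial>lborel) / G) powr t \<le> (\<integral>x. h x \<partial>lborel) / H"
    using f0 g0 pos t
    by (intro order_trans[OF weighted_am_gm le] divide_nonneg_pos Bochner_Integration.integral_nonneg) auto
  then show ?thesis using pos H f0 g0
    by (simp add: powr_divide Bochner_Integration.integral_nonneg H_def field_simps)
qed

section \<open>Gaussian smoothing of even log-concave functions\<close>

text \<open>Points are plain functions on the index set, so the convex combination is written coordinatewise.
The inequality is in multiplicative form and therefore also covers functions with zeros, such as
the indicator of a convex set.\<close>

definition log_concave :: "(('i \<Rightarrow> real) \<Rightarrow> real) \<Rightarrow> bool" where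
  "log_concave F \<longleftrightarrow> (\<forall>z. 0 \<le> F z) \<and>
     (\<forall>x y t. 0 < t \<longrightarrow> t < 1 \<longrightarrow> F x powr (1 - t) * F y powr t \<le> F (\<lambda>i. (1 - t) * x i + t * y i))"

text \<open>The function \<open>z \<mapsto> E F (z + \<xi> a)\<close> for a standard normal variable \<open>\<xi>\<close>.\<close>

definition gaussian_smoothing :: "('i \<Rightarrow> real) \<Rightarrow> (('i \<Rightarrow> real) \<Rightarrow> real) \<Rightarrow> ('i \<Rightarrow> real) \<Rightarrow> real" where
  "gaussian_smoothing a F z = (\<integral>x. F (\<lambda>i. z i + x * a i) * std_normal_density x \<partial>lborel)"

text \<open>The square is convex; the gap is \<open>(1 - t) t (x - y)\<^sup>2 / 2\<close> in the exponent.\<close>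

lemma std_normal_density_log_concave:
  assumes "0 < t" "t < 1"
  shows "std_normal_density x powr (1 - t) * std_normal_density y powr t
    \<le> std_normal_density ((1 - t) * x + t * y)"
proof -
  define c where "c = 1 / sqrt (2 * pi)"
  have c: "c > 0" by (simp add: c_def)
  have "std_normal_density x powr (1 - t) * std_normal_density y powr t
      = (c powr (1 - t) * c powr t) * exp ((1 - t) * (- x\<^sup>2 / 2) + t * (- y\<^sup>2 / 2))"
    unfolding std_normal_density_def c_def[symmetric]
    using c by (simp add: powr_mult exp_powr_real exp_add[symmetric] ac_simps)
  also have "c powr (1 - t) * c powr t = c" using c by (simp add: powr_add[symmetric])
  also have "(1 - t) * (- x\<^sup>2 / 2) + t * (- y\<^sup>2 / 2) \<le> - ((1 - t) * x + t * y)\<^sup>2 / 2"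
  proof -
    have "- ((1 - t) * x + t * y)\<^sup>2 / 2 - ((1 - t) * (- x\<^sup>2 / 2) + t * (- y\<^sup>2 / 2))
        = (1 - t) * t * (x - y)\<^sup>2 / 2"
      by (simp add: power2_eq_square field_simps)
    moreover have "0 \<le> (1 - t) * t * (x - y)\<^sup>2 / 2" using assms by simp
    ultimately show ?thesis by linarith
  qed
  finally show ?thesis using c by (simp add: std_normal_density_def c_def[symmetric])
qed

text \<open>Log-concavity along a line makes superlevel sets intervals. This yields both the hypothesis of the
Prekopa-Leindler inequality and, below, Borel measurability along lines for free.\<close>

lemma superlevel_interval:
  fixes k :: "real \<Rightarrow> real"
  assumes k0: "\<And>x. 0 \<le> k x"
    and k: "\<And>x y t. 0 < t \<Longrightarrow> t < 1 \<Longrightarrow> k x powr (1 - t) * k y powr t \<le> k ((1 - t) * x + t * y)"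
  shows "is_interval {x. s < k x}"
proof (cases "s < 0")
  case True
  then have "{x. s < k x} = UNIV" using k0 by (auto intro: less_le_trans)
  then show ?thesis by simp
next
  case False
  have "convex {x. s < k x}"
  proof (rule convexI, clarsimp)
    fix x y u v :: real assume *: "s < k x" "s < k y" "0 \<le> u" "0 \<le> v" "u + v = 1"
    show "s < k (u * x + v * y)"
    proof (cases "u = 0 \<or> v = 0")
      case False
      with * have v: "0 < v" "v < 1" "u = 1 - v" by auto
      have "s = s powr (1 - v) * s powr v" using \<open>\<not> s < 0\<close> by (simp add: powr_add[symmetric])
      also have "\<dots> \<le> s powr (1 - v) * k y powr v"
        using * v \<open>\<not> s < 0\<close> by (intro mult_left_mono powr_mono2) auto
      also have "\<dots> < k x powr (1 - v) * k y powr v"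
        using * v \<open>\<not> s < 0\<close> by (intro mult_strict_right_mono powr_less_mono2) auto
      also have "\<dots> \<le> k (u * x + v * y)" using k v by auto
      finally show ?thesis .
    qed (use * in auto)
  qed
  then show ?thesis by (simp add: is_interval_convex_1)
qed

context
  fixes F :: "('i \<Rightarrow> real) \<Rightarrow> real" and a :: "'i \<Rightarrow> real"
  assumes F: "log_concave F" and F1: "\<And>z. F z \<le> 1"
begin

private definition "fibre z x = F (\<lambda>i. z i + x * a i) * std_normal_density x"

private lemma fibre_nonneg: "0 \<le> fibre z x"
  using F by (simp add: fibre_def log_concave_def)

private lemma fibre_le: "fibre z x \<le> std_normal_density x"
  using F1 mult_right_mono[OF F1, of "std_normal_density x"] by (simp add: fibre_def)

private lemma fibre_mid:
  assumes t: "0 < t" "t < 1"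
  shows "fibre z x powr (1 - t) * fibre w y powr t
    \<le> fibre (\<lambda>i. (1 - t) * z i + t * w i) ((1 - t) * x + t * y)"
proof -
  have nn: "0 \<le> F u" for u using F by (simp add: log_concave_def)
  have "fibre z x powr (1 - t) * fibre w y powr t
      = (F (\<lambda>i. z i + x * a i) powr (1 - t) * F (\<lambda>i. w i + y * a i) powr t)
        * (std_normal_density x powr (1 - t) * std_normal_density y powr t)"
    using nn by (simp add: fibre_def powr_mult)
  also have "\<dots> \<le> F (\<lambda>i. (1 - t) * (z i + x * a i) + t * (w i + y * a i))
      * std_normal_density ((1 - t) * x + t * y)"
    using F t nn by (intro mult_mono std_normal_density_log_concave) (auto simp: log_concave_def)
  also have "(\<lambda>i. (1 - t) * (z i + x * a i) + t * (w i + y * a i))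
      = (\<lambda>i. ((1 - t) * z i + t * w i) + ((1 - t) * x + t * y) * a i)"
    by (auto simp: algebra_simps)
  finally show ?thesis by (simp add: fibre_def)
qed

private lemma fibre_interval: "is_interval {x. s < fibre z x}"
proof (rule superlevel_interval[OF fibre_nonneg])
  fix x y t :: real assume t: "0 < t" "t < 1"
  show "fibre z x powr (1 - t) * fibre z y powr t \<le> fibre z ((1 - t) * x + t * y)"
    using fibre_mid[OF t, of z x z y] by (simp add: algebra_simps)
qed

private lemma fibre_measurable [measurable]: "fibre z \<in> borel_measurable borel"
  using real_interval_borel_measurable[OF fibre_interval]
  by (auto simp: borel_measurable_iff_greater)

private lemma fibre_integrable: "integrable lborel (fibre z)"
  by (rule Bochner_Integration.integrable_bound[where f = std_normal_density])
     (auto simp: fibre_nonneg fibre_le)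

lemma nn_integral_gaussian_smoothing:
  "(\<integral>\<^sup>+x. ennreal (F (\<lambda>i. z i + x * a i)) \<partial>density lborel (\<lambda>x. ennreal (std_normal_density x)))
    = ennreal (gaussian_smoothing a F z)"
proof -
  have F0: "0 \<le> F z" for z using F by (simp add: log_concave_def)
  have "(\<lambda>x. fibre z x / std_normal_density x) \<in> borel_measurable borel" by measurable
  then have [measurable]: "(\<lambda>x. F (\<lambda>i. z i + x * a i)) \<in> borel_measurable borel"
    using normal_density_pos[of 1 0] by (simp add: fibre_def less_imp_neq[symmetric])
  have "(\<integral>\<^sup>+x. ennreal (F (\<lambda>i. z i + x * a i)) \<partial>density lborel (\<lambda>x. ennreal (std_normal_density x)))
      = (\<integral>\<^sup>+x. ennreal (fibre z x) \<partial>lborel)"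
    by (subst nn_integral_density) (auto simp: fibre_def ennreal_mult F0 mult.commute)
  also have "\<dots> = ennreal (gaussian_smoothing a F z)"
    by (subst nn_integral_eq_integral[OF fibre_integrable])
       (auto simp: fibre_nonneg, simp add: gaussian_smoothing_def fibre_def[abs_def])
  finally show ?thesis .
qed

text \<open>Prekopa's theorem for one Gaussian direction: the integrands over the lines through \<open>x\<close>, \<open>y\<close> and
their convex combination satisfy the hypothesis of the Prekopa-Leindler inequality, because \<open>F\<close> and
the normal density are log-concave.\<close>

lemma log_concave_gaussian_smoothing: "log_concave (gaussian_smoothing a F)"
proof -
  have eq: "gaussian_smoothing a F z = (\<integral>x. fibre z x \<partial>lborel)" for z
    by (simp add: gaussian_smoothing_def fibre_def)
  have 1: "std_normal_density x \<le> 1 / sqrt (2 * pi)" for x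
    by (simp add: std_normal_density_def divide_right_mono)
  show ?thesis
    unfolding log_concave_def eq
    by (auto simp: Bochner_Integration.integral_nonneg fibre_nonneg intro!: prekopa_leindler fibre_integrable fibre_interval
        fibre_mid order_trans[OF fibre_le 1])
qed

lemma gaussian_smoothing_le:
  assumes "\<And>x. F (\<lambda>i. z i + x * a i) \<le> C"
  shows "gaussian_smoothing a F z \<le> C"
proof -
  have "gaussian_smoothing a F z = (\<integral>x. fibre z x \<partial>lborel)"
    by (simp add: gaussian_smoothing_def fibre_def)
  also have "\<dots> \<le> (\<integral>x. C * std_normal_density x \<partial>lborel)"
    by (intro integral_mono fibre_integrable) (auto simp: fibre_def intro!: mult_right_mono assms)
  finally show ?thesis by simp
qed

end

text \<open>Substitute \<open>-x\<close> in the integral; the normal density is even.\<close>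

lemma gaussian_smoothing_even:
  assumes even: "\<And>z. F (\<lambda>i. - z i) = F z"
  shows "gaussian_smoothing a F (\<lambda>i. - z i) = gaussian_smoothing a F z"
proof -
  have "gaussian_smoothing a F (\<lambda>i. - z i)
      = (\<integral>x. F (\<lambda>i. - z i + (- x) * a i) * std_normal_density (- x) \<partial>lborel)"
    unfolding gaussian_smoothing_def
    by (subst lborel_integral_real_affine[where c = "-1" and t = 0]) auto
  also have "\<dots> = gaussian_smoothing a F z"
    unfolding gaussian_smoothing_def
  proof (intro Bochner_Integration.integral_cong refl)
    fix x
    show "F (\<lambda>i. - z i + (- x) * a i) * std_normal_density (- x)
      = F (\<lambda>i. z i + x * a i) * std_normal_density x"
      using even[of "\<lambda>i. z i + x * a i"] by (simp add: std_normal_density_def algebra_simps)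
  qed
  finally show ?thesis .
qed

text \<open>The origin is the midpoint of \<open>z\<close> and \<open>-z\<close>, where \<open>F\<close> takes the same value.\<close>

lemma even_log_concave_le_0:
  assumes F: "log_concave F" and even: "\<And>z. F (\<lambda>i. - z i) = F z"
  shows "F z \<le> F (\<lambda>i. 0)"
proof -
  have "F z = F z powr (1 - 1/2) * F (\<lambda>i. - z i) powr (1/2)"
    using F even by (simp add: log_concave_def powr_add[symmetric])
  also have "\<dots> \<le> F (\<lambda>i. (1 - 1/2) * z i + 1/2 * - z i)"
    using F[unfolded log_concave_def, THEN conjunct2, rule_format, of "1/2" z "\<lambda>i. - z i"] by simp
  also have "\<dots> = F (\<lambda>i. 0)" by simp
  finally show ?thesis .
qed

section \<open>Positive semidefinite kernels on finite sets\<close>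

definition psd_on :: "'i set \<Rightarrow> ('i \<Rightarrow> 'i \<Rightarrow> real) \<Rightarrow> bool" where
  "psd_on J K \<longleftrightarrow> (\<forall>i\<in>J. \<forall>j\<in>J. K i j = K j i) \<and> (\<forall>c. 0 \<le> (\<Sum>i\<in>J. \<Sum>j\<in>J. c i * c j * K i j))"

lemma psd_onD:
  assumes "psd_on J K"
  shows "i \<in> J \<Longrightarrow> j \<in> J \<Longrightarrow> K i j = K j i"
    and "0 \<le> (\<Sum>i\<in>J. \<Sum>j\<in>J. c i * c j * K i j)"
  using assms unfolding psd_on_def by blast+

text \<open>The quadratic form as a polynomial of degree two in the coordinate \<open>c p\<close>.\<close>

lemma quadratic_form_insert:
  fixes K :: "'i \<Rightarrow> 'i \<Rightarrow> real"
  assumes "finite J" "p \<notin> J" and sym: "\<And>i. i \<in> J \<Longrightarrow> K p i = K i p"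
  shows "(\<Sum>i\<in>insert p J. \<Sum>j\<in>insert p J. c i * c j * K i j)
    = (c p)\<^sup>2 * K p p + 2 * c p * (\<Sum>i\<in>J. c i * K i p) + (\<Sum>i\<in>J. \<Sum>j\<in>J. c i * c j * K i j)"
proof -
  have "(\<Sum>i\<in>J. c p * c i * K p i) = c p * (\<Sum>i\<in>J. c i * K i p)"
    unfolding sum_distrib_left by (intro sum.cong) (auto simp: sym)
  moreover have "(\<Sum>i\<in>J. c i * c p * K i p) = c p * (\<Sum>i\<in>J. c i * K i p)"
    unfolding sum_distrib_left by (intro sum.cong) auto
  ultimately show ?thesis
    using assms by (simp add: sum.distrib power2_eq_square algebra_simps)
qed

text \<open>Otherwise the quadratic form would be affine and nonconstant in the coordinate at \<open>p\<close>, hence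
negative somewhere.\<close>

lemma psd_on_zero_diagonal:
  assumes "finite J" "p \<notin> J" and psd: "psd_on (insert p J) K" and 0: "K p p = 0" and i: "i \<in> J"
  shows "K i p = 0"
proof (rule ccontr)
  assume ne: "K i p \<noteq> 0"
  \<comment> \<open>With \<open>x\<close> at \<open>p\<close> and \<open>1\<close> at \<open>i\<close>, the quadratic form is \<open>2 x K i p + K i i = -1\<close>.\<close>
  define x where "x = - (K i i + 1) / (2 * K i p)"
  define c where "c = (\<lambda>j. if j = p then x else if j = i then 1 else (0::real))"
  have c: "c p = x" "\<And>j. j \<in> J \<Longrightarrow> c j = (if j = i then 1 else 0)"
    using assms by (auto simp: c_def)
  have "0 \<le> (\<Sum>i\<in>insert p J. \<Sum>j\<in>insert p J. c i * c j * K i j)"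
    by (rule psd_onD(2)[OF psd])
  also have "\<dots> = (c p)\<^sup>2 * K p p + 2 * c p * (\<Sum>i\<in>J. c i * K i p) + (\<Sum>i\<in>J. \<Sum>j\<in>J. c i * c j * K i j)"
    by (intro quadratic_form_insert assms psd_onD(1)[OF psd]) auto
  also have "(\<Sum>j\<in>J. c j * K j p) = (\<Sum>j\<in>J. if j = i then K i p else 0)"
    by (intro sum.cong) (auto simp: c)
  also have "\<dots> = K i p" using i \<open>finite J\<close> by simp
  also have "(\<Sum>j\<in>J. \<Sum>k\<in>J. c j * c k * K j k) = (\<Sum>j\<in>J. \<Sum>k\<in>J. if k = i then if j = i then K i i else 0 else 0)"
    by (intro sum.cong) (auto simp: c)
  also have "\<dots> = K i i" using i \<open>finite J\<close> by simp
  finally have "0 \<le> 2 * x * K i p + K i i" using 0 c by simp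
  moreover have "2 * x * K i p = - (K i i + 1)" using ne by (simp add: x_def)
  ultimately show False by simp
qed

text \<open>Minimize the quadratic form over the coordinate at \<open>p\<close>. If \<open>K p p = 0\<close>, then division by zero gives
\<open>0\<close> and the kernel is just restricted to \<open>J\<close>, as it should be.\<close>

lemma psd_on_schur_complement:
  assumes "finite J" "p \<notin> J" and psd: "psd_on (insert p J) K"
  shows "psd_on J (\<lambda>i j. K i j - K i p * K j p / K p p)"
  unfolding psd_on_def
proof (intro conjI ballI allI)
  fix c :: "'a \<Rightarrow> real"
  define S where "S = (\<Sum>i\<in>J. c i * K i p)"
  \<comment> \<open>The value at \<open>p\<close> that minimizes the quadratic form.\<close>
  define d where "d = c(p := - S / K p p)"
  have d: "d p = - S / K p p" "\<And>j. j \<in> J \<Longrightarrow> d j = c j"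
    using assms by (auto simp: d_def)
  have "0 \<le> (\<Sum>i\<in>insert p J. \<Sum>j\<in>insert p J. d i * d j * K i j)"
    by (rule psd_onD(2)[OF psd])
  also have "\<dots> = (d p)\<^sup>2 * K p p + 2 * d p * (\<Sum>i\<in>J. d i * K i p) + (\<Sum>i\<in>J. \<Sum>j\<in>J. d i * d j * K i j)"
    by (intro quadratic_form_insert assms psd_onD(1)[OF psd]) auto
  also have "(\<Sum>i\<in>J. d i * K i p) = S" by (simp add: d S_def)
  also have "(\<Sum>i\<in>J. \<Sum>j\<in>J. d i * d j * K i j) = (\<Sum>i\<in>J. \<Sum>j\<in>J. c i * c j * K i j)"
    by (intro sum.cong) (auto simp: d)
  also have "(d p)\<^sup>2 * K p p + 2 * d p * S = - (S * S / K p p)"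
    by (simp add: d power2_eq_square field_simps)
  also have "S * S / K p p = (\<Sum>i\<in>J. \<Sum>j\<in>J. c i * c j * (K i p * K j p / K p p))"
    unfolding S_def sum_product sum_divide_distrib by (intro sum.cong) auto
  finally show "0 \<le> (\<Sum>i\<in>J. \<Sum>j\<in>J. c i * c j * (K i j - K i p * K j p / K p p))"
    by (simp add: right_diff_distrib sum_subtractf)
qed (simp add: psd_onD(1)[OF psd] mult.commute)

text \<open>Cholesky decomposition: split off the rank-one kernel \<open>K i p * K j p / K p p\<close>, which carries the row
and the column of \<open>p\<close>, and continue with the Schur complement.\<close>

lemma psd_on_imp_gram:
  assumes "finite J" "psd_on J K"
  shows "\<exists>n (a :: nat \<Rightarrow> 'i \<Rightarrow> real). \<forall>i\<in>J. \<forall>j\<in>J. K i j = (\<Sum>k<n. a k i * a k j)"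
  using assms
proof (induction J arbitrary: K rule: finite_induct)
  case (insert p J)
  obtain n and a :: "nat \<Rightarrow> 'i \<Rightarrow> real" where
    a: "\<And>i j. i \<in> J \<Longrightarrow> j \<in> J \<Longrightarrow> K i j - K i p * K j p / K p p = (\<Sum>k<n. a k i * a k j)"
    using insert.IH[OF psd_on_schur_complement[OF insert.hyps insert.prems]] by metis
  have sym: "K i j = K j i" if "i \<in> insert p J" "j \<in> insert p J" for i j
    using psd_onD(1)[OF insert.prems that] .
  have Kpp: "0 \<le> K p p"
  proof -
    have "0 \<le> (\<Sum>i\<in>insert p J. \<Sum>j\<in>insert p J. of_bool (i = p) * of_bool (j = p) * K i j)"
      by (rule psd_onD(2)[OF insert.prems])
    also have "\<dots> = K p p"
      using insert.hyps by (subst quadratic_form_insert) (auto simp: sym sum.neutral intro!: sum.neutral)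
    finally show ?thesis .
  qed
  define b where "b = (\<lambda>k i. if k < n then if i = p then 0 else a k i else K i p / sqrt (K p p))"
  have "K i j = (\<Sum>k<Suc n. b k i * b k j)" if ij: "i \<in> insert p J" "j \<in> insert p J" for i j
  proof -
    have last: "b n i * b n j = K i p * K j p / K p p"
      using Kpp by (simp add: b_def)
    consider "i \<in> J" "j \<in> J" | "i = p \<or> j = p" using ij by auto
    then show ?thesis
    proof cases
      case 1
      then have "(\<Sum>k<n. b k i * b k j) = (\<Sum>k<n. a k i * a k j)"
        using insert.hyps by (intro sum.cong) (auto simp: b_def)
      then show ?thesis using a[OF 1] last by simp
    next
      case 2
      then have "(\<Sum>k<n. b k i * b k j) = 0" by (auto simp: b_def intro!: sum.neutral)
      moreover have "K i p * K j p / K p p = K i j"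
        using 2 ij sym psd_on_zero_diagonal[OF insert.hyps insert.prems]
        by (cases "K p p = 0") auto
      ultimately show ?thesis using last by simp
    qed
  qed
  then show ?case by blast
qed auto

section \<open>Characteristic functions determine rectangle probabilities\<close>

text \<open>Normalize the weights to probability densities and apply uniqueness of one-dimensional
characteristic functions to the image measures.\<close>

lemma weighted_distr_unique:
  fixes D :: "'a \<Rightarrow> real" and D' :: "'b \<Rightarrow> real" and U :: "'a \<Rightarrow> real" and U' :: "'b \<Rightarrow> real"
  assumes int: "integrable M D" "integrable N D'"
    and nn: "\<And>x. 0 \<le> D x" "\<And>x. 0 \<le> D' x"
    and U[measurable]: "U \<in> borel_measurable M" "U' \<in> borel_measurable N"
    and eq: "\<And>u. (\<integral>x. D x *\<^sub>R iexp (u * U x) \<partial>M) = (\<integral>x. D' x *\<^sub>R iexp (u * U' x) \<partial>N)"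
    and A[measurable]: "A \<in> sets borel"
  shows "(\<integral>x. D x * indicator A (U x) \<partial>M) = (\<integral>x. D' x * indicator A (U' x) \<partial>N)"
proof -
  have [measurable]: "D \<in> borel_measurable M" "D' \<in> borel_measurable N" using int by auto
  define m where "m = (\<integral>x. D x \<partial>M)"
  have "complex_of_real m = complex_of_real (\<integral>x. D' x \<partial>N)"
    using eq[of 0] by (simp add: scaleR_conv_of_real m_def)
  then have m': "m = (\<integral>x. D' x \<partial>N)" by (simp only: of_real_eq_iff)
  have "m \<ge> 0" unfolding m_def using nn by (intro Bochner_Integration.integral_nonneg) auto
  show ?thesis
  proof (cases "m = 0")
    case True
    have "integrable M (\<lambda>x. D x * indicator A (U x))" "integrable N (\<lambda>x. D' x * indicator A (U' x))"
      using nn by (auto intro!: Bochner_Integration.integrable_bound[OF int(1)]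
          Bochner_Integration.integrable_bound[OF int(2)] split: split_indicator)
    note int' = this
    have "(\<integral>x. D x * indicator A (U x) \<partial>M) = 0"
    proof (rule antisym)
      show "(\<integral>x. D x * indicator A (U x) \<partial>M) \<le> 0"
        unfolding True[symmetric] m_def using nn int int'
        by (intro integral_mono) (auto split: split_indicator)
    qed (use nn in \<open>auto intro!: Bochner_Integration.integral_nonneg\<close>)
    moreover have "(\<integral>x. D' x * indicator A (U' x) \<partial>N) = 0"
    proof (rule antisym)
      show "(\<integral>x. D' x * indicator A (U' x) \<partial>N) \<le> 0"
        unfolding True[symmetric] m' using nn int int'
        by (intro integral_mono) (auto split: split_indicator)
    qed (use nn in \<open>auto intro!: Bochner_Integration.integral_nonneg\<close>)
    ultimately show ?thesis by simp
  next
    case False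
    with \<open>m \<ge> 0\<close> have m: "m > 0" by simp
    define \<nu> where "\<nu> = distr (density M (\<lambda>x. ennreal (D x / m))) borel U"
    define \<nu>' where "\<nu>' = distr (density N (\<lambda>x. ennreal (D' x / m))) borel U'"
    have "emeasure (density M (\<lambda>x. ennreal (D x / m))) (space M) = 1"
      using m nn int by (simp add: emeasure_density nn_integral_eq_integral m_def cong: nn_integral_cong)
    then have p: "prob_space (density M (\<lambda>x. ennreal (D x / m)))"
      by (intro prob_spaceI) simp
    have "emeasure (density N (\<lambda>x. ennreal (D' x / m))) (space N) = 1"
      using m nn int by (simp add: emeasure_density nn_integral_eq_integral m' cong: nn_integral_cong)
    then have p': "prob_space (density N (\<lambda>x. ennreal (D' x / m)))"
      by (intro prob_spaceI) simp
    have rd: "real_distribution \<nu>" "real_distribution \<nu>'"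
      unfolding \<nu>_def \<nu>'_def using p p'
      by (auto simp: real_distribution_def real_distribution_axioms_def intro!: prob_space.prob_space_distr)
    have "char \<nu> = char \<nu>'"
    proof
      fix u
      have "char \<nu> u = (\<integral>x. D x *\<^sub>R iexp (u * U x) \<partial>M) /\<^sub>R m"
        unfolding char_def \<nu>_def using m nn
        by (subst integral_distr, measurable, subst integral_density) (auto simp: divide_inverse_commute simp flip: integral_scaleR_right)
      moreover have "char \<nu>' u = (\<integral>x. D' x *\<^sub>R iexp (u * U' x) \<partial>N) /\<^sub>R m"
        unfolding char_def \<nu>'_def using m nn
        by (subst integral_distr, measurable, subst integral_density) (auto simp: divide_inverse_commute simp flip: integral_scaleR_right)
      ultimately show "char \<nu> u = char \<nu>' u" using eq by simp
    qed
    then have "\<nu> = \<nu>'" using rd by (intro Levy_uniqueness)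
    then have "(\<integral>u. indicator A u \<partial>\<nu>) = (\<integral>u. indicator A u \<partial>\<nu>' :: real)" by simp
    moreover have "(\<integral>u. indicator A u \<partial>\<nu>) = (\<integral>x. D x * indicator A (U x) \<partial>M) / m"
      unfolding \<nu>_def using m nn
      by (subst integral_distr, measurable, subst integral_density) (auto)
    moreover have "(\<integral>u. indicator A u \<partial>\<nu>') = (\<integral>x. D' x * indicator A (U' x) \<partial>N) / m"
      unfolding \<nu>'_def using m nn
      by (subst integral_distr, measurable, subst integral_density) (auto)
    ultimately show ?thesis using m by simp
  qed
qed

text \<open>The weights \<open>1 + cos (s + \<theta>)\<close> are nonnegative and are combinations of three characters. Thus they are
admissible as densities while integrals against them are known from characteristic functions.\<close>

lemma one_plus_cos_iexp:
  "(1 + cos (s + \<theta>)) *\<^sub>R iexp r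
    = iexp r + (iexp \<theta> * iexp (r + s) + iexp (- \<theta>) * iexp (r - s)) / 2"
proof -
  have 1: "iexp \<theta> * iexp (r + s) = iexp r * iexp (s + \<theta>)"
    by (simp add: exp_add[symmetric] algebra_simps)
  have 2: "iexp (- \<theta>) * iexp (r - s) = iexp r * iexp (- (s + \<theta>))"
    by (simp only: exp_add[symmetric]) (simp add: algebra_simps)
  have 3: "complex_of_real (cos (s + \<theta>)) = (iexp (s + \<theta>) + iexp (- (s + \<theta>))) / 2"
    unfolding cos_of_real[symmetric] cos_exp_eq
    by (simp only: of_real_minus mult_minus_right mult_minus_left)
  have "(1 + cos (s + \<theta>)) *\<^sub>R iexp r = (1 + complex_of_real (cos (s + \<theta>))) * iexp r"
    by (simp add: scaleR_conv_of_real)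
  then show ?thesis unfolding 1 2 3 by (simp add: algebra_simps)
qed

lemma integral_half_combination:
  fixes f g h :: "'a \<Rightarrow> complex"
  assumes "integrable M f" "integrable M g" "integrable M h"
  shows "(\<integral>x. f x + (p * g x + q * h x) / 2 \<partial>M)
    = (\<integral>x. f x \<partial>M) + (p * (\<integral>x. g x \<partial>M) + q * (\<integral>x. h x \<partial>M)) / 2"
  using assms by simp

text \<open>One coordinate \<open>U\<close> is turned from the frequency variable \<open>u\<close> into a set \<open>A\<close>, while the remaining
coordinates stay in the exponential \<open>iexp S\<close>. Uniqueness needs nonnegative weights, so \<open>iexp S\<close> is
first replaced by \<open>1 + cos (S + \<theta>)\<close> and then recovered from two values of \<open>\<theta>\<close>.\<close>

lemma iexp_weight_step:
  fixes W :: "'a \<Rightarrow> real" and W' :: "'b \<Rightarrow> real"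
    and U S :: "'a \<Rightarrow> real" and U' S' :: "'b \<Rightarrow> real"
  assumes int: "integrable M W" "integrable N W'"
    and nn: "\<And>x. 0 \<le> W x" "\<And>x. 0 \<le> W' x"
    and [measurable]: "U \<in> borel_measurable M" "U' \<in> borel_measurable N"
      "S \<in> borel_measurable M" "S' \<in> borel_measurable N"
    and eq: "\<And>u v. (\<integral>x. W x *\<^sub>R iexp (u * U x + v * S x) \<partial>M) = (\<integral>x. W' x *\<^sub>R iexp (u * U' x + v * S' x) \<partial>N)"
    and A[measurable]: "A \<in> sets borel"
  shows "(\<integral>x. (W x * indicator A (U x)) *\<^sub>R iexp (S x) \<partial>M) = (\<integral>x. (W' x * indicator A (U' x)) *\<^sub>R iexp (S' x) \<partial>N)"
proof -
  have [measurable]: "W \<in> borel_measurable M" "W' \<in> borel_measurable N" using int by auto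
  have intb: "integrable M (\<lambda>x. W x *\<^sub>R f x)" if "f \<in> borel_measurable M" "\<And>x. norm (f x) \<le> 2"
    for f :: "'a \<Rightarrow> 'c::{banach, second_countable_topology}"
    by (rule Bochner_Integration.integrable_bound[where f = "\<lambda>x. 2 * W x"])
       (use that int nn in \<open>auto intro!: mult_left_mono simp: mult.commute[of 2]\<close>)
  have intb': "integrable N (\<lambda>x. W' x *\<^sub>R f x)" if "f \<in> borel_measurable N" "\<And>x. norm (f x) \<le> 2"
    for f :: "'b \<Rightarrow> 'c::{banach, second_countable_topology}"
    by (rule Bochner_Integration.integrable_bound[where f = "\<lambda>x. 2 * W' x"])
       (use that int nn in \<open>auto intro!: mult_left_mono simp: mult.commute[of 2]\<close>)
  have bound: "\<bar>1 + cos x\<bar> \<le> 2" "0 \<le> 1 + cos x" for x :: real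
    using cos_ge_minus_one[of x] cos_le_one[of x] by linarith+
  have cos_eq: "(\<integral>x. W x * (1 + cos (S x + \<theta>)) * indicator A (U x) \<partial>M)
      = (\<integral>x. W' x * (1 + cos (S' x + \<theta>)) * indicator A (U' x) \<partial>N)" for \<theta>
  proof (rule weighted_distr_unique)
    fix u
    have ints: "integrable M (\<lambda>x. W x *\<^sub>R iexp (u * U x))"
      "integrable M (\<lambda>x. W x *\<^sub>R iexp (u * U x + S x))" "integrable M (\<lambda>x. W x *\<^sub>R iexp (u * U x - S x))"
      by (intro intb; simp)+
    have ints': "integrable N (\<lambda>x. W' x *\<^sub>R iexp (u * U' x))"
      "integrable N (\<lambda>x. W' x *\<^sub>R iexp (u * U' x + S' x))" "integrable N (\<lambda>x. W' x *\<^sub>R iexp (u * U' x - S' x))"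
      by (intro intb'; simp)+
    have "(\<integral>x. (W x * (1 + cos (S x + \<theta>))) *\<^sub>R iexp (u * U x) \<partial>M)
      = (\<integral>x. W x *\<^sub>R iexp (u * U x) + (iexp \<theta> * (W x *\<^sub>R iexp (u * U x + S x))
          + iexp (- \<theta>) * (W x *\<^sub>R iexp (u * U x - S x))) / 2 \<partial>M)"
      unfolding scaleR_scaleR[symmetric] one_plus_cos_iexp
      by (intro Bochner_Integration.integral_cong refl) (simp add: scaleR_conv_of_real algebra_simps)
    also have "\<dots> = (\<integral>x. W x *\<^sub>R iexp (u * U x) \<partial>M)
       + (iexp \<theta> * (\<integral>x. W x *\<^sub>R iexp (u * U x + S x) \<partial>M)
          + iexp (- \<theta>) * (\<integral>x. W x *\<^sub>R iexp (u * U x - S x) \<partial>M)) / 2"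
      by (rule integral_half_combination; fact ints)
    also have "\<dots> = (\<integral>x. W' x *\<^sub>R iexp (u * U' x) \<partial>N)
       + (iexp \<theta> * (\<integral>x. W' x *\<^sub>R iexp (u * U' x + S' x) \<partial>N)
          + iexp (- \<theta>) * (\<integral>x. W' x *\<^sub>R iexp (u * U' x - S' x) \<partial>N)) / 2"
      using eq[of u 0] eq[of u 1] eq[of u "-1"] by simp
    also have "\<dots> = (\<integral>x. W' x *\<^sub>R iexp (u * U' x) + (iexp \<theta> * (W' x *\<^sub>R iexp (u * U' x + S' x))
          + iexp (- \<theta>) * (W' x *\<^sub>R iexp (u * U' x - S' x))) / 2 \<partial>N)"
      by (rule integral_half_combination[symmetric]; fact ints')
    also have "\<dots> = (\<integral>x. (W' x * (1 + cos (S' x + \<theta>))) *\<^sub>R iexp (u * U' x) \<partial>N)"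
      unfolding scaleR_scaleR[symmetric] one_plus_cos_iexp
      by (intro Bochner_Integration.integral_cong refl) (simp add: scaleR_conv_of_real algebra_simps)
    finally show "(\<integral>x. (W x * (1 + cos (S x + \<theta>))) *\<^sub>R iexp (u * U x) \<partial>M)
      = (\<integral>x. (W' x * (1 + cos (S' x + \<theta>))) *\<^sub>R iexp (u * U' x) \<partial>N)" .
  next
    show "integrable M (\<lambda>x. W x * (1 + cos (S x + \<theta>)))"
      using intb[of "\<lambda>x. 1 + cos (S x + \<theta>)"] bound by simp
    show "integrable N (\<lambda>x. W' x * (1 + cos (S' x + \<theta>)))"
      using intb'[of "\<lambda>x. 1 + cos (S' x + \<theta>)"] bound by simp
  qed (use nn bound in auto)
  have one_eq: "(\<integral>x. W x * indicator A (U x) \<partial>M) = (\<integral>x. W' x * indicator A (U' x) \<partial>N)"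
    using eq[of _ 0] by (intro weighted_distr_unique int nn) auto
  have i1: "integrable M (\<lambda>x. W x *\<^sub>R (indicator A (U x) :: real))"
    "integrable M (\<lambda>x. W x *\<^sub>R (cos (S x + \<theta>) * indicator A (U x)))"
    "integrable M (\<lambda>x. W x *\<^sub>R (indicator A (U x) *\<^sub>R iexp (S x)))" for \<theta>
    by (intro intb; auto split: split_indicator intro: order_trans[OF abs_cos_le_one])+
  have i1': "integrable N (\<lambda>x. W' x *\<^sub>R (indicator A (U' x) :: real))"
    "integrable N (\<lambda>x. W' x *\<^sub>R (cos (S' x + \<theta>) * indicator A (U' x)))"
    "integrable N (\<lambda>x. W' x *\<^sub>R (indicator A (U' x) *\<^sub>R iexp (S' x)))" for \<theta>
    by (intro intb'; auto split: split_indicator intro: order_trans[OF abs_cos_le_one])+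
  have cos_eq': "(\<integral>x. W x * (cos (S x + \<theta>) * indicator A (U x)) \<partial>M)
      = (\<integral>x. W' x * (cos (S' x + \<theta>) * indicator A (U' x)) \<partial>N)" for \<theta>
    using cos_eq[of \<theta>] one_eq i1(1) i1(2)[of \<theta>] i1'(1) i1'(2)[of \<theta>]
    by (simp add: ring_distribs mult.assoc)
  show ?thesis
  proof (rule complex_eqI)
    show "Re (\<integral>x. (W x * indicator A (U x)) *\<^sub>R iexp (S x) \<partial>M)
      = Re (\<integral>x. (W' x * indicator A (U' x)) *\<^sub>R iexp (S' x) \<partial>N)"
      using cos_eq'[of 0] i1(3) i1'(3)
      by (simp flip: integral_Re add: Re_exp mult.commute mult.left_commute)
    show "Im (\<integral>x. (W x * indicator A (U x)) *\<^sub>R iexp (S x) \<partial>M)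
      = Im (\<integral>x. (W' x * indicator A (U' x)) *\<^sub>R iexp (S' x) \<partial>N)"
      \<comment> \<open>The phase \<open>- pi / 2\<close> turns the cosine into the sine.\<close>
      using cos_eq'[of "- pi / 2"] i1(3) i1'(3)
      by (simp flip: integral_Im add: Im_exp cos_diff mult.commute mult.left_commute)
  qed
qed

text \<open>Replace the coordinates in the exponential by indicators one after the other. The sum over all of
\<open>J\<close> stays in the exponential throughout, so that every frequency vector is available at each step.\<close>

lemma rectangle_prob_unique:
  fixes X :: "'i \<Rightarrow> 'a \<Rightarrow> real" and Y :: "'i \<Rightarrow> 'b \<Rightarrow> real"
  assumes "prob_space M" "prob_space N" and J: "finite J"
    and X[measurable]: "\<And>j. j \<in> J \<Longrightarrow> X j \<in> borel_measurable M"
    and Y[measurable]: "\<And>j. j \<in> J \<Longrightarrow> Y j \<in> borel_measurable N"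
    and char: "\<And>c. (\<integral>\<omega>. iexp (\<Sum>j\<in>J. c j * X j \<omega>) \<partial>M) = (\<integral>\<omega>. iexp (\<Sum>j\<in>J. c j * Y j \<omega>) \<partial>N)"
    and A[measurable]: "\<And>j. j \<in> J \<Longrightarrow> A j \<in> sets borel"
  shows "measure M {\<omega> \<in> space M. \<forall>j\<in>J. X j \<omega> \<in> A j} = measure N {\<omega> \<in> space N. \<forall>j\<in>J. Y j \<omega> \<in> A j}"
proof -
  interpret M: prob_space M by fact
  interpret N: prob_space N by fact
  have *: "(\<integral>\<omega>. (\<Prod>j\<in>K. indicator (A j) (X j \<omega>)) *\<^sub>R iexp (\<Sum>j\<in>J. c j * X j \<omega>) \<partial>M)
      = (\<integral>\<omega>. (\<Prod>j\<in>K. indicator (A j) (Y j \<omega>)) *\<^sub>R iexp (\<Sum>j\<in>J. c j * Y j \<omega>) \<partial>N)"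
    if "finite K" "K \<subseteq> J" for K c
    using that
  proof (induction K arbitrary: c rule: finite_induct)
    case empty
    show ?case using char by simp
  next
    case (insert i K)
    have [measurable]: "X i \<in> borel_measurable M" "Y i \<in> borel_measurable N" "A i \<in> sets borel"
      using insert.prems by auto
    have mK: "X j \<in> borel_measurable M" "Y j \<in> borel_measurable N" "A j \<in> sets borel" if "j \<in> K" for j
      using insert.prems that by auto
    have mX[measurable]: "(\<lambda>\<omega>. \<Prod>j\<in>K. indicator (A j) (X j \<omega>) :: real) \<in> borel_measurable M"
      by (intro borel_measurable_prod measurable_compose[OF mK(1)] borel_measurable_indicator mK(3))
    have mY[measurable]: "(\<lambda>\<omega>. \<Prod>j\<in>K. indicator (A j) (Y j \<omega>) :: real) \<in> borel_measurable N"
      by (intro borel_measurable_prod measurable_compose[OF mK(2)] borel_measurable_indicator mK(3))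
    have b: "0 \<le> (\<Prod>j\<in>K. indicator (A j) (f j) :: real)" "(\<Prod>j\<in>K. indicator (A j) (f j) :: real) \<le> 1" for f
      by (auto intro!: prod_nonneg prod_le_1 split: split_indicator)
    have "(\<integral>\<omega>. ((\<Prod>j\<in>K. indicator (A j) (X j \<omega>)) * indicator (A i) (X i \<omega>)) *\<^sub>R iexp (\<Sum>j\<in>J. c j * X j \<omega>) \<partial>M)
      = (\<integral>\<omega>. ((\<Prod>j\<in>K. indicator (A j) (Y j \<omega>)) * indicator (A i) (Y i \<omega>)) *\<^sub>R iexp (\<Sum>j\<in>J. c j * Y j \<omega>) \<partial>N)"
    proof (rule iexp_weight_step)
      show "integrable M (\<lambda>\<omega>. \<Prod>j\<in>K. indicator (A j) (X j \<omega>) :: real)"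
        by (rule M.integrable_const_bound[where B = 1]) (use b in auto)
      show "integrable N (\<lambda>\<omega>. \<Prod>j\<in>K. indicator (A j) (Y j \<omega>) :: real)"
        by (rule N.integrable_const_bound[where B = 1]) (use b in auto)
      fix u v
      have "u * Z i + v * (\<Sum>j\<in>J. c j * Z j) = (\<Sum>j\<in>J. (v * c j + (if j = i then u else 0)) * Z j)" for Z
      proof -
        have "(\<Sum>j\<in>J. (if j = i then u else 0) * Z j) = u * Z i"
          using J insert.prems by (simp add: if_distrib[of "\<lambda>x. x * _"] cong: if_cong)
        then show ?thesis by (simp add: ring_distribs sum.distrib sum_distrib_left mult.assoc)
      qed
      note eq = this[of "\<lambda>j. X j _"] this[of "\<lambda>j. Y j _"]
      show "(\<integral>x. (\<Prod>j\<in>K. indicator (A j) (X j x)) *\<^sub>R iexp (u * X i x + v * (\<Sum>j\<in>J. c j * X j x)) \<partial>M)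
        = (\<integral>x. (\<Prod>j\<in>K. indicator (A j) (Y j x)) *\<^sub>R iexp (u * Y i x + v * (\<Sum>j\<in>J. c j * Y j x)) \<partial>N)"
        unfolding eq using insert.prems by (intro insert.IH) auto
    qed (use b in auto)
    then show ?case using insert.hyps by (simp add: mult.commute)
  qed
  have eq: "(\<Prod>j\<in>J. indicator (A j) (f j) :: real) = of_bool (\<forall>j\<in>J. f j \<in> A j)" for f
    using J by (auto simp: indicator_def prod_zero_iff intro!: prod.neutral)
  have [measurable]: "{\<omega> \<in> space M. \<forall>j\<in>J. X j \<omega> \<in> A j} \<in> sets M" "{\<omega> \<in> space N. \<forall>j\<in>J. Y j \<omega> \<in> A j} \<in> sets N"
    using J X Y A by (auto intro!: sets.sets_Collect_finite_All' sets.sets_Collect_finite_All measurable_sets_Collect)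
  have "complex_of_real (\<integral>\<omega>. (\<Prod>j\<in>J. indicator (A j) (X j \<omega>)) \<partial>M)
      = complex_of_real (\<integral>\<omega>. (\<Prod>j\<in>J. indicator (A j) (Y j \<omega>)) \<partial>N)"
    using *[OF J, of "\<lambda>_. 0"] by (simp add: scaleR_conv_of_real del: of_real_prod)
  then have "(\<integral>\<omega>. (\<Prod>j\<in>J. indicator (A j) (X j \<omega>)) \<partial>M) = (\<integral>\<omega>. (\<Prod>j\<in>J. indicator (A j) (Y j \<omega>)) \<partial>N :: real)"
    by (simp only: of_real_eq_iff)
  moreover have "(\<integral>\<omega>. (\<Prod>j\<in>J. indicator (A j) (X j \<omega>)) \<partial>M)
      = (\<integral>\<omega>. indicator {\<omega> \<in> space M. \<forall>j\<in>J. X j \<omega> \<in> A j} \<omega> \<partial>M :: real)"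
    unfolding eq by (intro Bochner_Integration.integral_cong refl) (auto simp: indicator_def)
  moreover have "(\<integral>\<omega>. (\<Prod>j\<in>J. indicator (A j) (Y j \<omega>)) \<partial>N)
      = (\<integral>\<omega>. indicator {\<omega> \<in> space N. \<forall>j\<in>J. Y j \<omega> \<in> A j} \<omega> \<partial>N :: real)"
    unfolding eq by (intro Bochner_Integration.integral_cong refl) (auto simp: indicator_def)
  ultimately show ?thesis by simp
qed

section \<open>Box probabilities of Gaussian families\<close>

text \<open>The probability that \<open>z + \<Sum>k<n. \<xi>\<^sub>k a\<^sub>k\<close> lies in the box \<open>[-b, b]\<^sup>J\<close>, as an iterated smoothing.\<close>

primrec smoothed_box :: "'i set \<Rightarrow> real \<Rightarrow> (nat \<Rightarrow> 'i \<Rightarrow> real) \<Rightarrow> nat \<Rightarrow> ('i \<Rightarrow> real) \<Rightarrow> real" where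
  "smoothed_box J b a 0 = (\<lambda>z. of_bool (\<forall>j\<in>J. \<bar>z j\<bar> \<le> b))"
| "smoothed_box J b a (Suc n) = gaussian_smoothing (a n) (smoothed_box J b a n)"

lemma log_concave_box: "log_concave (\<lambda>z. of_bool (\<forall>j\<in>J. \<bar>z j\<bar> \<le> b))"
  unfolding log_concave_def
proof (intro conjI allI impI)
  fix x y :: "'a \<Rightarrow> real" and t :: real assume t: "0 < t" "t < 1"
  have "\<bar>(1 - t) * x j + t * y j\<bar> \<le> b" if "\<bar>x j\<bar> \<le> b" "\<bar>y j\<bar> \<le> b" for j
  proof -
    have "\<bar>(1 - t) * x j + t * y j\<bar> \<le> (1 - t) * \<bar>x j\<bar> + t * \<bar>y j\<bar>"
      using t by (intro order_trans[OF abs_triangle_ineq]) (simp add: abs_mult)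
    also have "\<dots> \<le> (1 - t) * b + t * b"
      using t that by (intro add_mono mult_left_mono) auto
    finally show ?thesis by (simp add: algebra_simps)
  qed
  then show "of_bool (\<forall>j\<in>J. \<bar>x j\<bar> \<le> b) powr (1 - t) * of_bool (\<forall>j\<in>J. \<bar>y j\<bar> \<le> b) powr t
    \<le> (of_bool (\<forall>j\<in>J. \<bar>(1 - t) * x j + t * y j\<bar> \<le> b) :: real)"
    by auto
qed simp

lemma smoothed_box_properties:
  shows log_concave_smoothed_box: "log_concave (smoothed_box J b a n)"
    and smoothed_box_le_1: "smoothed_box J b a n z \<le> 1"
    and smoothed_box_even: "smoothed_box J b a n (\<lambda>i. - z i) = smoothed_box J b a n z"
proof -
  have "log_concave (smoothed_box J b a n) \<and> (\<forall>z. smoothed_box J b a n z \<le> 1)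
      \<and> (\<forall>z. smoothed_box J b a n (\<lambda>i. - z i) = smoothed_box J b a n z)"
  proof (induction n)
    case 0
    show ?case by (simp add: log_concave_box)
  next
    case (Suc n)
    then show ?case
      by (auto intro!: log_concave_gaussian_smoothing gaussian_smoothing_le gaussian_smoothing_even)
  qed
  then show "log_concave (smoothed_box J b a n)" "smoothed_box J b a n z \<le> 1"
    "smoothed_box J b a n (\<lambda>i. - z i) = smoothed_box J b a n z" by auto
qed

lemma smoothed_box_nonneg: "0 \<le> smoothed_box J b a n z"
  using log_concave_smoothed_box[of J b a n] by (simp add: log_concave_def)

text \<open>A smoothing averages values of an even log-concave function around \<open>0\<close>, and these are at most its
value at \<open>0\<close>.\<close>

lemma smoothed_box_0_antimono:
  assumes "n \<le> m"
  shows "smoothed_box J b a m (\<lambda>i. 0) \<le> smoothed_box J b a n (\<lambda>i. 0)"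
  using assms
proof (induction m rule: dec_induct)
  case (step m)
  have "smoothed_box J b a (Suc m) (\<lambda>i. 0) \<le> smoothed_box J b a m (\<lambda>i. 0)"
    unfolding smoothed_box.simps
    by (rule gaussian_smoothing_le[OF log_concave_smoothed_box smoothed_box_le_1],
        rule even_log_concave_le_0[OF log_concave_smoothed_box smoothed_box_even])
  with step show ?case by simp
qed simp

lemma smoothed_box_cong:
  assumes "\<And>k. k < n \<Longrightarrow> a k = a' k"
  shows "smoothed_box J b a n = smoothed_box J b a' n"
  using assms by (induction n) auto

abbreviation "std_normal \<equiv> density lborel (\<lambda>x. ennreal (std_normal_density x))"

interpretation std_normal: prob_space std_normal
  by (rule prob_space_normal_density) simp

abbreviation "gauss_space n \<equiv> (\<Pi>\<^sub>M k\<in>{..<n::nat}. std_normal)"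

interpretation gauss: product_sigma_finite "\<lambda>_::nat. std_normal"
  by unfold_locales

lemma gauss_space_prob: "prob_space (gauss_space n)"
  by (rule prob_space_PiM) unfold_locales

text \<open>Fubini: the last standard normal coordinate is integrated outermost.\<close>

lemma smoothed_box_eq_prob:
  assumes J: "finite J"
  shows "emeasure (gauss_space n) {\<omega> \<in> space (gauss_space n). \<forall>j\<in>J. \<bar>z j + (\<Sum>k<n. a k j * \<omega> k)\<bar> \<le> b}
    = ennreal (smoothed_box J b a n z)"
proof (induction n arbitrary: z)
  case 0
  show ?case
  proof (cases "\<forall>j\<in>J. \<bar>z j\<bar> \<le> b")
    case False
    then have empty: "{\<omega> \<in> space (gauss_space 0). \<forall>j\<in>J. \<bar>z j + (\<Sum>k<0. a k j * \<omega> k)\<bar> \<le> b} = {}" by auto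
    show ?thesis unfolding empty using False by simp
  qed (simp add: space_PiM_empty)
next
  case (Suc n)
  define S where "S = {\<omega> \<in> space (gauss_space (Suc n)). \<forall>j\<in>J. \<bar>z j + (\<Sum>k<Suc n. a k j * \<omega> k)\<bar> \<le> b}"
  have meas: "(\<lambda>\<omega>. a k j * \<omega> k) \<in> borel_measurable (gauss_space m)" if "k < m" for k m j
    using that by (auto intro!: borel_measurable_times measurable_component_singleton)
  have [measurable]: "S \<in> sets (gauss_space (Suc n))"
    unfolding S_def
    by (intro sets.sets_Collect_finite_All J) (auto intro!: borel_measurable_add borel_measurable_sum meas borel_measurable_le)
  have "emeasure (gauss_space (Suc n)) S = (\<integral>\<^sup>+\<omega>. indicator S \<omega> \<partial>gauss_space (Suc n))"
    by simp
  also have "\<dots> = (\<integral>\<^sup>+x. (\<integral>\<^sup>+\<omega>. indicator S (fun_upd \<omega> n x) \<partial>gauss_space n) \<partial>std_normal)"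
    unfolding lessThan_Suc
    by (rule gauss.product_nn_integral_insert_rev) (auto simp flip: lessThan_Suc)
  also have "\<dots> = (\<integral>\<^sup>+x. ennreal (smoothed_box J b a n (\<lambda>j. z j + x * a n j)) \<partial>std_normal)"
  proof (rule nn_integral_cong)
    fix x :: real
    define S' where "S' = {\<omega> \<in> space (gauss_space n). \<forall>j\<in>J. \<bar>(z j + x * a n j) + (\<Sum>k<n. a k j * \<omega> k)\<bar> \<le> b}"
    have [measurable]: "S' \<in> sets (gauss_space n)"
      unfolding S'_def
      by (intro sets.sets_Collect_finite_All J) (auto intro!: borel_measurable_add borel_measurable_sum meas borel_measurable_le)
    have "(\<integral>\<^sup>+\<omega>. indicator S (fun_upd \<omega> n x) \<partial>gauss_space n) = (\<integral>\<^sup>+\<omega>. indicator S' \<omega> \<partial>gauss_space n)"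
    proof (rule nn_integral_cong)
      fix \<omega> assume w: "\<omega> \<in> space (gauss_space n)"
      then have "fun_upd \<omega> n x \<in> space (gauss_space (Suc n))"
        by (auto simp: space_PiM PiE_def extensional_def)
      moreover have "(\<Sum>k<Suc n. a k j * (fun_upd \<omega> n x) k) = (\<Sum>k<n. a k j * \<omega> k) + x * a n j" for j
        by simp
      ultimately show "indicator S (fun_upd \<omega> n x) = (indicator S' \<omega> :: ennreal)"
        using w by (simp add: S_def S'_def indicator_def algebra_simps del: fun_upd_apply sum.lessThan_Suc)
    qed
    also have "\<dots> = ennreal (smoothed_box J b a n (\<lambda>j. z j + x * a n j))"
      using Suc.IH[of "\<lambda>j. z j + x * a n j"] unfolding S'_def[symmetric] by simp
    finally show "(\<integral>\<^sup>+\<omega>. indicator S (fun_upd \<omega> n x) \<partial>gauss_space n) = \<dots>" .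
  qed
  also have "\<dots> = ennreal (smoothed_box J b a (Suc n) z)"
    by (simp add: nn_integral_gaussian_smoothing log_concave_smoothed_box smoothed_box_le_1)
  finally show ?case unfolding S_def .
qed

lemma char_std_normal: "(\<integral>x. iexp (u * x) \<partial>std_normal) = complex_of_real (exp (- u\<^sup>2 / 2))"
  using fun_cong[OF char_std_normal_distribution, of u] by (simp add: char_def)

lemma char_gauss_space:
  "(\<integral>\<omega>. iexp (\<Sum>k<n. u k * \<omega> k) \<partial>gauss_space n) = complex_of_real (exp (- (\<Sum>k<n. (u k)\<^sup>2) / 2))"
proof -
  have "(\<integral>\<omega>. iexp (\<Sum>k<n. u k * \<omega> k) \<partial>gauss_space n)
      = (\<integral>\<omega>. (\<Prod>k<n. iexp (u k * \<omega> k)) \<partial>gauss_space n)"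
    by (simp add: exp_sum[symmetric] sum_distrib_left)
  also have "\<dots> = (\<Prod>k<n. (\<integral>x. iexp (u k * x) \<partial>std_normal))"
    by (rule gauss.product_integral_prod)
       (auto intro!: std_normal.integrable_const_bound[where B = 1])
  also have "\<dots> = complex_of_real (\<Prod>k<n. exp (- (u k)\<^sup>2 / 2))"
    by (simp only: char_std_normal of_real_prod)
  also have "(\<Prod>k<n. exp (- (u k)\<^sup>2 / 2)) = exp (- (\<Sum>k<n. (u k)\<^sup>2) / 2)"
    by (simp add: exp_sum[symmetric] sum_negf sum_divide_distrib)
  finally show ?thesis .
qed

text \<open>Joint centered normality of the variables \<open>X j\<close> with covariance \<open>K\<close>, encoded by characteristic
functions so that degenerate covariances need no special treatment.\<close>

definition gaussian_family :: "'a measure \<Rightarrow> 'i set \<Rightarrow> ('i \<Rightarrow> 'a \<Rightarrow> real) \<Rightarrow> ('i \<Rightarrow> 'i \<Rightarrow> real) \<Rightarrow> bool" where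
  "gaussian_family M J X K \<longleftrightarrow> (\<forall>j\<in>J. X j \<in> borel_measurable M) \<and>
     (\<forall>c. (\<integral>\<omega>. iexp (\<Sum>j\<in>J. c j * X j \<omega>) \<partial>M)
        = complex_of_real (exp (- (\<Sum>i\<in>J. \<Sum>j\<in>J. c i * c j * K i j) / 2)))"

lemma gaussian_family_box_prob:
  assumes M: "prob_space M" and J: "finite J" and X: "gaussian_family M J X K"
    and K: "\<And>i j. i \<in> J \<Longrightarrow> j \<in> J \<Longrightarrow> K i j = (\<Sum>k<n. a k i * a k j)"
  shows "measure M {\<omega> \<in> space M. \<forall>j\<in>J. \<bar>X j \<omega>\<bar> \<le> b} = smoothed_box J b a n (\<lambda>i. 0)"
proof -
  define Y where "Y = (\<lambda>j \<omega>. \<Sum>k<n. a k j * \<omega> k :: real)"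
  have Ym: "Y j \<in> borel_measurable (gauss_space n)" for j
    unfolding Y_def by (auto intro!: borel_measurable_sum borel_measurable_times measurable_component_singleton)
  have "measure M {\<omega> \<in> space M. \<forall>j\<in>J. X j \<omega> \<in> {-b..b}}
      = measure (gauss_space n) {\<omega> \<in> space (gauss_space n). \<forall>j\<in>J. Y j \<omega> \<in> {-b..b}}"
  proof (rule rectangle_prob_unique[OF M gauss_space_prob J])
    fix c :: "'b \<Rightarrow> real"
    have "(\<integral>\<omega>. iexp (\<Sum>j\<in>J. c j * Y j \<omega>) \<partial>gauss_space n)
        = (\<integral>\<omega>. iexp (\<Sum>k<n. (\<Sum>j\<in>J. c j * a k j) * \<omega> k) \<partial>gauss_space n)"
      unfolding Y_def sum_distrib_left sum_distrib_right
      by (subst sum.swap) (simp add: mult.assoc)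
    also have "\<dots> = complex_of_real (exp (- (\<Sum>k<n. (\<Sum>j\<in>J. c j * a k j)\<^sup>2) / 2))"
      by (rule char_gauss_space)
    also have "(\<Sum>k<n. (\<Sum>j\<in>J. c j * a k j)\<^sup>2) = (\<Sum>i\<in>J. \<Sum>j\<in>J. c i * c j * K i j)"
    proof -
      have "(\<Sum>k<n. (\<Sum>j\<in>J. c j * a k j)\<^sup>2) = (\<Sum>k<n. \<Sum>i\<in>J. \<Sum>j\<in>J. c i * c j * (a k i * a k j))"
        by (simp add: power2_eq_square sum_product mult_ac)
      also have "\<dots> = (\<Sum>i\<in>J. \<Sum>j\<in>J. \<Sum>k<n. c i * c j * (a k i * a k j))"
        by (subst sum.swap, intro sum.cong refl, subst sum.swap) simp
      also have "\<dots> = (\<Sum>i\<in>J. \<Sum>j\<in>J. c i * c j * K i j)"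
        by (intro sum.cong refl) (simp add: K sum_distrib_left)
      finally show ?thesis .
    qed
    finally show "(\<integral>\<omega>. iexp (\<Sum>j\<in>J. c j * X j \<omega>) \<partial>M) = (\<integral>\<omega>. iexp (\<Sum>j\<in>J. c j * Y j \<omega>) \<partial>gauss_space n)"
      using X unfolding gaussian_family_def by metis
  qed (use X Ym in \<open>auto simp: gaussian_family_def\<close>)
  also have "\<dots> = smoothed_box J b a n (\<lambda>i. 0)"
    using smoothed_box_eq_prob[OF J, of n "\<lambda>_. 0" a b]
    by (simp add: measure_def Y_def abs_le_iff smoothed_box_nonneg minus_le_iff conj_commute)
  finally show ?thesis by (simp add: abs_le_iff minus_le_iff conj_commute)
qed

text \<open>A characteristic function is bounded by \<open>1\<close>.\<close>

lemma gaussian_family_psd: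
  assumes M: "prob_space M" and X: "gaussian_family M J X K"
    and sym: "\<And>i j. i \<in> J \<Longrightarrow> j \<in> J \<Longrightarrow> K i j = K j i"
  shows "psd_on J K"
  unfolding psd_on_def
proof (intro conjI ballI allI sym)
  fix c
  interpret prob_space M by fact
  have "exp (- (\<Sum>i\<in>J. \<Sum>j\<in>J. c i * c j * K i j) / 2) = norm (\<integral>\<omega>. iexp (\<Sum>j\<in>J. c j * X j \<omega>) \<partial>M)"
    using X by (simp add: gaussian_family_def)
  also have "\<dots> \<le> (\<integral>\<omega>. norm (iexp (\<Sum>j\<in>J. c j * X j \<omega>)) \<partial>M)" by (rule integral_norm_bound)
  also have "\<dots> = 1" by (simp add: prob_space del: of_real_sum)
  finally show "0 \<le> (\<Sum>i\<in>J. \<Sum>j\<in>J. c i * c j * K i j)" by simp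
qed

text \<open>Anderson's inequality for symmetric boxes. Write \<open>K'\<close> and the excess \<open>K - K'\<close> as Gram kernels; the larger
box probability uses the directions of \<open>K'\<close> only, the smaller one smooths further in those of the excess.\<close>

proposition gaussian_box_prob_antimono:
  fixes X :: "'i \<Rightarrow> 'a \<Rightarrow> real" and Y :: "'i \<Rightarrow> 'b \<Rightarrow> real"
  assumes M: "prob_space M" and N: "prob_space N" and J: "finite J"
    and X: "gaussian_family M J X K" and Y: "gaussian_family N J Y K'"
    and K'_sym: "\<And>i j. i \<in> J \<Longrightarrow> j \<in> J \<Longrightarrow> K' i j = K' j i"
    and diff: "psd_on J (\<lambda>i j. K i j - K' i j)"
  shows "measure M {\<omega> \<in> space M. \<forall>j\<in>J. \<bar>X j \<omega>\<bar> \<le> b} \<le> measure N {\<omega> \<in> space N. \<forall>j\<in>J. \<bar>Y j \<omega>\<bar> \<le> b}"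
proof -
  obtain n and a :: "nat \<Rightarrow> 'i \<Rightarrow> real" where
    a: "\<And>i j. i \<in> J \<Longrightarrow> j \<in> J \<Longrightarrow> K' i j = (\<Sum>k<n. a k i * a k j)"
    using psd_on_imp_gram[OF J gaussian_family_psd[OF N Y K'_sym]] by metis
  obtain m and d :: "nat \<Rightarrow> 'i \<Rightarrow> real" where
    d: "\<And>i j. i \<in> J \<Longrightarrow> j \<in> J \<Longrightarrow> K i j - K' i j = (\<Sum>k<m. d k i * d k j)"
    using psd_on_imp_gram[OF J diff] by metis
  \<comment> \<open>Directions of the smaller covariance first, then those of the excess.\<close>
  define e where "e = (\<lambda>k. if k < n then a k else d (k - n))"
  have e: "K i j = (\<Sum>k<n + m. e k i * e k j)" if "i \<in> J" "j \<in> J" for i j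
  proof -
    have "(\<Sum>k<n + m. e k i * e k j) = (\<Sum>k<n. e k i * e k j) + (\<Sum>k<m. e (n + k) i * e (n + k) j)"
      by (induction m) auto
    also have "\<dots> = K' i j + (K i j - K' i j)"
      using a[OF that] d[OF that] by (simp add: e_def)
    finally show ?thesis by simp
  qed
  have "measure M {\<omega> \<in> space M. \<forall>j\<in>J. \<bar>X j \<omega>\<bar> \<le> b} = smoothed_box J b e (n + m) (\<lambda>i. 0)"
    by (rule gaussian_family_box_prob[OF M J X e])
  also have "\<dots> \<le> smoothed_box J b e n (\<lambda>i. 0)" by (rule smoothed_box_0_antimono) simp
  also have "smoothed_box J b e n = smoothed_box J b a n"
    by (rule smoothed_box_cong) (simp add: e_def)
  also have "smoothed_box J b a n (\<lambda>i. 0) = measure N {\<omega> \<in> space N. \<forall>j\<in>J. \<bar>Y j \<omega>\<bar> \<le> b}"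
    by (rule gaussian_family_box_prob[OF N J Y a, symmetric])
  finally show ?thesis .
qed

section \<open>The covariance deficit of the first family\<close>

lemma c_fun_0 [simp]: "c_fun \<mu> 0 = 1" and s_fun_0 [simp]: "s_fun \<mu> 0 = 0"
  by (auto simp: c_fun_def s_fun_def)

lemma c_fun_deriv [derivative_intros]:
  assumes "(f has_real_derivative f') (at x within S)"
  shows "((\<lambda>x. c_fun \<mu> (f x)) has_real_derivative (\<mu> * s_fun \<mu> (f x) * f')) (at x within S)"
    (is ?c)
  and s_fun_deriv [derivative_intros]:
    "((\<lambda>x. s_fun \<mu> (f x)) has_real_derivative (c_fun \<mu> (f x) * f')) (at x within S)" (is ?s)
proof -
  have "?c \<and> ?s"
  proof -
    consider "\<mu> > 0" | "\<mu> = 0" | "\<mu> < 0" by linarith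
    then show ?thesis
    proof cases
      case 1
      define r where "r = sqrt \<mu>"
      have "r > 0" "\<mu> = r * r" using 1 by (auto simp: r_def)
      moreover have "c_fun \<mu> x = cosh (r * x)" "s_fun \<mu> x = sinh (r * x) / r" for x
        using 1 by (auto simp: c_fun_def s_fun_def r_def)
      ultimately show ?thesis by (auto intro!: derivative_eq_intros assms)
    next
      case 2
      then show ?thesis by (auto simp: c_fun_def s_fun_def intro: assms)
    next
      case 3
      define r where "r = sqrt (- \<mu>)"
      have "r > 0" "\<mu> = - (r * r)" using 3 by (auto simp: r_def)
      moreover have "c_fun \<mu> x = cos (r * x)" "s_fun \<mu> x = sin (r * x) / r" for x
        using 3 by (auto simp: c_fun_def s_fun_def r_def)
      ultimately show ?thesis by (auto intro!: derivative_eq_intros assms)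
    qed
  qed
  then show ?c ?s by auto
qed

text \<open>With \<open>x = ln (s/u)\<close> and \<open>y = ln (t/u)\<close>, this is \<open>u\<close> times a bilinear form in \<open>(c_fun, s_fun)\<close> at \<open>x\<close> and
\<open>y\<close>. The coefficients are the solution of the linear system which says that the derivative in \<open>u\<close> is
\<open>(1 - 4\<mu>) s_fun x * s_fun y\<close>.\<close>

definition C_primitive :: "real \<Rightarrow> real \<Rightarrow> real \<Rightarrow> real \<Rightarrow> real" where
  "C_primitive \<mu> s t u = u * (2 * c_fun \<mu> (ln (s / u)) * c_fun \<mu> (ln (t / u))
     + s_fun \<mu> (ln (s / u)) * c_fun \<mu> (ln (t / u)) + c_fun \<mu> (ln (s / u)) * s_fun \<mu> (ln (t / u))
     + (1 - 2 * \<mu>) * (s_fun \<mu> (ln (s / u)) * s_fun \<mu> (ln (t / u))))"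

lemma C_primitive_deriv:
  assumes "s > 0" "t > 0" "u > 0"
  shows "(C_primitive \<mu> s t has_real_derivative (1 - 4 * \<mu>) * (s_fun \<mu> (ln (s / u)) * s_fun \<mu> (ln (t / u)))) (at u within S)"
proof -
  have ln: "((\<lambda>u. ln (s / u)) has_real_derivative - 1 / u) (at u within S)" if "s > 0" for s
    using that \<open>u > 0\<close> by (auto intro!: derivative_eq_intros simp: field_simps power2_eq_square)
  show ?thesis
    unfolding C_primitive_def
    by (rule DERIV_cong, (rule derivative_intros ln assms)+)
       (use assms in \<open>simp add: field_simps\<close>)
qed

text \<open>At \<open>u = min s t\<close> one of the logarithms vanishes.\<close>

lemma C_primitive_eq_C_cov:
  assumes "s > 0" "t > 0"
  shows "C_primitive \<mu> s t (min s t) = C_cov \<mu> s t"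
  using assms by (cases "s \<le> t") (auto simp: C_primitive_def C_cov_def min_def max_def)

lemma C_cov_commute: "C_cov \<mu> s t = C_cov \<mu> t s"
  by (simp add: C_cov_def min.commute max.commute)

text \<open>The bilinear form in \<open>C_primitive\<close> has matrix \<open>(2, 1; 1, 1 - 2\<mu>)\<close>, whose determinant is \<open>1 - 4\<mu> > 0\<close>.
Therefore the contribution of the lower end of the integral is nonnegative, wherever the integral is
cut off.\<close>

lemma C_primitive_psd:
  assumes mu: "\<mu> < 1/4" and u: "u > 0"
  shows "0 \<le> (\<Sum>s\<in>I. \<Sum>t\<in>I. a s * a t * C_primitive \<mu> s t u)"
proof -
  define X where "X = (\<Sum>t\<in>I. a t * c_fun \<mu> (ln (t / u)))"
  define Y where "Y = (\<Sum>t\<in>I. a t * s_fun \<mu> (ln (t / u)))"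
  have "(\<Sum>s\<in>I. \<Sum>t\<in>I. a s * a t * C_primitive \<mu> s t u)
      = u * (2 * X * X + Y * X + X * Y + (1 - 2 * \<mu>) * (Y * Y))"
  proof -
    have prods:
      "X * X = (\<Sum>s\<in>I. \<Sum>t\<in>I. a s * a t * (c_fun \<mu> (ln (s / u)) * c_fun \<mu> (ln (t / u))))"
      "Y * X = (\<Sum>s\<in>I. \<Sum>t\<in>I. a s * a t * (s_fun \<mu> (ln (s / u)) * c_fun \<mu> (ln (t / u))))"
      "X * Y = (\<Sum>s\<in>I. \<Sum>t\<in>I. a s * a t * (c_fun \<mu> (ln (s / u)) * s_fun \<mu> (ln (t / u))))"
      "Y * Y = (\<Sum>s\<in>I. \<Sum>t\<in>I. a s * a t * (s_fun \<mu> (ln (s / u)) * s_fun \<mu> (ln (t / u))))"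
      unfolding X_def Y_def sum_product by (intro sum.cong refl; simp)+
    show ?thesis
      unfolding mult.assoc[of 2 X X] prods C_primitive_def sum_distrib_left sum.distrib[symmetric]
      by (intro sum.cong refl) (simp add: algebra_simps)
  qed
  also have "\<dots> = u * (2 * (X + Y / 2)\<^sup>2 + 2 * (1/4 - \<mu>) * Y\<^sup>2)"
    by (simp add: power2_eq_square field_simps)
  also have "\<dots> \<ge> 0" using mu u by simp
  finally show ?thesis .
qed

text \<open>By the fundamental theorem of calculus, \<open>C_cov \<mu> s t\<close> is \<open>C_primitive \<mu> s t \<epsilon>\<close> plus the integral of
\<open>(1 - 4\<mu>) g s u * g t u\<close> over \<open>u \<ge> \<epsilon>\<close>. The two terms are positive semidefinite.\<close>

lemma C_cov_psd:
  assumes mu: "\<mu> < 1/4" and I: "finite I" "I \<subseteq> {0<..}"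
  shows "psd_on I (C_cov \<mu>)"
  unfolding psd_on_def
proof (intro conjI ballI allI C_cov_commute)
  fix a :: "real \<Rightarrow> real"
  show "0 \<le> (\<Sum>s\<in>I. \<Sum>t\<in>I. a s * a t * C_cov \<mu> s t)"
  proof (cases "I = {}")
    case False
    define \<epsilon> T where "\<epsilon> = Min I" and "T = Max I"
    have pos: "\<epsilon> > 0" and mem: "\<And>t. t \<in> I \<Longrightarrow> \<epsilon> \<le> t \<and> t \<le> T"
      using I False by (auto simp: \<epsilon>_def T_def)
    define g where "g t u = (if u \<le> t then s_fun \<mu> (ln (t / u)) else 0)" for t u :: real
    have int: "((\<lambda>u. g s u * g t u) has_integral (C_cov \<mu> s t - C_primitive \<mu> s t \<epsilon>) / (1 - 4 * \<mu>)) {\<epsilon>..T}"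
      if st: "s \<in> I" "t \<in> I" for s t
    proof -
      have s: "0 < s" "0 < t" "\<epsilon> \<le> min s t" "min s t \<le> T" using mem[of s] mem[of t] st pos by auto
      have "((\<lambda>u. (1 - 4 * \<mu>) * (s_fun \<mu> (ln (s / u)) * s_fun \<mu> (ln (t / u)))) has_integral
          (C_primitive \<mu> s t (min s t) - C_primitive \<mu> s t \<epsilon>)) {\<epsilon>..min s t}"
      proof (rule fundamental_theorem_of_calculus)
        fix u assume "u \<in> {\<epsilon>..min s t}"
        then have "u > 0" using pos by auto
        then show "(C_primitive \<mu> s t has_vector_derivative
            (1 - 4 * \<mu>) * (s_fun \<mu> (ln (s / u)) * s_fun \<mu> (ln (t / u)))) (at u within {\<epsilon>..min s t})"
          unfolding has_real_derivative_iff_has_vector_derivative[symmetric]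
          by (rule C_primitive_deriv[OF s(1,2)])
      qed (use s in auto)
      from has_integral_mult_right[OF this, of "1 / (1 - 4 * \<mu>)"]
      have "((\<lambda>u. s_fun \<mu> (ln (s / u)) * s_fun \<mu> (ln (t / u))) has_integral
          (C_cov \<mu> s t - C_primitive \<mu> s t \<epsilon>) / (1 - 4 * \<mu>)) {\<epsilon>..min s t}"
        using mu s(1,2) by (simp add: C_primitive_eq_C_cov)
      then have "((\<lambda>u. if u \<in> {\<epsilon>..min s t} then s_fun \<mu> (ln (s / u)) * s_fun \<mu> (ln (t / u)) else 0) has_integral
          (C_cov \<mu> s t - C_primitive \<mu> s t \<epsilon>) / (1 - 4 * \<mu>)) {\<epsilon>..T}"
        using s by (subst has_integral_restrict) auto
      then show ?thesis
        by (rule has_integral_eq[rotated]) (auto simp: g_def)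
    qed
    have "((\<lambda>u. (\<Sum>s\<in>I. \<Sum>t\<in>I. a s * a t * (g s u * g t u))) has_integral
        (\<Sum>s\<in>I. \<Sum>t\<in>I. a s * a t * ((C_cov \<mu> s t - C_primitive \<mu> s t \<epsilon>) / (1 - 4 * \<mu>)))) {\<epsilon>..T}"
      using I by (intro has_integral_sum has_integral_mult_right int) auto
    moreover have "(\<Sum>s\<in>I. \<Sum>t\<in>I. a s * a t * (g s u * g t u)) = (\<Sum>t\<in>I. a t * g t u)\<^sup>2" for u
      by (simp add: power2_eq_square sum_product mult_ac)
    ultimately have "0 \<le> (\<Sum>s\<in>I. \<Sum>t\<in>I. a s * a t * ((C_cov \<mu> s t - C_primitive \<mu> s t \<epsilon>) / (1 - 4 * \<mu>)))"
      by (auto intro: has_integral_nonneg)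
    also have "\<dots> = ((\<Sum>s\<in>I. \<Sum>t\<in>I. a s * a t * C_cov \<mu> s t)
        - (\<Sum>s\<in>I. \<Sum>t\<in>I. a s * a t * C_primitive \<mu> s t \<epsilon>)) / (1 - 4 * \<mu>)"
      by (simp add: sum_subtractf[symmetric] sum_divide_distrib right_diff_distrib)
    finally have "(\<Sum>s\<in>I. \<Sum>t\<in>I. a s * a t * C_primitive \<mu> s t \<epsilon>) \<le> (\<Sum>s\<in>I. \<Sum>t\<in>I. a s * a t * C_cov \<mu> s t)"
      using mu by (simp add: zero_le_divide_iff)
    with C_primitive_psd[OF mu pos, where a = a and I = I] show ?thesis by linarith
  qed simp
qed

section \<open>The covariance deficit of the symmetric family\<close>

definition power_kernel :: "real \<Rightarrow> real \<Rightarrow> real \<Rightarrow> real" where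
  "power_kernel p t u = indicator {0..t} u * (t / u) powr (- p)"

lemma power_kernel_measurable [measurable]: "power_kernel p t \<in> borel_measurable borel"
  unfolding power_kernel_def by measurable

lemma has_bochner_integral_powr_from_0:
  fixes a s :: real
  assumes "a > -1" "s \<ge> 0"
  shows "has_bochner_integral lborel (\<lambda>u. indicator {0..s} u * u powr a) (s powr (a + 1) / (a + 1))"
proof (rule has_bochner_integral_nn_integral)
  have "((\<lambda>u. u powr a) has_integral (s powr (a + 1) / (a + 1))) {0..s}"
    using has_integral_powr_from_0[OF assms] by simp
  then have "((\<lambda>u. if u \<in> {0..s} then u powr a else 0) has_integral (s powr (a + 1) / (a + 1))) UNIV"
    by (subst has_integral_restrict_UNIV)
  then have "((\<lambda>u. indicator {0..s} u * u powr a) has_integral (s powr (a + 1) / (a + 1))) UNIV"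
    by (rule has_integral_eq[rotated]) auto
  then show "(\<integral>\<^sup>+u. ennreal (indicator {0..s} u * u powr a) \<partial>lborel) = ennreal (s powr (a + 1) / (a + 1))"
    by (intro nn_integral_has_integral_lborel) auto
qed (use assms in auto)

text \<open>Only the exponent of the kernel for the larger time survives in the dependence on \<open>s\<close> and \<open>t\<close>.\<close>

lemma power_kernel_product:
  assumes "p + q > -1" and st: "0 < s" "s \<le> t"
  shows "has_bochner_integral lborel (\<lambda>u. power_kernel p s u * power_kernel q t u)
    (s powr (q + 1) * t powr (- q) / (p + q + 1))"
proof -
  have "power_kernel p s u * power_kernel q t u
      = (s powr (- p) * t powr (- q)) * (indicator {0..s} u * u powr (p + q))" for u
  proof (cases "0 < u \<and> u \<le> s")
    case True
    with st show ?thesis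
      by (simp add: power_kernel_def powr_divide powr_minus powr_add field_simps)
  qed (use st in \<open>auto simp: power_kernel_def indicator_def\<close>)
  moreover have "s powr (q + 1) * t powr (- q) / (p + q + 1)
      = (s powr (- p) * t powr (- q)) * (s powr (p + q + 1) / (p + q + 1))"
    using st by (simp add: powr_add powr_minus field_simps)
  moreover have "has_bochner_integral lborel
      (\<lambda>u. (s powr (- p) * t powr (- q)) * (indicator {0..s} u * u powr (p + q)))
      ((s powr (- p) * t powr (- q)) * (s powr (p + q + 1) / (p + q + 1)))"
    using assms by (intro has_bochner_integral_mult_right has_bochner_integral_powr_from_0) auto
  ultimately show ?thesis by (simp only:)
qed

text \<open>The covariance \<open>2 (s t)\<^sup>-\<^sup>\<alpha> (min s t)\<^sup>2\<^sup>\<alpha>\<^sup>+\<^sup>1 / (2\<alpha> + 1)\<close> of \<open>sqrt 2 \<integral> (t/u)\<^sup>-\<^sup>\<alpha> dW\<close>: an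
Ornstein-Uhlenbeck covariance in logarithmic time.\<close>

definition ou_cov :: "real \<Rightarrow> real \<Rightarrow> real \<Rightarrow> real" where
  "ou_cov \<alpha> s t = 2 * (\<integral>u. power_kernel \<alpha> s u * power_kernel \<alpha> t u \<partial>lborel)"

lemma ou_cov_commute: "ou_cov \<alpha> s t = ou_cov \<alpha> t s"
  by (simp add: ou_cov_def mult.commute)

lemma integrable_power_kernel_product:
  assumes "p + q > -1" "0 < s" "0 < t"
  shows "integrable lborel (\<lambda>u. power_kernel p s u * power_kernel q t u)"
  using power_kernel_product[of p q s t] power_kernel_product[of q p t s] assms
  by (cases "s \<le> t") (auto simp: has_bochner_integral_iff mult.commute add.commute)

text \<open>For \<open>s \<le> t\<close> the four products of power kernels integrate to multiples of two functions of \<open>(s, t)\<close>,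
and partial fractions in the exponents match the coefficients. In spectral terms, the difference of
the two Ornstein-Uhlenbeck densities is a positive multiple of their product.\<close>

lemma ou_cov_diff:
  assumes a: "-1/2 < \<alpha>" "\<alpha> < \<alpha>'" and "0 < s" "0 < t"
  shows "ou_cov \<alpha> s t - ou_cov \<alpha>' s t = 2 * (\<alpha> + \<alpha>' + 1) / (\<alpha>' - \<alpha>)
    * (\<integral>u. (power_kernel \<alpha> s u - power_kernel \<alpha>' s u) * (power_kernel \<alpha> t u - power_kernel \<alpha>' t u) \<partial>lborel)"
  using \<open>0 < s\<close> \<open>0 < t\<close>
proof (induction s t rule: linorder_wlog)
  case (sym s t)
  then show ?case by (simp add: ou_cov_commute mult.commute)
next
  case (le s t)
  define x y where "x = s powr (\<alpha> + 1) * t powr (- \<alpha>)" and "y = s powr (\<alpha>' + 1) * t powr (- \<alpha>')"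
  note I = power_kernel_product[OF _ \<open>0 < s\<close> \<open>s \<le> t\<close>]
  have "has_bochner_integral lborel (\<lambda>u. power_kernel \<alpha> s u * power_kernel \<alpha> t u - power_kernel \<alpha> s u * power_kernel \<alpha>' t u
      - power_kernel \<alpha>' s u * power_kernel \<alpha> t u + power_kernel \<alpha>' s u * power_kernel \<alpha>' t u)
      (x / (\<alpha> + \<alpha> + 1) - y / (\<alpha> + \<alpha>' + 1) - x / (\<alpha>' + \<alpha> + 1) + y / (\<alpha>' + \<alpha>' + 1))"
    unfolding x_def y_def using a by (intro has_bochner_integral_add has_bochner_integral_diff I) auto
  then have "(\<integral>u. (power_kernel \<alpha> s u - power_kernel \<alpha>' s u) * (power_kernel \<alpha> t u - power_kernel \<alpha>' t u) \<partial>lborel)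
      = x / (\<alpha> + \<alpha> + 1) - y / (\<alpha> + \<alpha>' + 1) - x / (\<alpha>' + \<alpha> + 1) + y / (\<alpha>' + \<alpha>' + 1)"
    by (simp add: has_bochner_integral_iff algebra_simps)
  moreover have "ou_cov \<alpha> s t = 2 * (x / (\<alpha> + \<alpha> + 1))" "ou_cov \<alpha>' s t = 2 * (y / (\<alpha>' + \<alpha>' + 1))"
    using I[of \<alpha> \<alpha>] I[of \<alpha>' \<alpha>'] a by (simp_all add: ou_cov_def x_def y_def has_bochner_integral_iff)
  moreover have "2 * (x / (\<alpha> + \<alpha> + 1)) - 2 * (y / (\<alpha>' + \<alpha>' + 1)) = 2 * (\<alpha> + \<alpha>' + 1) / (\<alpha>' - \<alpha>)
      * (x / (\<alpha> + \<alpha> + 1) - y / (\<alpha> + \<alpha>' + 1) - x / (\<alpha>' + \<alpha> + 1) + y / (\<alpha>' + \<alpha>' + 1))"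
  proof -
    define D where "D = \<alpha>' - \<alpha>"
    \<comment> \<open>The identity is partial fractions in \<open>B\<close>, \<open>B + D\<close> and \<open>B + 2 D\<close>.\<close>
    define B where "B = \<alpha> + \<alpha> + 1"
    have B: "B > 0" and D: "D > 0" using a by (auto simp: D_def B_def)
    have eqs: "\<alpha> + \<alpha>' + 1 = B + D" "\<alpha>' + \<alpha> + 1 = B + D" "\<alpha>' + \<alpha>' + 1 = B + 2 * D" "\<alpha>' - \<alpha> = D" "\<alpha> + \<alpha> + 1 = B"
      by (auto simp: B_def D_def)
    have "1 / B - 1 / (B + D) = D / (B * (B + D))" "1 / (B + D) - 1 / (B + 2 * D) = D / ((B + D) * (B + 2 * D))"
      using B D by (simp_all add: field_simps)
    moreover have "x / B - y / (B + D) - x / (B + D) + y / (B + 2 * D)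
        = x * (1 / B - 1 / (B + D)) - y * (1 / (B + D) - 1 / (B + 2 * D))"
      by (simp add: right_diff_distrib)
    ultimately have eq: "x / B - y / (B + D) - x / (B + D) + y / (B + 2 * D)
        = D / (B + D) * (x / B - y / (B + 2 * D))"
      by (simp add: right_diff_distrib mult.commute)
    have "2 * (B + D) / D * (D / (B + D) * (x / B - y / (B + 2 * D))) = 2 * (x / B - y / (B + 2 * D))"
      using B D by (simp add: mult.assoc[symmetric] del: mult_cancel_left1 distrib_left_numeral)
    then show ?thesis unfolding eqs eq by simp
  qed
  ultimately show ?case by simp
qed

lemma ou_cov_antimono_psd:
  assumes a: "-1/2 < \<alpha>" "\<alpha> \<le> \<alpha>'" and I: "finite I" "I \<subseteq> {0<..}"
  shows "psd_on I (\<lambda>s t. ou_cov \<alpha> s t - ou_cov \<alpha>' s t)"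
proof (cases "\<alpha> = \<alpha>'")
  case False
  with a have lt: "\<alpha> < \<alpha>'" by simp
  define g where "g t u = power_kernel \<alpha> t u - power_kernel \<alpha>' t u" for t u
  define k where "k = 2 * (\<alpha> + \<alpha>' + 1) / (\<alpha>' - \<alpha>)"
  have k: "k \<ge> 0" using a lt by (simp add: k_def)
  have int: "integrable lborel (\<lambda>u. g s u * g t u)" if "s \<in> I" "t \<in> I" for s t
  proof -
    have "0 < s" "0 < t" using I that by auto
    then have "integrable lborel (\<lambda>u. power_kernel \<alpha> s u * power_kernel \<alpha> t u - power_kernel \<alpha> s u * power_kernel \<alpha>' t u
      - power_kernel \<alpha>' s u * power_kernel \<alpha> t u + power_kernel \<alpha>' s u * power_kernel \<alpha>' t u)"
      using a by (intro Bochner_Integration.integrable_add Bochner_Integration.integrable_diff integrable_power_kernel_product) auto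
    then show ?thesis by (simp add: g_def algebra_simps)
  qed
  show ?thesis
    unfolding psd_on_def
  proof (intro conjI ballI allI)
    fix c :: "real \<Rightarrow> real"
    have "(\<Sum>s\<in>I. \<Sum>t\<in>I. c s * c t * (ou_cov \<alpha> s t - ou_cov \<alpha>' s t))
        = (\<Sum>s\<in>I. \<Sum>t\<in>I. k * (c s * c t * (\<integral>u. g s u * g t u \<partial>lborel)))"
      using I a lt by (intro sum.cong refl) (auto simp: ou_cov_diff g_def k_def subset_eq)
    also have "\<dots> = k * (\<Sum>s\<in>I. \<Sum>t\<in>I. c s * c t * (\<integral>u. g s u * g t u \<partial>lborel))"
      by (simp add: sum_distrib_left)
    also have "(\<Sum>s\<in>I. \<Sum>t\<in>I. c s * c t * (\<integral>u. g s u * g t u \<partial>lborel))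
        = (\<integral>u. (\<Sum>s\<in>I. \<Sum>t\<in>I. c s * c t * (g s u * g t u)) \<partial>lborel)"
      by (simp add: Bochner_Integration.integral_sum int integrable_sum)
    also have "\<dots> = (\<integral>u. (\<Sum>t\<in>I. c t * g t u)\<^sup>2 \<partial>lborel)"
      by (simp add: power2_eq_square sum_product mult_ac)
    also have "k * \<dots> \<ge> 0" using k by simp
    finally show "0 \<le> (\<Sum>s\<in>I. \<Sum>t\<in>I. c s * c t * (ou_cov \<alpha> s t - ou_cov \<alpha>' s t))" .
  qed (simp add: ou_cov_commute)
qed (simp add: psd_on_def)

section \<open>Gaussian processes as Gaussian families\<close>

lemma char_normal:
  assumes M: "prob_space M" and \<sigma>: "\<sigma> > 0"
    and X: "distributed M lborel X (\<lambda>x. ennreal (normal_density 0 \<sigma> x))"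
  shows "(\<integral>\<omega>. iexp (u * X \<omega>) \<partial>M) = complex_of_real (exp (- (u * \<sigma>)\<^sup>2 / 2))"
proof -
  interpret prob_space M by fact
  have Z: "distributed M lborel (\<lambda>\<omega>. X \<omega> / \<sigma>) (\<lambda>x. ennreal (std_normal_density x))"
    using X normal_standard_normal_convert[OF \<sigma>, of X 0] by simp
  have [measurable]: "(\<lambda>\<omega>. X \<omega> / \<sigma>) \<in> borel_measurable M"
    using distributed_measurable[OF Z] by simp
  have "(\<integral>\<omega>. iexp (u * X \<omega>) \<partial>M) = (\<integral>\<omega>. iexp ((u * \<sigma>) * (X \<omega> / \<sigma>)) \<partial>M)"
    using \<sigma> by simp
  also have "\<dots> = (\<integral>x. iexp ((u * \<sigma>) * x) \<partial>distr M lborel (\<lambda>\<omega>. X \<omega> / \<sigma>))"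
    by (subst integral_distr) (auto simp: measurable_lborel1)
  also have "\<dots> = complex_of_real (exp (- (u * \<sigma>)\<^sup>2 / 2))"
    unfolding distributed_distr_eq_density[OF Z] by (rule char_std_normal)
  finally show ?thesis .
qed

text \<open>In the degenerate case the almost sure value is the mean, so it is \<open>0\<close>.\<close>

lemma centered_gaussian_rv:
  assumes M: "prob_space M" and X: "gaussian_rv M X" and mean: "(\<integral>\<omega>. X \<omega> \<partial>M) = 0"
  shows "integrable M X" and "integrable M (\<lambda>\<omega>. (X \<omega>)\<^sup>2)"
    and "(\<integral>\<omega>. iexp (X \<omega>) \<partial>M) = complex_of_real (exp (- (\<integral>\<omega>. (X \<omega>)\<^sup>2 \<partial>M) / 2))"
proof -
  interpret prob_space M by fact
  have [measurable]: "X \<in> borel_measurable M" using X by (simp add: gaussian_rv_def)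
  consider m where "AE \<omega> in M. X \<omega> = m"
    | m \<sigma> where "\<sigma> > 0" "distributed M lborel X (\<lambda>x. ennreal (normal_density m \<sigma> x))"
    using X by (auto simp: gaussian_rv_def)
  then have "integrable M X \<and> integrable M (\<lambda>\<omega>. (X \<omega>)\<^sup>2)
    \<and> (\<integral>\<omega>. iexp (X \<omega>) \<partial>M) = complex_of_real (exp (- (\<integral>\<omega>. (X \<omega>)\<^sup>2 \<partial>M) / 2))"
  proof cases
    case 1
    have "(\<integral>\<omega>. X \<omega> \<partial>M) = (\<integral>\<omega>. m \<partial>M)" by (rule integral_cong_AE) (use 1 in auto)
    then have "m = 0" using mean by (simp add: prob_space)
    with 1 have 0: "AE \<omega> in M. X \<omega> = 0" by simp
    have "integrable M X \<longleftrightarrow> integrable M (\<lambda>\<omega>. 0 :: real)"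
      by (rule integrable_cong_AE) (use 0 in auto)
    moreover have "integrable M (\<lambda>\<omega>. (X \<omega>)\<^sup>2) \<longleftrightarrow> integrable M (\<lambda>\<omega>. 0 :: real)"
      by (rule integrable_cong_AE) (use 0 in auto)
    moreover have "(\<integral>\<omega>. (X \<omega>)\<^sup>2 \<partial>M) = (\<integral>\<omega>. 0 \<partial>M)"
      by (rule integral_cong_AE) (use 0 in auto)
    moreover have "(\<integral>\<omega>. iexp (X \<omega>) \<partial>M) = (\<integral>\<omega>. 1 \<partial>M)"
      by (rule integral_cong_AE) (use 0 in auto)
    ultimately show ?thesis by (simp add: prob_space)
  next
    case 2
    have "m = 0" using normal_distributed_expectation[OF 2] mean by simp
    note X = 2(2)[unfolded this]
    have "integrable M X"
      using distributed_integrable[OF X, of "\<lambda>x. x"] integrable_normal_moment[OF 2(1), of 0 1] by simp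
    moreover have "integrable M (\<lambda>\<omega>. (X \<omega>)\<^sup>2)"
      using distributed_integrable[OF X, of "\<lambda>x. x\<^sup>2"] integrable_normal_moment[OF 2(1), of 0 2] by simp
    moreover have "(\<integral>\<omega>. (X \<omega>)\<^sup>2 \<partial>M) = \<sigma>\<^sup>2"
      using normal_distributed_variance[OF 2(1) X] mean by simp
    ultimately show ?thesis using char_normal[OF M 2(1) X, of 1] by simp
  qed
  then show "integrable M X" "integrable M (\<lambda>\<omega>. (X \<omega>)\<^sup>2)"
    "(\<integral>\<omega>. iexp (X \<omega>) \<partial>M) = complex_of_real (exp (- (\<integral>\<omega>. (X \<omega>)\<^sup>2 \<partial>M) / 2))" by auto
qed

text \<open>Each linear combination is a centered Gaussian variable, whose variance is the quadratic form of the
covariance.\<close>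

lemma centered_gaussian_process_family:
  assumes M: "prob_space M" and V: "centered_gaussian_process M V"
    and I: "finite I" "I \<subseteq> {0..}"
    and cov: "\<And>s t. s \<in> I \<Longrightarrow> t \<in> I \<Longrightarrow> (\<integral>\<omega>. V s \<omega> * V t \<omega> \<partial>M) = K s t"
  shows "gaussian_family M I V K"
proof -
  interpret prob_space M by fact
  have rv: "gaussian_rv M (\<lambda>\<omega>. \<Sum>t\<in>J. a t * V t \<omega>)" if "finite J" "J \<subseteq> {0..}" for J a
    using V that by (auto simp: centered_gaussian_process_def)
  have rv1: "gaussian_rv M (V t)" and mean1: "(\<integral>\<omega>. V t \<omega> \<partial>M) = 0" if "t \<in> I" for t
    using rv[of "{t}" "\<lambda>_. 1"] V that I by (auto simp: centered_gaussian_process_def)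
  note one = centered_gaussian_rv[OF M rv1 mean1]
  have m[measurable]: "V t \<in> borel_measurable M" if "t \<in> I" for t
    using rv1[OF that] by (simp add: gaussian_rv_def)
  have int2: "integrable M (\<lambda>\<omega>. V s \<omega> * V t \<omega>)" if st: "s \<in> I" "t \<in> I" for s t
  proof (rule Bochner_Integration.integrable_bound)
    show "integrable M (\<lambda>\<omega>. (V s \<omega>)\<^sup>2 + (V t \<omega>)\<^sup>2)" using one(2) st by auto
    show "(\<lambda>\<omega>. V s \<omega> * V t \<omega>) \<in> borel_measurable M" using m st by auto
    have "\<bar>x * y\<bar> \<le> x\<^sup>2 + y\<^sup>2" for x y :: real
    proof -
      have "2 * (\<bar>x\<bar> * \<bar>y\<bar>) \<le> x\<^sup>2 + y\<^sup>2" using sum_squares_bound[of "\<bar>x\<bar>" "\<bar>y\<bar>"] by simp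
      then show ?thesis using mult_nonneg_nonneg[of "\<bar>x\<bar>" "\<bar>y\<bar>"] unfolding abs_mult by linarith
    qed
    then show "AE \<omega> in M. norm (V s \<omega> * V t \<omega>) \<le> norm ((V s \<omega>)\<^sup>2 + (V t \<omega>)\<^sup>2)" by auto
  qed
  show ?thesis
    unfolding gaussian_family_def
  proof (intro conjI ballI allI m)
    fix c :: "real \<Rightarrow> real"
    have "(\<integral>\<omega>. (\<Sum>t\<in>I. c t * V t \<omega>) \<partial>M) = 0"
      using one(1) mean1 by (subst Bochner_Integration.integral_sum) auto
    from centered_gaussian_rv(3)[OF M rv[OF I] this]
    have "(\<integral>\<omega>. iexp (\<Sum>t\<in>I. c t * V t \<omega>) \<partial>M)
        = complex_of_real (exp (- (\<integral>\<omega>. (\<Sum>t\<in>I. c t * V t \<omega>)\<^sup>2 \<partial>M) / 2))" .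
    also have "(\<integral>\<omega>. (\<Sum>t\<in>I. c t * V t \<omega>)\<^sup>2 \<partial>M)
        = (\<integral>\<omega>. (\<Sum>s\<in>I. \<Sum>t\<in>I. c s * c t * (V s \<omega> * V t \<omega>)) \<partial>M)"
      by (simp add: power2_eq_square sum_product mult_ac)
    also have "\<dots> = (\<Sum>s\<in>I. \<Sum>t\<in>I. c s * c t * K s t)"
      using int2 cov by (simp add: Bochner_Integration.integral_sum integrable_sum)
    finally show "(\<integral>\<omega>. iexp (\<Sum>t\<in>I. c t * V t \<omega>) \<partial>M)
        = complex_of_real (exp (- (\<Sum>s\<in>I. \<Sum>t\<in>I. c s * c t * K s t) / 2))" .
  qed
qed

section \<open>Wiener integrals as Gaussian families\<close>

lemma finite_set_enumeration:
  fixes P :: "real set"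
  assumes "finite P" "P \<noteq> {}"
  obtains n and p :: "nat \<Rightarrow> real" where "strict_mono_on {..n} p" "p ` {..n} = P"
proof -
  define xs where "xs = sorted_list_of_set P"
  have xs: "set xs = P" "sorted_wrt (<) xs"
    using assms by (auto simp: xs_def)
  then have "xs \<noteq> []" using assms by auto
  then have len: "{..length xs - 1} = {..<length xs}" by (cases xs) auto
  show ?thesis
  proof
    show "strict_mono_on {..length xs - 1} ((!) xs)"
      unfolding len using xs(2) by (auto simp: strict_mono_on_def sorted_wrt_iff_nth_less)
    show "(!) xs ` {..length xs - 1} = P"
      unfolding len xs(1)[symmetric] by (auto simp: in_set_conv_nth)
  qed
qed

text \<open>A telescoping sum, for increments of the Brownian path (\<open>h t = B t \<omega>\<close>) as well as for indicators
(\<open>h t = indicator {..t} u\<close>).\<close>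

lemma telescope_over_partition:
  fixes p :: "nat \<Rightarrow> real" and h :: "real \<Rightarrow> 'e::real_vector"
  assumes p: "strict_mono_on {..n} p" and ab: "a \<in> p ` {..n}" "b \<in> p ` {..n}" "a \<le> b"
  shows "(\<Sum>k<n. indicator {a<..b} (p (Suc k)) *\<^sub>R (h (p (Suc k)) - h (p k))) = h b - h a"
proof -
  obtain i j where ij: "i \<le> n" "j \<le> n" "a = p i" "b = p j" using ab by auto
  have less: "p k < p l \<longleftrightarrow> k < l" if "k \<le> n" "l \<le> n" for k l
    using strict_mono_on_less[OF p] that by auto
  have le: "p k \<le> p l \<longleftrightarrow> k \<le> l" if "k \<le> n" "l \<le> n" for k l
    using strict_mono_on_less_eq[OF p] that by auto
  have "i \<le> j" using ij ab le by auto
  have "(\<Sum>k<n. indicator {a<..b} (p (Suc k)) *\<^sub>R (h (p (Suc k)) - h (p k)))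
      = (\<Sum>k<n. if k \<in> {i..<j} then h (p (Suc k)) - h (p k) else 0)"
    using ij by (intro sum.cong refl) (auto simp: indicator_def less le)
  also have "\<dots> = (\<Sum>k\<in>{i..<j}. h (p (Suc k)) - h (p k))"
    using ij by (subst sum.If_cases) (auto intro!: sum.cong)
  also have "\<dots> = h b - h a"
    using sum_Suc_diff'[OF \<open>i \<le> j\<close>, of "\<lambda>k. h (p k)"] ij by simp
  finally show ?thesis .
qed

text \<open>All steps are cut at a common partition containing their end points. On \<open>(p k, p (k+1)]\<close> the step
function is constant and its value is read off at the right end point.\<close>

lemma step_integral_refine:
  assumes p: "strict_mono_on {..n} p"
    and xs: "\<And>a b c. (a, b, c) \<in> set xs \<Longrightarrow> a \<in> p ` {..n} \<and> b \<in> p ` {..n} \<and> a \<le> b"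
  shows "step_integral B xs \<omega> = (\<Sum>k<n. step_fun xs (p (Suc k)) \<bullet> (B (p (Suc k)) \<omega> - B (p k) \<omega>))"
    and "step_fun xs u = (\<Sum>k<n. indicator {p k<..p (Suc k)} u *\<^sub>R step_fun xs (p (Suc k)))"
proof -
  have le: "p k \<le> p (Suc k)" if "k < n" for k
    using strict_mono_on_less_eq[OF p, of k "Suc k"] that by auto
  have "step_integral B xs \<omega> = (\<Sum>k<n. step_fun xs (p (Suc k)) \<bullet> (B (p (Suc k)) \<omega> - B (p k) \<omega>)) \<and>
      step_fun xs u = (\<Sum>k<n. indicator {p k<..p (Suc k)} u *\<^sub>R step_fun xs (p (Suc k)))"
    using xs
  proof (induction xs)
    case (Cons x xs)
    obtain a b c where x: "x = (a, b, c)" by (cases x) auto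
    have abc: "a \<in> p ` {..n}" "b \<in> p ` {..n}" "a \<le> b" using Cons.prems[of a b c] x by auto
    have IH: "step_integral B xs \<omega> = (\<Sum>k<n. step_fun xs (p (Suc k)) \<bullet> (B (p (Suc k)) \<omega> - B (p k) \<omega>))"
      "step_fun xs u = (\<Sum>k<n. indicator {p k<..p (Suc k)} u *\<^sub>R step_fun xs (p (Suc k)))"
      using Cons.IH Cons.prems by auto
    have sf: "step_fun (x # xs) v = indicator {a<..b} v *\<^sub>R c + step_fun xs v" for v
      by (simp add: step_fun_def x)
    have 1: "c \<bullet> (B b \<omega> - B a \<omega>)
        = (\<Sum>k<n. (indicator {a<..b} (p (Suc k)) *\<^sub>R c) \<bullet> (B (p (Suc k)) \<omega> - B (p k) \<omega>))"
      using telescope_over_partition[OF p abc, where h = "\<lambda>t. B t \<omega>"]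
      by (simp add: inner_sum_right[symmetric] flip: inner_scaleR_right)
    have "(\<Sum>k<n. indicator {a<..b} (p (Suc k)) *\<^sub>R indicator {p k<..p (Suc k)} u) = (indicator {a<..b} u :: real)"
    proof -
      have "(indicator {..p (Suc k)} u - indicator {..p k} u :: real) = indicator {p k<..p (Suc k)} u" if "k < n" for k
        using le[OF that] by (auto simp: indicator_def)
      moreover have "(indicator {..b} u - indicator {..a} u :: real) = indicator {a<..b} u"
        using abc by (auto simp: indicator_def)
      ultimately show ?thesis
        using telescope_over_partition[OF p abc, where h = "\<lambda>t. indicator {..t} u :: real"] by simp
    qed
    then have 2: "indicator {a<..b} u *\<^sub>R c
        = (\<Sum>k<n. indicator {p k<..p (Suc k)} u *\<^sub>R (indicator {a<..b} (p (Suc k)) *\<^sub>R c))"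
      by (simp add: scaleR_sum_left[symmetric] mult.commute)
    have "step_integral B (x # xs) \<omega> = c \<bullet> (B b \<omega> - B a \<omega>) + step_integral B xs \<omega>"
      by (simp add: step_integral_def x)
    then show ?case
      unfolding sf by (auto simp: 1 2 IH inner_add_left scaleR_add_right sum.distrib)
  qed (simp add: step_integral_def step_fun_def)
  then show "step_integral B xs \<omega> = (\<Sum>k<n. step_fun xs (p (Suc k)) \<bullet> (B (p (Suc k)) \<omega> - B (p k) \<omega>))"
    "step_fun xs u = (\<Sum>k<n. indicator {p k<..p (Suc k)} u *\<^sub>R step_fun xs (p (Suc k)))" by auto
qed

text \<open>The intervals of the partition are disjoint, so at most one term of the refined sum is nonzero at
each point.\<close>

lemma step_fun_norm_integral:
  fixes xs :: "(real \<times> real \<times> 'e::euclidean_space) list"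
  assumes p: "strict_mono_on {..n} p"
    and xs: "\<And>a b c. (a, b, c) \<in> set xs \<Longrightarrow> a \<in> p ` {..n} \<and> b \<in> p ` {..n} \<and> a \<le> b"
  shows "has_bochner_integral lborel (\<lambda>u. (norm (step_fun xs u))\<^sup>2)
    (\<Sum>k<n. (norm (step_fun xs (p (Suc k))))\<^sup>2 * (p (Suc k) - p k))"
proof -
  have le: "p k \<le> p (Suc k)" if "k < n" for k
    using strict_mono_on_less_eq[OF p, of k "Suc k"] that by auto
  have refine: "step_fun xs u = (\<Sum>k<n. indicator {p k<..p (Suc k)} u *\<^sub>R step_fun xs (p (Suc k)))" for u
    by (rule step_integral_refine(2)[OF p]) (use xs in blast)
  have eq: "(norm (step_fun xs u))\<^sup>2 = (\<Sum>k<n. (norm (step_fun xs (p (Suc k))))\<^sup>2 * indicator {p k<..p (Suc k)} u)" for u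
  proof (cases "\<exists>k<n. u \<in> {p k<..p (Suc k)}")
    case True
    then obtain k where k: "k < n" "u \<in> {p k<..p (Suc k)}" by auto
    have other: "indicator {p l<..p (Suc l)} u = (if l = k then 1 else 0 :: real)" if "l < n" for l
    proof -
      have "l = k" if "u \<in> {p l<..p (Suc l)}"
      proof (rule ccontr)
        assume "l \<noteq> k"
        then have "Suc l \<le> k \<or> Suc k \<le> l" by auto
        then show False
          using k that \<open>l < n\<close> strict_mono_on_less_eq[OF p, of "Suc l" k] strict_mono_on_less_eq[OF p, of "Suc k" l]
          by auto
      qed
      then have "u \<in> {p l<..p (Suc l)} \<longleftrightarrow> l = k" using k by blast
      then show ?thesis by (simp only: indicator_def of_bool_def)
    qed
    have "step_fun xs u = (\<Sum>l<n. if l = k then step_fun xs (p (Suc k)) else 0)"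
      by (subst refine, intro sum.cong refl) (simp add: other)
    moreover have "(\<Sum>l<n. (norm (step_fun xs (p (Suc l))))\<^sup>2 * indicator {p l<..p (Suc l)} u)
        = (\<Sum>l<n. if l = k then (norm (step_fun xs (p (Suc k))))\<^sup>2 else 0)"
      by (intro sum.cong refl) (simp add: other)
    ultimately show ?thesis using k by simp
  next
    case False
    then have "indicator {p l<..p (Suc l)} u = (0 :: real)" if "l < n" for l
      using that by (simp add: indicator_def)
    moreover from this have "step_fun xs u = 0"
      by (subst refine) (auto intro!: sum.neutral)
    ultimately show ?thesis by simp
  qed
  have "has_bochner_integral lborel (indicator {p k<..p (Suc k)}) (p (Suc k) - p k)" if "k < n" for k
    using le[OF that] has_bochner_integral_real_indicator[of "{p k<..p (Suc k)}" lborel] by simp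
  then have "has_bochner_integral lborel
      (\<lambda>u. \<Sum>k<n. (norm (step_fun xs (p (Suc k))))\<^sup>2 * indicator {p k<..p (Suc k)} u)
      (\<Sum>k<n. (norm (step_fun xs (p (Suc k))))\<^sup>2 * (p (Suc k) - p k))"
    by (intro has_bochner_integral_sum has_bochner_integral_mult_right) auto
  then show ?thesis by (simp only: eq[symmetric])
qed

lemma brownian_motionD:
  fixes B :: "real \<Rightarrow> 'a \<Rightarrow> 'e::euclidean_space"
  assumes "brownian_motion M B"
  shows "prob_space M"
    and "0 \<le> t \<Longrightarrow> B t \<in> borel_measurable M"
    and "0 \<le> p 0 \<Longrightarrow> strict_mono_on {..n} p \<Longrightarrow> prob_space.indep_vars M (\<lambda>_. borel)
      (\<lambda>(k, b) \<omega>. (B (p (Suc k)) \<omega> - B (p k) \<omega>) \<bullet> b) ({..<n} \<times> Basis)"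
    and "0 \<le> s \<Longrightarrow> s < t \<Longrightarrow> b \<in> Basis \<Longrightarrow> distributed M lborel (\<lambda>\<omega>. (B t \<omega> - B s \<omega>) \<bullet> b)
      (\<lambda>x. ennreal (normal_density 0 (sqrt (t - s)) x))"
  using assms unfolding brownian_motion_def by simp_all

text \<open>After refinement the integral is a sum of independent normal variables, indexed by the intervals and
the coordinates, and the characteristic function is a product.\<close>

lemma char_step_integral:
  fixes xs :: "(real \<times> real \<times> 'e::euclidean_space) list" and B :: "real \<Rightarrow> 'a \<Rightarrow> 'e"
  assumes B: "brownian_motion M B" and xs: "step_list_on T xs"
  shows "(\<integral>\<omega>. iexp (step_integral B xs \<omega>) \<partial>M)
    = complex_of_real (exp (- (\<integral>u. (norm (step_fun xs u))\<^sup>2 \<partial>lborel) / 2))"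
    and "integrable lborel (\<lambda>u. (norm (step_fun xs u))\<^sup>2)"
proof -
  have M: "prob_space M" by (rule brownian_motionD(1)[OF B])
  interpret prob_space M by fact
  \<comment> \<open>Time \<open>0\<close> is added so that the partition is nonempty.\<close>
  define P where "P = insert 0 ((\<lambda>(a, b, c). a) ` set xs \<union> (\<lambda>(a, b, c). b) ` set xs)"
  have "finite P" "P \<noteq> {}" by (auto simp: P_def)
  then obtain n and p :: "nat \<Rightarrow> real" where p: "strict_mono_on {..n} p" and Pp: "p ` {..n} = P"
    using finite_set_enumeration by metis
  have P0: "x \<ge> 0" if "x \<in> P" for x
    using xs that unfolding P_def step_list_on_def by fastforce
  have xs': "a \<in> p ` {..n} \<and> b \<in> p ` {..n} \<and> a \<le> b" if "(a, b, c) \<in> set xs" for a b c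
  proof -
    have "a \<le> b" using xs that by (auto simp: step_list_on_def)
    moreover have "a \<in> P" "b \<in> P"
      unfolding P_def using that by (auto intro!: image_eqI[where x = "(a, b, c)"])
    ultimately show ?thesis unfolding Pp by blast
  qed
  have p0: "p k \<ge> 0" if "k \<le> n" for k using P0 Pp that by auto
  have less: "p k < p (Suc k)" if "k < n" for k
    using strict_mono_on_less[OF p, of k "Suc k"] that by auto
  have norm_int: "has_bochner_integral lborel (\<lambda>u. (norm (step_fun xs u))\<^sup>2)
    (\<Sum>k<n. (norm (step_fun xs (p (Suc k))))\<^sup>2 * (p (Suc k) - p k))"
    by (rule step_fun_norm_integral[OF p]) (use xs' in blast)
  define C where "C k = step_fun xs (p (Suc k))" for k
  define D where "D = (\<lambda>(k, b) \<omega>. (B (p (Suc k)) \<omega> - B (p k) \<omega>) \<bullet> b)"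
  have "indep_vars (\<lambda>_. borel) D ({..<n} \<times> Basis)"
    unfolding D_def using p p0[of 0] by (intro brownian_motionD(3)[OF B]) auto
  then have ind: "indep_vars (\<lambda>_. borel) (\<lambda>i \<omega>. (C (fst i) \<bullet> snd i) * D i \<omega>) ({..<n} \<times> Basis)"
    by (rule indep_vars_compose2[where Y = "\<lambda>i x. (C (fst i) \<bullet> snd i) * x"]) auto
  have rv: "(\<lambda>\<omega>. (C (fst i) \<bullet> snd i) * D i \<omega>) \<in> borel_measurable M" if "i \<in> {..<n} \<times> Basis" for i
    using ind that by (auto simp: indep_vars_def)
  have si: "step_integral B xs \<omega> = (\<Sum>i\<in>{..<n} \<times> Basis. (C (fst i) \<bullet> snd i) * D i \<omega>)" for \<omega>
  proof -
    have "step_integral B xs \<omega> = (\<Sum>k<n. C k \<bullet> (B (p (Suc k)) \<omega> - B (p k) \<omega>))"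
      unfolding C_def by (rule step_integral_refine(1)[OF p]) (use xs' in blast)
    also have "\<dots> = (\<Sum>k<n. \<Sum>b\<in>Basis. (C k \<bullet> b) * D (k, b) \<omega>)"
      by (intro sum.cong refl, subst euclidean_inner) (simp add: D_def)
    finally show ?thesis by (simp add: sum.cartesian_product case_prod_unfold)
  qed
  have "(\<integral>\<omega>. iexp (step_integral B xs \<omega>) \<partial>M)
      = char (distr M borel (\<lambda>\<omega>. \<Sum>i\<in>{..<n} \<times> Basis. (C (fst i) \<bullet> snd i) * D i \<omega>)) 1"
    unfolding si char_def using rv by (subst integral_distr) auto
  also have "\<dots> = (\<Prod>i\<in>{..<n} \<times> Basis. char (distr M borel (\<lambda>\<omega>. (C (fst i) \<bullet> snd i) * D i \<omega>)) 1)"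
    by (rule char_distr_sum[OF ind])
  also have "\<dots> = (\<Prod>i\<in>{..<n} \<times> Basis. complex_of_real (exp (- (C (fst i) \<bullet> snd i)\<^sup>2 * (p (Suc (fst i)) - p (fst i)) / 2)))"
  proof (intro prod.cong refl)
    fix i :: "nat \<times> 'e" assume i: "i \<in> {..<n} \<times> Basis"
    then have k: "fst i < n" "snd i \<in> Basis" by auto
    have dist: "distributed M lborel (D i) (\<lambda>x. ennreal (normal_density 0 (sqrt (p (Suc (fst i)) - p (fst i))) x))"
      using brownian_motionD(4)[OF B p0[of "fst i"] less[OF k(1)] k(2)] k(1)
      by (simp add: D_def case_prod_unfold)
    have "char (distr M borel (\<lambda>\<omega>. (C (fst i) \<bullet> snd i) * D i \<omega>)) 1 = (\<integral>\<omega>. iexp ((C (fst i) \<bullet> snd i) * D i \<omega>) \<partial>M)"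
      unfolding char_def using rv[OF i] by (subst integral_distr) auto
    also have "\<dots> = complex_of_real (exp (- ((C (fst i) \<bullet> snd i) * sqrt (p (Suc (fst i)) - p (fst i)))\<^sup>2 / 2))"
      by (rule char_normal[OF M _ dist]) (use less k in auto)
    finally show "char (distr M borel (\<lambda>\<omega>. (C (fst i) \<bullet> snd i) * D i \<omega>)) 1
      = complex_of_real (exp (- (C (fst i) \<bullet> snd i)\<^sup>2 * (p (Suc (fst i)) - p (fst i)) / 2))"
      using less[OF k(1)] by (simp add: power_mult_distrib)
  qed
  also have "\<dots> = complex_of_real (exp (\<Sum>i\<in>{..<n} \<times> Basis. - (C (fst i) \<bullet> snd i)\<^sup>2 * (p (Suc (fst i)) - p (fst i)) / 2))"
    by (simp only: exp_sum finite_cartesian_product finite_lessThan finite_Basis of_real_prod)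
  also have "(\<Sum>i\<in>{..<n} \<times> Basis. - (C (fst i) \<bullet> snd i)\<^sup>2 * (p (Suc (fst i)) - p (fst i)) / 2)
      = - (\<Sum>k<n. (norm (C k))\<^sup>2 * (p (Suc k) - p k)) / 2"
  proof -
    have n: "(norm (C k))\<^sup>2 = (\<Sum>b\<in>Basis. (C k \<bullet> b)\<^sup>2)" for k
      unfolding power2_norm_eq_inner by (subst euclidean_inner) (simp add: power2_eq_square)
    have "(\<Sum>i\<in>{..<n} \<times> Basis. - (C (fst i) \<bullet> snd i)\<^sup>2 * (p (Suc (fst i)) - p (fst i)) / 2)
        = (\<Sum>k<n. \<Sum>b\<in>Basis. - (C k \<bullet> b)\<^sup>2 * (p (Suc k) - p k) / 2)"
      by (simp only: sum.cartesian_product' fst_conv snd_conv)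
    also have "\<dots> = (\<Sum>k<n. - ((\<Sum>b\<in>Basis. (C k \<bullet> b)\<^sup>2) * (p (Suc k) - p k)) / 2)"
      by (intro sum.cong refl) (simp add: sum_distrib_right sum_divide_distrib sum_negf)
    finally show ?thesis by (simp add: n sum_negf[symmetric] sum_divide_distrib)
  qed
  finally show "(\<integral>\<omega>. iexp (step_integral B xs \<omega>) \<partial>M)
    = complex_of_real (exp (- (\<integral>u. (norm (step_fun xs u))\<^sup>2 \<partial>lborel) / 2))"
    and "integrable lborel (\<lambda>u. (norm (step_fun xs u))\<^sup>2)"
    using norm_int by (simp_all add: has_bochner_integral_iff C_def)
qed

lemma l2_tendsto_sum:
  fixes F :: "'i \<Rightarrow> 'a \<Rightarrow> 'e::euclidean_space"
  assumes I: "finite I"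
    and F[measurable]: "\<And>t. t \<in> I \<Longrightarrow> F t \<in> borel_measurable M"
    and G[measurable]: "\<And>t n. t \<in> I \<Longrightarrow> G t n \<in> borel_measurable M"
    and lim: "\<And>t. t \<in> I \<Longrightarrow> (\<lambda>n::nat. \<integral>\<^sup>+x. ennreal ((norm (F t x - G t n x))\<^sup>2) \<partial>M) \<longlonglongrightarrow> 0"
  shows "(\<lambda>n. \<integral>\<^sup>+x. ennreal ((norm ((\<Sum>t\<in>I. c t *\<^sub>R F t x) - (\<Sum>t\<in>I. c t *\<^sub>R G t n x)))\<^sup>2) \<partial>M) \<longlonglongrightarrow> 0"
proof (rule tendsto_sandwich)
  define k where "k t = (c t)\<^sup>2 * card I" for t
  define U where "U n = (\<Sum>t\<in>I. ennreal (k t) * (\<integral>\<^sup>+x. ennreal ((norm (F t x - G t n x))\<^sup>2) \<partial>M))" for n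
  show "eventually (\<lambda>n. 0 \<le> (\<integral>\<^sup>+x. ennreal ((norm ((\<Sum>t\<in>I. c t *\<^sub>R F t x) - (\<Sum>t\<in>I. c t *\<^sub>R G t n x)))\<^sup>2) \<partial>M)) sequentially"
    by simp
  show "(\<lambda>_. 0 :: ennreal) \<longlonglongrightarrow> 0" by simp
  have "U \<longlonglongrightarrow> (\<Sum>t\<in>I. ennreal (k t) * 0)"
    unfolding U_def by (intro tendsto_sum ennreal_tendsto_cmult lim) auto
  then show "U \<longlonglongrightarrow> 0" by simp
  have pt: "(norm ((\<Sum>t\<in>I. c t *\<^sub>R F t x) - (\<Sum>t\<in>I. c t *\<^sub>R G t n x)))\<^sup>2
      \<le> (\<Sum>t\<in>I. k t * (norm (F t x - G t n x))\<^sup>2)" for n x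
  proof -
    have "norm ((\<Sum>t\<in>I. c t *\<^sub>R F t x) - (\<Sum>t\<in>I. c t *\<^sub>R G t n x)) = norm (\<Sum>t\<in>I. c t *\<^sub>R (F t x - G t n x))"
      by (simp add: sum_subtractf scaleR_diff_right)
    also have "\<dots> \<le> (\<Sum>t\<in>I. \<bar>c t\<bar> * norm (F t x - G t n x))"
      using norm_sum[of "\<lambda>t. c t *\<^sub>R (F t x - G t n x)" I] by simp
    finally have "(norm ((\<Sum>t\<in>I. c t *\<^sub>R F t x) - (\<Sum>t\<in>I. c t *\<^sub>R G t n x)))\<^sup>2
        \<le> (\<Sum>t\<in>I. \<bar>c t\<bar> * norm (F t x - G t n x))\<^sup>2" by (intro power_mono) auto
    also have "\<dots> \<le> (\<Sum>t\<in>I. (\<bar>c t\<bar> * norm (F t x - G t n x))\<^sup>2) * card I"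
      by (rule sum_squared_le_sum_of_squares)
    also have "\<dots> = (\<Sum>t\<in>I. k t * (norm (F t x - G t n x))\<^sup>2)"
      by (simp add: k_def sum_distrib_left sum_distrib_right power_mult_distrib mult_ac)
    finally show ?thesis .
  qed
  have "(\<integral>\<^sup>+x. ennreal ((norm ((\<Sum>t\<in>I. c t *\<^sub>R F t x) - (\<Sum>t\<in>I. c t *\<^sub>R G t n x)))\<^sup>2) \<partial>M) \<le> U n" for n
  proof -
    have "(\<integral>\<^sup>+x. ennreal ((norm ((\<Sum>t\<in>I. c t *\<^sub>R F t x) - (\<Sum>t\<in>I. c t *\<^sub>R G t n x)))\<^sup>2) \<partial>M)
        \<le> (\<integral>\<^sup>+x. (\<Sum>t\<in>I. ennreal (k t) * ennreal ((norm (F t x - G t n x))\<^sup>2)) \<partial>M)"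
      by (intro nn_integral_mono order_trans[OF ennreal_leI[OF pt]])
         (auto simp: k_def ennreal_mult[symmetric] sum_ennreal intro!: order_eq_refl)
    also have "\<dots> = U n"
      unfolding U_def by (subst nn_integral_sum) (auto simp: nn_integral_cmult F G)
    finally show ?thesis .
  qed
  then show "eventually (\<lambda>n. (\<integral>\<^sup>+x. ennreal ((norm ((\<Sum>t\<in>I. c t *\<^sub>R F t x) - (\<Sum>t\<in>I. c t *\<^sub>R G t n x)))\<^sup>2) \<partial>M) \<le> U n) sequentially"
    by simp
qed

text \<open>From \<open>\<bar>a\<^sup>2 - b\<^sup>2\<bar> \<le> (1 + 1/\<epsilon>) (a - b)\<^sup>2 + \<epsilon> b\<^sup>2\<close>, integrated and with \<open>\<epsilon>\<close> small.\<close>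

lemma l2_norm_tendsto:
  fixes f :: "'a \<Rightarrow> 'e::euclidean_space"
  assumes [measurable]: "f \<in> borel_measurable M" "\<And>n. g n \<in> borel_measurable M"
    and g: "\<And>n. integrable M (\<lambda>x. (norm (g n x))\<^sup>2)"
    and lim: "(\<lambda>n::nat. \<integral>\<^sup>+x. ennreal ((norm (f x - g n x))\<^sup>2) \<partial>M) \<longlonglongrightarrow> 0"
  shows "integrable M (\<lambda>x. (norm (f x))\<^sup>2)"
    and "(\<lambda>n. \<integral>x. (norm (g n x))\<^sup>2 \<partial>M) \<longlonglongrightarrow> (\<integral>x. (norm (f x))\<^sup>2 \<partial>M)"
proof -
  have two: "(norm (v + w))\<^sup>2 \<le> 2 * (norm v)\<^sup>2 + 2 * (norm w)\<^sup>2" for v w :: 'e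
  proof -
    have "(norm (v + w))\<^sup>2 \<le> (norm v + norm w)\<^sup>2" by (intro power_mono norm_triangle_ineq) auto
    also have "\<dots> \<le> 2 * (norm v)\<^sup>2 + 2 * (norm w)\<^sup>2"
      using sum_squares_bound[of "norm v" "norm w"] by (simp add: power2_sum)
    finally show ?thesis .
  qed
  have "eventually (\<lambda>n. (\<integral>\<^sup>+x. ennreal ((norm (f x - g n x))\<^sup>2) \<partial>M) < 1) sequentially"
    using lim by (rule order_tendstoD) simp
  then obtain N where "(\<integral>\<^sup>+x. ennreal ((norm (f x - g N x))\<^sup>2) \<partial>M) < 1"
    by (auto simp: eventually_sequentially)
  then have "integrable M (\<lambda>x. (norm (f x - g N x))\<^sup>2)"
    by (intro integrableI_bounded) (auto intro: less_trans)
  then have "integrable M (\<lambda>x. 2 * (norm (f x - g N x))\<^sup>2 + 2 * (norm (g N x))\<^sup>2)" using g by auto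
  then show f: "integrable M (\<lambda>x. (norm (f x))\<^sup>2)"
    by (rule Bochner_Integration.integrable_bound) (use two[of "f x - g N x" "g N x" for x] in auto)
  have fg: "integrable M (\<lambda>x. (norm (f x - g n x))\<^sup>2)" for n
  proof (rule Bochner_Integration.integrable_bound)
    show "integrable M (\<lambda>x. 2 * (norm (f x))\<^sup>2 + 2 * (norm (g n x))\<^sup>2)" using f g by auto
    show "AE x in M. norm ((norm (f x - g n x))\<^sup>2) \<le> norm (2 * (norm (f x))\<^sup>2 + 2 * (norm (g n x))\<^sup>2)"
      using two[of "f x" "- g n x" for x] by auto
  qed measurable
  define d where "d n = (\<integral>x. (norm (f x - g n x))\<^sup>2 \<partial>M)" for n
  define q where "q = (\<integral>x. (norm (f x))\<^sup>2 \<partial>M)"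
  have q: "q \<ge> 0" by (simp add: q_def)
  have "(\<lambda>n. ennreal (d n)) \<longlonglongrightarrow> 0"
    using lim unfolding d_def by (simp add: nn_integral_eq_integral fg)
  then have d: "d \<longlonglongrightarrow> 0"
    by (subst (asm) ennreal_tendsto_0_iff) (simp_all add: d_def)
  have bound: "\<bar>(norm (g n x))\<^sup>2 - (norm (f x))\<^sup>2\<bar> \<le> (1 + 1 / \<epsilon>) * (norm (f x - g n x))\<^sup>2 + \<epsilon> * (norm (f x))\<^sup>2"
    if \<epsilon>: "\<epsilon> > 0" for \<epsilon> n x
  proof -
    define a b e where "a = norm (g n x)" and "b = norm (f x)" and "e = norm (f x - g n x)"
    have abs: "\<bar>a - b\<bar> \<le> e" "0 \<le> b" "0 \<le> e"
      using norm_triangle_ineq3[of "g n x" "f x"] by (auto simp: a_def b_def e_def norm_minus_commute)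
    have "a\<^sup>2 - b\<^sup>2 = (a - b) * ((a - b) + 2 * b)" by (simp add: power2_eq_square algebra_simps)
    also have "\<bar>\<dots>\<bar> \<le> e * (e + 2 * b)" using abs unfolding abs_mult by (intro mult_mono) auto
    also have "\<dots> = e\<^sup>2 + 2 * e * b" by (simp add: power2_eq_square algebra_simps)
    also have "2 * e * b \<le> e\<^sup>2 / \<epsilon> + \<epsilon> * b\<^sup>2"
    proof -
      have "0 \<le> (e - \<epsilon> * b)\<^sup>2 / \<epsilon>" using \<epsilon> by simp
      also have "\<dots> = e\<^sup>2 / \<epsilon> + \<epsilon> * b\<^sup>2 - 2 * e * b" using \<epsilon> by (simp add: power2_eq_square field_simps)
      finally show ?thesis by simp
    qed
    finally show ?thesis unfolding a_def b_def e_def by (simp add: algebra_simps)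
  qed
  have diff: "\<bar>(\<integral>x. (norm (g n x))\<^sup>2 \<partial>M) - q\<bar> \<le> (1 + 1 / \<epsilon>) * d n + \<epsilon> * q" if "\<epsilon> > 0" for \<epsilon> n
  proof -
    have "\<bar>(\<integral>x. (norm (g n x))\<^sup>2 \<partial>M) - q\<bar> = \<bar>\<integral>x. (norm (g n x))\<^sup>2 - (norm (f x))\<^sup>2 \<partial>M\<bar>"
      unfolding q_def using f g by simp
    also have "\<dots> \<le> (\<integral>x. \<bar>(norm (g n x))\<^sup>2 - (norm (f x))\<^sup>2\<bar> \<partial>M)"
      using integral_norm_bound[of M "\<lambda>x. (norm (g n x))\<^sup>2 - (norm (f x))\<^sup>2"] by simp
    also have "\<dots> \<le> (\<integral>x. (1 + 1 / \<epsilon>) * (norm (f x - g n x))\<^sup>2 + \<epsilon> * (norm (f x))\<^sup>2 \<partial>M)"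
      using f g fg bound[OF that] by (intro integral_mono) auto
    also have "\<dots> = (1 + 1 / \<epsilon>) * d n + \<epsilon> * q"
      unfolding d_def q_def using f fg by simp
    finally show ?thesis .
  qed
  show "(\<lambda>n. \<integral>x. (norm (g n x))\<^sup>2 \<partial>M) \<longlonglongrightarrow> (\<integral>x. (norm (f x))\<^sup>2 \<partial>M)"
    unfolding q_def[symmetric]
  proof (rule tendstoI)
    fix r :: real assume r: "r > 0"
    \<comment> \<open>Then \<open>\<epsilon> q \<le> r / 2\<close>, also for \<open>q = 0\<close>.\<close>
    define \<epsilon> where "\<epsilon> = r / (2 * (q + 1))"
    have \<epsilon>: "\<epsilon> > 0" using r q by (simp add: \<epsilon>_def)
    have "(\<lambda>n. (1 + 1 / \<epsilon>) * d n) \<longlonglongrightarrow> (1 + 1 / \<epsilon>) * 0" by (intro tendsto_intros d)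
    then have "eventually (\<lambda>n. (1 + 1 / \<epsilon>) * d n < r / 2) sequentially"
      by (rule order_tendstoD) (use r in simp)
    then show "eventually (\<lambda>n. dist (\<integral>x. (norm (g n x))\<^sup>2 \<partial>M) q < r) sequentially"
    proof eventually_elim
      case (elim n)
      have "\<epsilon> * q \<le> \<epsilon> * (q + 1)" using \<epsilon> by simp
      also have "\<dots> = r / 2" using q by (simp add: \<epsilon>_def field_simps)
      finally show ?case using diff[OF \<epsilon>, of n] elim unfolding dist_real_def by linarith
    qed
  qed
qed

text \<open>The exponential is a contraction, and \<open>\<bar>x\<bar> \<le> \<epsilon> + x\<^sup>2 / \<epsilon>\<close>.\<close>

lemma iexp_tendsto_of_l2:
  fixes f :: "'a \<Rightarrow> real"
  assumes M: "prob_space M"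
    and [measurable]: "f \<in> borel_measurable M" "\<And>n. g n \<in> borel_measurable M"
    and lim: "(\<lambda>n::nat. \<integral>\<^sup>+x. ennreal ((f x - g n x)\<^sup>2) \<partial>M) \<longlonglongrightarrow> 0"
  shows "(\<lambda>n. \<integral>x. iexp (g n x) \<partial>M) \<longlonglongrightarrow> (\<integral>x. iexp (f x) \<partial>M)"
proof (rule tendstoI)
  interpret prob_space M by fact
  fix r :: real assume r: "r > 0"
  define \<epsilon> where "\<epsilon> = r / 2"
  have \<epsilon>: "\<epsilon> > 0" using r by (simp add: \<epsilon>_def)
  have int: "integrable M (\<lambda>x. iexp (h x))" if "h \<in> borel_measurable M" for h :: "'a \<Rightarrow> real"
    using that by (intro integrable_const_bound[where B = 1]) auto
  have pt: "cmod (iexp (g n x) - iexp (f x)) \<le> \<epsilon> + (f x - g n x)\<^sup>2 / \<epsilon>" for n x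
  proof -
    have "iexp (g n x) - iexp (f x) = iexp (f x) * (iexp (g n x - f x) - 1)"
      by (simp add: algebra_simps exp_add[symmetric])
    then have "cmod (iexp (g n x) - iexp (f x)) = cmod (iexp (g n x - f x) - 1)"
      by (simp add: norm_mult)
    also have "\<dots> \<le> \<bar>g n x - f x\<bar>"
      using iexp_approx1[of "g n x - f x" 0] by simp
    also have "\<dots> \<le> \<epsilon> + (f x - g n x)\<^sup>2 / \<epsilon>"
    proof (cases "\<bar>g n x - f x\<bar> \<le> \<epsilon>")
      case True
      then show ?thesis using \<epsilon> by (intro add_increasing2) auto
    next
      case False
      then have "\<bar>g n x - f x\<bar> * \<epsilon> \<le> \<bar>g n x - f x\<bar> * \<bar>g n x - f x\<bar>"
        by (intro mult_left_mono) auto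
      moreover have "\<bar>g n x - f x\<bar> * \<bar>g n x - f x\<bar> = (f x - g n x)\<^sup>2"
        unfolding abs_mult_self_eq by (simp add: power2_eq_square algebra_simps)
      ultimately have "\<bar>g n x - f x\<bar> \<le> (f x - g n x)\<^sup>2 / \<epsilon>"
        using \<epsilon> by (simp add: pos_le_divide_eq)
      then show ?thesis using \<epsilon> by simp
    qed
    finally show ?thesis .
  qed
  have "eventually (\<lambda>n. (\<integral>\<^sup>+x. ennreal ((f x - g n x)\<^sup>2) \<partial>M) < ennreal (\<epsilon> * \<epsilon>)) sequentially"
    using lim by (rule order_tendstoD) (use \<epsilon> in simp)
  then show "eventually (\<lambda>n. dist (\<integral>x. iexp (g n x) \<partial>M) (\<integral>x. iexp (f x) \<partial>M) < r) sequentially"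
  proof eventually_elim
    case (elim n)
    have "(\<integral>\<^sup>+x. ennreal ((f x - g n x)\<^sup>2) \<partial>M) < \<infinity>"
      using elim by (rule less_trans) simp
    then have sq: "integrable M (\<lambda>x. (f x - g n x)\<^sup>2)"
      by (intro integrableI_bounded) auto
    with elim have lt: "(\<integral>x. (f x - g n x)\<^sup>2 \<partial>M) < \<epsilon> * \<epsilon>"
      by (simp add: nn_integral_eq_integral ennreal_less_iff)
    have "dist (\<integral>x. iexp (g n x) \<partial>M) (\<integral>x. iexp (f x) \<partial>M) = cmod (\<integral>x. iexp (g n x) - iexp (f x) \<partial>M)"
      by (simp add: dist_norm int)
    also have "\<dots> \<le> (\<integral>x. cmod (iexp (g n x) - iexp (f x)) \<partial>M)" by (rule integral_norm_bound)
    also have "\<dots> \<le> (\<integral>x. \<epsilon> + (f x - g n x)\<^sup>2 / \<epsilon> \<partial>M)"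
      using sq pt by (intro integral_mono) (auto intro!: integrable_norm Bochner_Integration.integrable_diff int)
    also have "\<dots> = \<epsilon> + (\<integral>x. (f x - g n x)\<^sup>2 \<partial>M) / \<epsilon>" using sq by (simp add: prob_space)
    also have "\<dots> < r" using lt \<epsilon> by (simp add: \<epsilon>_def field_simps)
    finally show ?case .
  qed
qed

lemma step_fun_measurable [measurable]: "step_fun xs \<in> borel_measurable borel"
proof (induction xs)
  case (Cons x xs)
  obtain a b c where "x = (a, b, c)" by (cases x) auto
  then have "step_fun (x # xs) = (\<lambda>u. indicator {a<..b} u *\<^sub>R c + step_fun xs u)"
    by (auto simp: step_fun_def)
  with Cons show ?case by simp
qed (simp add: step_fun_def[abs_def])

lemma step_fun_outside:
  assumes "step_list_on t xs" "u \<notin> {0..t}"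
  shows "step_fun xs u = 0"
  using assms
proof (induction xs)
  case (Cons x xs)
  obtain a b c where "x = (a, b, c)" by (cases x) auto
  with Cons show ?case by (auto simp: step_fun_def step_list_on_def indicator_def)
qed (simp add: step_fun_def)

lemma step_integral_measurable:
  fixes B :: "real \<Rightarrow> 'a \<Rightarrow> 'e::euclidean_space"
  assumes B: "\<And>t. 0 \<le> t \<Longrightarrow> B t \<in> borel_measurable M" and xs: "step_list_on t xs"
  shows "step_integral B xs \<in> borel_measurable M"
  using xs
proof (induction xs)
  case (Cons x xs)
  obtain a b c where x: "x = (a, b, c)" by (cases x) auto
  have "B a \<in> borel_measurable M" "B b \<in> borel_measurable M"
    using Cons.prems by (auto simp: x step_list_on_def intro!: B)
  moreover have "step_integral B (x # xs) = (\<lambda>\<omega>. c \<bullet> (B b \<omega> - B a \<omega>) + step_integral B xs \<omega>)"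
    by (auto simp: step_integral_def x)
  ultimately show ?case using Cons by (auto simp: step_list_on_def)
qed (simp add: step_integral_def[abs_def])

text \<open>Linear combinations of step functions at the level of lists: a combination of step integrals is
again a step integral, whose characteristic function is known.\<close>

definition step_combination :: "('i \<Rightarrow> real) \<Rightarrow> ('i \<Rightarrow> (real \<times> real \<times> 'e::euclidean_space) list) \<Rightarrow> 'i list
    \<Rightarrow> (real \<times> real \<times> 'e) list" where
  "step_combination c S ts = concat (map (\<lambda>t. map (\<lambda>(a, b, e). (a, b, c t *\<^sub>R e)) (S t)) ts)"

lemma step_fun_combination:
  fixes S :: "'i \<Rightarrow> (real \<times> real \<times> 'e::euclidean_space) list"
  shows "step_fun (step_combination c S ts) u = (\<Sum>t\<leftarrow>ts. c t *\<^sub>R step_fun (S t) u)"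
proof (induction ts)
  case (Cons t ts)
  have "step_fun (map (\<lambda>(a, b, e). (a, b, c t *\<^sub>R e)) xs) u = c t *\<^sub>R step_fun xs u" for xs :: "(real \<times> real \<times> 'e) list"
    by (induction xs) (auto simp: step_fun_def scaleR_add_right mult.commute)
  moreover have "step_fun (xs @ ys) u = step_fun xs u + step_fun ys u" for xs ys :: "(real \<times> real \<times> 'e) list"
    by (simp add: step_fun_def)
  ultimately show ?case using Cons by (simp add: step_combination_def)
qed (simp add: step_combination_def step_fun_def)

lemma step_integral_combination:
  fixes S :: "'i \<Rightarrow> (real \<times> real \<times> 'e::euclidean_space) list"
  shows "step_integral B (step_combination c S ts) \<omega> = (\<Sum>t\<leftarrow>ts. c t * step_integral B (S t) \<omega>)"
proof (induction ts)
  case (Cons t ts)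
  have "step_integral B (map (\<lambda>(a, b, e). (a, b, c t *\<^sub>R e)) xs) \<omega> = c t * step_integral B xs \<omega>" for xs :: "(real \<times> real \<times> 'e) list"
    by (induction xs) (auto simp: step_integral_def algebra_simps)
  moreover have "step_integral B (xs @ ys) \<omega> = step_integral B xs \<omega> + step_integral B ys \<omega>" for xs ys :: "(real \<times> real \<times> 'e) list"
    by (simp add: step_integral_def)
  ultimately show ?case using Cons by (simp add: step_combination_def)
qed (simp add: step_combination_def step_integral_def)

lemma step_list_on_combination:
  assumes "\<And>t. t \<in> set ts \<Longrightarrow> step_list_on t (S t)" "\<And>t. t \<in> set ts \<Longrightarrow> t \<le> T"
  shows "step_list_on T (step_combination c S ts)"
  using assms by (force simp: step_list_on_def step_combination_def)

text \<open>Linear combinations of the approximating step integrals have Gaussian characteristic functions, and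
both sides converge: the characteristic functions by \<open>L\<^sup>2\<close> convergence on the probability space, the
variances by \<open>L\<^sup>2\<close> convergence of the integrands.\<close>

proposition wiener_integrals_gaussian_family:
  fixes B :: "real \<Rightarrow> 'a \<Rightarrow> 'e::euclidean_space"
  assumes B: "brownian_motion M B" and I: "finite I"
    and X: "\<And>t. t \<in> I \<Longrightarrow> has_wiener_integral M B (f t) t (X t)"
  defines "F \<equiv> \<lambda>t u. indicator {0..t} u *\<^sub>R f t u"
  shows "gaussian_family M I X (\<lambda>s t. \<integral>u. F s u \<bullet> F t u \<partial>lborel)"
proof -
  note M = brownian_motionD(1)[OF B]
  have "\<exists>S. \<forall>t\<in>I. (\<forall>n::nat. step_list_on t (S t n)) \<and>
        (\<lambda>n. \<integral>\<^sup>+u\<in>{0..t}. ennreal ((norm (f t u - step_fun (S t n) u))\<^sup>2) \<partial>lborel) \<longlonglongrightarrow> 0 \<and>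
        (\<lambda>n. \<integral>\<^sup>+\<omega>. ennreal ((X t \<omega> - step_integral B (S t n) \<omega>)\<^sup>2) \<partial>M) \<longlonglongrightarrow> 0"
    using X unfolding has_wiener_integral_def by (intro bchoice) blast
  then obtain S where S: "\<And>t n. t \<in> I \<Longrightarrow> step_list_on t (S t n)"
    and Sf: "\<And>t. t \<in> I \<Longrightarrow> (\<lambda>n. \<integral>\<^sup>+u\<in>{0..t}. ennreal ((norm (f t u - step_fun (S t n) u))\<^sup>2) \<partial>lborel) \<longlonglongrightarrow> 0"
    and SX: "\<And>t. t \<in> I \<Longrightarrow> (\<lambda>n. \<integral>\<^sup>+\<omega>. ennreal ((X t \<omega> - step_integral B (S t n) \<omega>)\<^sup>2) \<partial>M) \<longlonglongrightarrow> 0"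
    by blast
  have F[measurable]: "F t \<in> borel_measurable lborel" if "t \<in> I" for t
    using X[OF that] by (simp add: F_def has_wiener_integral_def set_borel_measurable_def)
  have Xm: "X t \<in> borel_measurable M" if "t \<in> I" for t
    using X[OF that] by (simp add: has_wiener_integral_def)
  have Sm: "step_integral B (S t n) \<in> borel_measurable M" if "t \<in> I" for t n
    using S[OF that] by (intro step_integral_measurable brownian_motionD(2)[OF B])
  have SF: "(\<lambda>n. \<integral>\<^sup>+u. ennreal ((norm (F t u - step_fun (S t n) u))\<^sup>2) \<partial>lborel) \<longlonglongrightarrow> 0" if t: "t \<in> I" for t
  proof -
    have "(\<integral>\<^sup>+u. ennreal ((norm (F t u - step_fun (S t n) u))\<^sup>2) \<partial>lborel)
        = (\<integral>\<^sup>+u\<in>{0..t}. ennreal ((norm (f t u - step_fun (S t n) u))\<^sup>2) \<partial>lborel)" for n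
      by (intro nn_integral_cong) (auto simp: F_def indicator_def step_fun_outside[OF S[OF t]])
    then show ?thesis using Sf[OF t] by simp
  qed
  have F2: "integrable lborel (\<lambda>u. (norm (F t u))\<^sup>2)" if t: "t \<in> I" for t
    by (rule l2_norm_tendsto(1)[OF F[OF t] _ char_step_integral(2)[OF B S[OF t]] SF[OF t]]) simp
  have FF: "integrable lborel (\<lambda>u. F s u \<bullet> F t u)" if "s \<in> I" "t \<in> I" for s t
  proof (rule Bochner_Integration.integrable_bound)
    show "integrable lborel (\<lambda>u. (norm (F s u))\<^sup>2 + (norm (F t u))\<^sup>2)" using F2 that by auto
    show "(\<lambda>u. F s u \<bullet> F t u) \<in> borel_measurable lborel" using F that by auto
    have "\<bar>v \<bullet> w\<bar> \<le> (norm v)\<^sup>2 + (norm w)\<^sup>2" for v w :: 'e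
      using Cauchy_Schwarz_ineq2[of v w] sum_squares_bound[of "norm v" "norm w"] mult_nonneg_nonneg[of "norm v" "norm w"]
      by simp
    then show "AE u in lborel. norm (F s u \<bullet> F t u) \<le> norm ((norm (F s u))\<^sup>2 + (norm (F t u))\<^sup>2)" by auto
  qed
  show ?thesis
    unfolding gaussian_family_def
  proof (intro conjI ballI allI Xm)
    fix c
    define ts where "ts = sorted_list_of_set I"
    have ts: "set ts = I" "distinct ts" using I by (auto simp: ts_def)
    define C where "C n = step_combination c (\<lambda>t. S t n) ts" for n
    have Cf: "step_fun (C n) u = (\<Sum>t\<in>I. c t *\<^sub>R step_fun (S t n) u)" for n u
      using ts by (simp add: C_def step_fun_combination sum_list_distinct_conv_sum_set)
    have Ci: "step_integral B (C n) \<omega> = (\<Sum>t\<in>I. c t *\<^sub>R step_integral B (S t n) \<omega>)" for n \<omega>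
      using ts by (simp add: C_def step_integral_combination sum_list_distinct_conv_sum_set)
    have "step_list_on (Max I) (C n)" for n
      unfolding C_def using ts S I by (intro step_list_on_combination) auto
    note char = char_step_integral[OF B this]
    have 1: "(\<lambda>n. \<integral>\<omega>. iexp (step_integral B (C n) \<omega>) \<partial>M) \<longlonglongrightarrow> (\<integral>\<omega>. iexp (\<Sum>t\<in>I. c t *\<^sub>R X t \<omega>) \<partial>M)"
      unfolding Ci
    proof (rule iexp_tendsto_of_l2[OF M])
      have "(\<lambda>n. \<integral>\<^sup>+\<omega>. ennreal ((norm ((\<Sum>t\<in>I. c t *\<^sub>R X t \<omega>) - (\<Sum>t\<in>I. c t *\<^sub>R step_integral B (S t n) \<omega>)))\<^sup>2) \<partial>M) \<longlonglongrightarrow> 0"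
        by (rule l2_tendsto_sum[OF I]) (simp_all add: Xm Sm SX)
      then show "(\<lambda>n. \<integral>\<^sup>+\<omega>. ennreal (((\<Sum>t\<in>I. c t *\<^sub>R X t \<omega>) - (\<Sum>t\<in>I. c t *\<^sub>R step_integral B (S t n) \<omega>))\<^sup>2) \<partial>M) \<longlonglongrightarrow> 0"
        by simp
    qed (use Xm Sm in \<open>auto intro!: borel_measurable_sum\<close>)
    have 2: "(\<lambda>n. \<integral>u. (norm (step_fun (C n) u))\<^sup>2 \<partial>lborel) \<longlonglongrightarrow> (\<integral>u. (norm (\<Sum>t\<in>I. c t *\<^sub>R F t u))\<^sup>2 \<partial>lborel)"
    proof (rule l2_norm_tendsto(2))
      show "(\<lambda>n. \<integral>\<^sup>+u. ennreal ((norm ((\<Sum>t\<in>I. c t *\<^sub>R F t u) - step_fun (C n) u))\<^sup>2) \<partial>lborel) \<longlonglongrightarrow> 0"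
        unfolding Cf by (rule l2_tendsto_sum[OF I]) (simp_all add: F SF)
      show "(\<lambda>u. \<Sum>t\<in>I. c t *\<^sub>R F t u) \<in> borel_measurable lborel"
        using F by (intro borel_measurable_sum borel_measurable_scaleR) auto
    qed (auto intro: char(2))
    have "(\<lambda>n. complex_of_real (exp (- (\<integral>u. (norm (step_fun (C n) u))\<^sup>2 \<partial>lborel) / 2)))
        \<longlonglongrightarrow> complex_of_real (exp (- (\<integral>u. (norm (\<Sum>t\<in>I. c t *\<^sub>R F t u))\<^sup>2 \<partial>lborel) / 2))"
      by (intro tendsto_intros 2) auto
    with 1 have "(\<integral>\<omega>. iexp (\<Sum>t\<in>I. c t *\<^sub>R X t \<omega>) \<partial>M)
        = complex_of_real (exp (- (\<integral>u. (norm (\<Sum>t\<in>I. c t *\<^sub>R F t u))\<^sup>2 \<partial>lborel) / 2))"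
      unfolding char(1) by (rule LIMSEQ_unique)
    also have "(\<integral>u. (norm (\<Sum>t\<in>I. c t *\<^sub>R F t u))\<^sup>2 \<partial>lborel)
        = (\<integral>u. (\<Sum>s\<in>I. \<Sum>t\<in>I. c s * c t * (F s u \<bullet> F t u)) \<partial>lborel)"
      by (simp add: power2_norm_eq_inner inner_sum_left inner_sum_right sum_distrib_left mult_ac inner_commute)
    also have "\<dots> = (\<Sum>s\<in>I. \<Sum>t\<in>I. c s * c t * (\<integral>u. F s u \<bullet> F t u \<partial>lborel))"
      by (simp add: Bochner_Integration.integral_sum integrable_sum FF)
    finally show "(\<integral>\<omega>. iexp (\<Sum>t\<in>I. c t * X t \<omega>) \<partial>M) = complex_of_real (exp (-
        (\<Sum>s\<in>I. \<Sum>t\<in>I. c s * c t * (\<integral>u. F s u \<bullet> F t u \<partial>lborel)) / 2))"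
      by simp
  qed
qed

lemma gaussian_family_scale:
  assumes X: "gaussian_family M I X K" and Vm: "\<And>t. t \<in> I \<Longrightarrow> V t \<in> borel_measurable M"
    and V: "\<And>t. t \<in> I \<Longrightarrow> AE \<omega> in M. V t \<omega> = r * X t \<omega>" and I: "finite I"
  shows "gaussian_family M I V (\<lambda>s t. r\<^sup>2 * K s t)"
  unfolding gaussian_family_def
proof (intro conjI ballI allI Vm)
  fix c
  have Xm: "\<And>t. t \<in> I \<Longrightarrow> X t \<in> borel_measurable M" using X by (simp add: gaussian_family_def)
  have "AE \<omega> in M. \<forall>t\<in>I. V t \<omega> = r * X t \<omega>" using V I by (subst AE_finite_all) auto
  then have "(\<integral>\<omega>. iexp (\<Sum>t\<in>I. c t * V t \<omega>) \<partial>M) = (\<integral>\<omega>. iexp (\<Sum>t\<in>I. (r * c t) * X t \<omega>) \<partial>M)"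
    using Xm Vm by (intro integral_cong_AE) (auto simp: mult_ac intro!: borel_measurable_sum measurable_compose[where f = "\<lambda>\<omega>. sum _ I" and g = iexp])
  also have "\<dots> = complex_of_real (exp (- (\<Sum>i\<in>I. \<Sum>j\<in>I. (r * c i) * (r * c j) * K i j) / 2))"
    by (rule X[unfolded gaussian_family_def, THEN conjunct2, rule_format])
  also have "(\<Sum>i\<in>I. \<Sum>j\<in>I. (r * c i) * (r * c j) * K i j) = (\<Sum>i\<in>I. \<Sum>j\<in>I. c i * c j * (r\<^sup>2 * K i j))"
    by (simp add: power2_eq_square mult_ac)
  finally show "(\<integral>\<omega>. iexp (\<Sum>t\<in>I. c t * V t \<omega>) \<partial>M)
      = complex_of_real (exp (- (\<Sum>i\<in>I. \<Sum>j\<in>I. c i * c j * (r\<^sup>2 * K i j)) / 2))" .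
qed

section \<open>Comparison of hitting times\<close>

text \<open>A left eigenvector of \<open>P\<close> is one of every power of \<open>P\<close>; the exponential series converges because
multiplication by \<open>P\<close> is a bounded operator.\<close>

lemma matrix_exp_left_eigenvector:
  fixes P :: "real^'n^'n" and w :: "real^'n"
  assumes w: "w v* P = z *\<^sub>R w"
  shows "w v* matrix_exp P = exp z *\<^sub>R w"
proof -
  define pw where "pw k = ((\<lambda>Q. P ** Q) ^^ k) (mat 1)" for k
  have "linear (\<lambda>Q. P ** Q :: real^'n^'n)"
    by (rule linearI) (auto simp: vec_eq_iff matrix_matrix_mult_def sum.distrib sum_distrib_left algebra_simps)
  then obtain C where C: "C > 0" "\<And>Q :: real^'n^'n. norm (P ** Q) \<le> C * norm Q"
    by (rule linear_bounded_pos) blast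
  have norm_pw: "norm (pw k) \<le> C ^ k * norm (mat 1 :: real^'n^'n)" for k
  proof (induction k)
    case (Suc k)
    have "norm (pw (Suc k)) \<le> C * norm (pw k)" using C(2) by (simp add: pw_def)
    also have "\<dots> \<le> C * (C ^ k * norm (mat 1 :: real^'n^'n))" using Suc C by (intro mult_left_mono) auto
    finally show ?case by (simp add: mult.assoc)
  qed (simp add: pw_def)
  have "summable (\<lambda>k. (1 / fact k) *\<^sub>R pw k)"
  proof (rule summable_comparison_test')
    show "summable (\<lambda>k. inverse (fact k) * C ^ k * norm (mat 1 :: real^'n^'n))"
      by (intro summable_mult2 summable_exp)
    show "norm ((1 / fact k) *\<^sub>R pw k) \<le> inverse (fact k) * C ^ k * norm (mat 1 :: real^'n^'n)" for k
      using norm_pw[of k] mult_left_mono[OF norm_pw[of k], of "inverse (fact k)"]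
      by (simp add: divide_inverse mult.assoc)
  qed
  moreover have "linear (\<lambda>Q :: real^'n^'n. w v* Q)"
    by (rule linearI) (auto simp: vec_eq_iff vector_matrix_mult_def sum.distrib sum_distrib_left algebra_simps)
  ultimately have "w v* matrix_exp P = (\<Sum>k. w v* ((1 / fact k) *\<^sub>R pw k))"
    unfolding matrix_exp_def pw_def[symmetric]
    by (intro bounded_linear.suminf) (auto simp: linear_conv_bounded_linear)
  moreover have "w v* ((1 / fact k) *\<^sub>R pw k) = (z ^ k /\<^sub>R fact k) *\<^sub>R w" for k
  proof -
    have "w v* pw k = z ^ k *\<^sub>R w"
    proof (induction k)
      case 0
      show ?case by (simp add: pw_def)
    next
      case (Suc k)
      have "w v* pw (Suc k) = (w v* P) v* pw k"
        by (simp add: pw_def vector_matrix_mul_assoc)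
      also have "\<dots> = z *\<^sub>R (w v* pw k)" by (simp add: w scaleR_vector_matrix_assoc)
      finally show ?case using Suc by simp
    qed
    then show ?thesis
      by (simp add: vector_scaleR_matrix_ac divide_inverse)
  qed
  moreover have "(\<Sum>k. (z ^ k /\<^sub>R fact k) *\<^sub>R w) = exp z *\<^sub>R w"
    by (intro sums_unique[symmetric] bounded_linear.sums[OF bounded_linear_scaleR_left] exp_converges)
  ultimately show ?thesis by simp
qed

text \<open>The row \<open>(1, -1)\<close> is a left eigenvector of the matrix with eigenvalue \<open>-\<alpha>\<close>. This is why the vector
integrand reduces to a scalar power kernel.\<close>

lemma difference_row_matrix_rpow:
  assumes "x > 0"
  shows "vector [1, -1] v* matrix_rpow x (A_mat \<alpha> \<alpha>) = x powr (- \<alpha>) *\<^sub>R (vector [1, -1] :: real^2)"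
proof -
  have "vector [1, -1] v* (ln x *\<^sub>R A_mat \<alpha> \<alpha>) = (- \<alpha> * ln x) *\<^sub>R (vector [1, -1] :: real^2)"
    by (simp add: vec_eq_iff forall_2 vector_matrix_mult_def sum_2 A_mat_def)
  from matrix_exp_left_eigenvector[OF this] show ?thesis
    using assms by (simp add: matrix_rpow_def powr_def)
qed

text \<open>Both cases of the definition give the same covariance: for \<open>\<alpha> < 1/2\<close> the factor \<open>2\<close> is the squared
norm of \<open>(1, -1)\<close>, for \<open>\<alpha> \<ge> 1/2\<close> it is the square of \<open>sqrt 2\<close>.\<close>

lemma sym_V_process_gaussian_family:
  assumes V: "sym_V_process M \<alpha> V" and I: "finite I" "I \<subseteq> {0<..}"
  shows "gaussian_family M I V (ou_cov \<alpha>)"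
proof -
  have Vm: "V t \<in> borel_measurable M" if "t \<in> I" for t
    using V I that by (auto simp: sym_V_process_def continuous_process_from_0_def)
  show ?thesis
  proof (cases "\<alpha> < 1/2")
    case True
    define f :: "real \<Rightarrow> real \<Rightarrow> real^2" where
      "f t s = vector [1, -1] v* matrix_rpow (t / s) (A_mat \<alpha> \<alpha>)" for t s
    obtain B :: "real \<Rightarrow> 'a \<Rightarrow> real^2" where B: "brownian_motion M B"
      and W: "\<And>t. t > 0 \<Longrightarrow> has_wiener_integral M B (f t) t (V t)"
      using V True unfolding sym_V_process_def f_def by auto
    have "gaussian_family M I V (\<lambda>s t. \<integral>u. (indicator {0..s} u *\<^sub>R f s u) \<bullet> (indicator {0..t} u *\<^sub>R f t u) \<partial>lborel)"
      using I by (intro wiener_integrals_gaussian_family[OF B] W) auto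
    moreover have "(\<integral>u. (indicator {0..s} u *\<^sub>R f s u) \<bullet> (indicator {0..t} u *\<^sub>R f t u) \<partial>lborel) = ou_cov \<alpha> s t"
      if st: "s \<in> I" "t \<in> I" for s t
    proof -
      have pos: "0 < s" "0 < t" using I st by auto
      have pk: "indicator {0..r} u *\<^sub>R f r u = power_kernel \<alpha> r u *\<^sub>R vector [1, -1]" if "u \<noteq> 0" "r > 0" for r u
        using that by (cases "u \<in> {0..r}")
          (auto simp: power_kernel_def f_def difference_row_matrix_rpow)
      have "(indicator {0..s} u *\<^sub>R f s u) \<bullet> (indicator {0..t} u *\<^sub>R f t u)
          = 2 * (power_kernel \<alpha> s u * power_kernel \<alpha> t u)" if "u \<noteq> 0" for u
        unfolding pk[OF that pos(1)] pk[OF that pos(2)] by (simp add: inner_vec_def sum_2)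
      note eq = this
      have m: "(\<lambda>u. indicator {0..r} u *\<^sub>R f r u) \<in> borel_measurable lborel" if "r \<in> {s, t}" for r
        using W[of r] pos that by (auto simp: has_wiener_integral_def set_borel_measurable_def)
      have "(\<integral>u. (indicator {0..s} u *\<^sub>R f s u) \<bullet> (indicator {0..t} u *\<^sub>R f t u) \<partial>lborel)
          = (\<integral>u. 2 * (power_kernel \<alpha> s u * power_kernel \<alpha> t u) \<partial>lborel)"
      proof (rule integral_cong_AE)
        show "(\<lambda>u. (indicator {0..s} u *\<^sub>R f s u) \<bullet> (indicator {0..t} u *\<^sub>R f t u)) \<in> borel_measurable lborel"
          by (intro borel_measurable_inner m) auto
        show "AE u in lborel. (indicator {0..s} u *\<^sub>R f s u) \<bullet> (indicator {0..t} u *\<^sub>R f t u)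
            = 2 * (power_kernel \<alpha> s u * power_kernel \<alpha> t u)"
          using AE_lborel_singleton[of "0 :: real"] by eventually_elim (rule eq)
      qed simp
      then show ?thesis by (simp add: ou_cov_def)
    qed
    ultimately show ?thesis by (simp add: gaussian_family_def)
  next
    case False
    then obtain W :: "real \<Rightarrow> 'a \<Rightarrow> real" where W: "brownian_motion M W"
      and "\<forall>t>0. \<exists>X. has_wiener_integral M W (\<lambda>s. (t / s) powr (- \<alpha>)) t X \<and> (AE \<omega> in M. V t \<omega> = sqrt 2 * X \<omega>)"
      using V unfolding sym_V_process_def by auto
    then obtain X where X: "\<And>t. t > 0 \<Longrightarrow> has_wiener_integral M W (\<lambda>s. (t / s) powr (- \<alpha>)) t (X t)"
      and VX: "\<And>t. t > 0 \<Longrightarrow> AE \<omega> in M. V t \<omega> = sqrt 2 * X t \<omega>" by metis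
    have "gaussian_family M I X (\<lambda>s t. \<integral>u. (indicator {0..s} u *\<^sub>R (s / u) powr (- \<alpha>)) \<bullet> (indicator {0..t} u *\<^sub>R (t / u) powr (- \<alpha>)) \<partial>lborel)"
      using I by (intro wiener_integrals_gaussian_family[OF W] X) auto
    then have "gaussian_family M I V (\<lambda>s t. (sqrt 2)\<^sup>2 * (\<integral>u. (indicator {0..s} u *\<^sub>R (s / u) powr (- \<alpha>)) \<bullet> (indicator {0..t} u *\<^sub>R (t / u) powr (- \<alpha>)) \<partial>lborel))"
      by (rule gaussian_family_scale[OF _ Vm _ I(1)]) (use VX I in auto)
    then show ?thesis by (simp add: ou_cov_def[abs_def] power_kernel_def)
  qed
qed

lemma hit_time_comparison:
  assumes M: "prob_space M" and N: "prob_space N"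
    and V: "continuous_process_from_0 M V" and V': "continuous_process_from_0 N V'"
    and K: "\<And>I. finite I \<Longrightarrow> I \<subseteq> {0<..} \<Longrightarrow> gaussian_family M I V K"
    and K': "\<And>I. finite I \<Longrightarrow> I \<subseteq> {0<..} \<Longrightarrow> gaussian_family N I V' K'"
    and sym: "\<And>s t. K' s t = K' t s"
    and psd: "\<And>I. finite I \<Longrightarrow> I \<subseteq> {0<..} \<Longrightarrow> psd_on I (\<lambda>s t. K s t - K' s t)"
  shows "st_le M (hit_time V) N (hit_time V') \<and>
    (\<forall>q>0. moment M (hit_time V) q \<le> moment N (hit_time V') q)"
proof -
  have "st_le M (hit_time V) N (hit_time V')"
    by (intro st_le_hit_timeI M N V V' gaussian_box_prob_antimono[OF M N, where K = K and K' = K'] K K' sym psd)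
  then show ?thesis using st_le_imp_moment_le[OF M N] by blast
qed

lemma V_process_gaussian_family:
  assumes "V_process M \<mu> lam V" "finite I" "I \<subseteq> {0<..}"
  shows "gaussian_family M I V (V_cov \<mu> lam)"
  using assms by (intro centered_gaussian_process_family) (auto simp: V_process_def subset_eq less_imp_le)

lemma V_cov_antimono_psd:
  assumes mu: "\<mu> < 1/4" and le: "lam \<le> lam'" and I: "finite I" "I \<subseteq> {0<..}"
  shows "psd_on I (\<lambda>s t. V_cov \<mu> lam s t - V_cov \<mu> lam' s t)"
  unfolding psd_on_def
proof (intro conjI ballI allI)
  have diff: "V_cov \<mu> lam s t - V_cov \<mu> lam' s t = (lam' - lam) * C_cov \<mu> s t" for s t
    by (simp add: V_cov_def Let_def algebra_simps)
  show "V_cov \<mu> lam s t - V_cov \<mu> lam' s t = V_cov \<mu> lam t s - V_cov \<mu> lam' t s" for s t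
    unfolding diff by (simp add: C_cov_commute)
  fix c
  have "(\<Sum>s\<in>I. \<Sum>t\<in>I. c s * c t * (V_cov \<mu> lam s t - V_cov \<mu> lam' s t))
      = (lam' - lam) * (\<Sum>s\<in>I. \<Sum>t\<in>I. c s * c t * C_cov \<mu> s t)"
    unfolding diff by (simp add: sum_distrib_left mult_ac)
  also have "\<dots> \<ge> 0"
    using le psd_onD(2)[OF C_cov_psd[OF mu I]] by (intro mult_nonneg_nonneg) auto
  finally show "0 \<le> (\<Sum>s\<in>I. \<Sum>t\<in>I. c s * c t * (V_cov \<mu> lam s t - V_cov \<mu> lam' s t))" .
qed

theorem theorem6p8:
  fixes M :: "'a measure" and N :: "'b measure"
  shows
    "(\<forall>\<mu> lam lam' :: real. \<forall>V V'.
        -1 \<le> \<mu> \<and> \<mu> < 1/4 \<and> lam \<in> Lambda_set \<mu> \<and> lam' \<in> Lambda_set \<mu> \<and> lam \<le> lam' \<and>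
        V_process M \<mu> lam V \<and> V_process N \<mu> lam' V' \<longrightarrow>
          st_le M (hit_time V) N (hit_time V') \<and>
          (\<forall>q>0. moment M (hit_time V) q \<le> moment N (hit_time V') q)) \<and>
     (\<forall>\<alpha> \<alpha>' :: real. \<forall>V V'.
        -1/2 < \<alpha> \<and> \<alpha> \<le> \<alpha>' \<and> \<alpha>' < 1 \<and>
        sym_V_process M \<alpha> V \<and> sym_V_process N \<alpha>' V' \<longrightarrow>
          st_le M (hit_time V) N (hit_time V') \<and>
          (\<forall>q>0. moment M (hit_time V) q \<le> moment N (hit_time V') q))"
proof (intro conjI[where P = "\<forall>\<mu> lam lam' V V'. _ \<mu> lam lam' V V'"] allI impI; elim conjE)
  fix \<mu> lam lam' :: real and V V'
  assume mu: "\<mu> < 1/4" and le: "lam \<le> lam'"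
    and V: "V_process M \<mu> lam V" and V': "V_process N \<mu> lam' V'"
  show "st_le M (hit_time V) N (hit_time V') \<and>
      (\<forall>q>0. moment M (hit_time V) q \<le> moment N (hit_time V') q)"
  proof (rule hit_time_comparison)
    show "V_cov \<mu> lam' s t = V_cov \<mu> lam' t s" for s t
      by (simp add: V_cov_def min.commute max.commute C_cov_commute)
  qed (use V V' in \<open>auto simp: V_process_def intro: V_process_gaussian_family V_cov_antimono_psd[OF mu le]\<close>)
next
  fix \<alpha> \<alpha>' :: real and V V'
  assume a: "-1/2 < \<alpha>" "\<alpha> \<le> \<alpha>'"
    and V: "sym_V_process M \<alpha> V" and V': "sym_V_process N \<alpha>' V'"
  show "st_le M (hit_time V) N (hit_time V') \<and>
      (\<forall>q>0. moment M (hit_time V) q \<le> moment N (hit_time V') q)"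
  proof (rule hit_time_comparison)
    show "ou_cov \<alpha>' s t = ou_cov \<alpha>' t s" for s t by (rule ou_cov_commute)
  qed (use V V' in \<open>auto simp: sym_V_process_def intro: sym_V_process_gaussian_family ou_cov_antimono_psd[OF a]\<close>)
qed

end
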